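(* Let $A=T(a)+E_a$ be a $\mathcal{CQT}$ matrix with symbol $a(z)\in\mathcal W_1$ and with spectrum $\Lambda$ (as a bounded operator on $\ell^2(\mathbb Z^+)$). Let $f(z)$ be an analytic function defined on the compact domain $\Omega\subset\mathbb C$ which encloses $\Lambda$ (that is, $\Lambda$ is contained in the interior of $\Omega$), and such that $a(\mathbb T)\subset\Omega$. Assume that the boundary $\partial\Omega$, a simple closed curve, admits a differentiable arc length parametrization $\gamma:[s_0,s_1]\to\partial\Omega$. Then the matrix \[ f(A):=\frac1{2\pi\mathbf i}\int_{\partial\Omega}f(z)(zI-A)^{-1}\,dz \] is a $\mathcal{CQT}$ matrix. Moreover, if $A\in\mathcal{AQT}$ then $f(A)\in\mathcal{AQT}$.
   Context: $\mathbf i$ is the imaginary unit; $\mathbb T=\{z\in\mathbb C:|z|=1\}$; $\mathbb Z^+$ is the set of positive integers. The Wiener class $\mathcal W$ is the set of complex Laurent series $a(z)=\sum_{i\in\mathbb Z}a_iz^i$ (viewed as functions on $\mathbb T$) with $\|a\|_{\mathcal W}:=\sum_{i\in\mathbb Z}|a_i|<\infty$. $\mathcal W_1:=\{a\in\mathcal W: a'\in\mathcal W\}$, where $a'(z)=\sum_{i} i a_i z^{i-1}$. For $a\in\mathcal W$, $T(a)=(t_{i,j})_{i,j\in\mathbb Z^+}$ is the semi-infinite Toeplitz matrix with $t_{i,j}=a_{j-i}$; $a$ is called its symbol. $\mathcal F$ is the set of semi-infinite complex matrices $F=(f_{i,j})_{i,j\in\mathbb Z^+}$ with $\|F\|_{\mathcal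 F}:=\sum_{i,j}|f_{i,j}|<\infty$. $\mathcal{CQT}$ is the set of matrices $T(a)+E$ with $a\in\mathcal W_1$ and $E\in\mathcal F$; it is known to be a Banach algebra with submultiplicative norm $\|T(a)+E\|_{\mathcal{CQT}}:=\|a\|_{\mathcal W}+\|a'\|_{\mathcal W}+\|E\|_{\mathcal F}$. $\mathcal{AQT}$ is the set of matrices $T(a)+E$ with $E\in\mathcal F$ and $a(z)$ analytic in an open annulus containing $\mathbb T$. Every $\mathcal{CQT}$ matrix defines a bounded linear operator on $\ell^2(\mathbb Z^+)$, and $\Lambda=\{z\in\mathbb C: zI-A\text{ is not invertible on }\ell^2(\mathbb Z^+)\}$. "$f$ analytic on the compact set $\Omega$" means analytic in a neighbourhood of $\Omega$. The integral is the operator-valued line integral over $\partial\Omega$, positively oriented. *)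

theory Defs
  imports "HOL-Complex_Analysis.Complex_Analysis"
begin

subsection \<open>The Hilbert space of square-summable sequences\<close>

text \<open>The index set of positive integers is represented by \<^typ>\<open>nat\<close>; index \<open>i\<close> stands for \<open>i + 1\<close>.\<close>

typedef ell2 = "{x :: nat \<Rightarrow> complex. (\<lambda>i. (cmod (x i))\<^sup>2) summable_on UNIV}"
  morphisms ell2_nth Abs_ell2
  by (rule exI[of _ "\<lambda>_. 0"]) simp

setup_lifting type_definition_ell2

lemma ell2_scale_aux:
  assumes "(\<lambda>i. (cmod (x i))\<^sup>2) summable_on (UNIV :: nat set)"
  shows "(\<lambda>i. (cmod (c * x i))\<^sup>2) summable_on UNIV"
  using summable_on_cmult_right[OF assms, of "(cmod c)\<^sup>2"]
  by (simp add: norm_mult power_mult_distrib)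

lemma ell2_add_aux:
  assumes "(\<lambda>i. (cmod (x i))\<^sup>2) summable_on (UNIV :: nat set)"
    and "(\<lambda>i. (cmod (y i))\<^sup>2) summable_on UNIV"
  shows "(\<lambda>i. (cmod (x i + y i))\<^sup>2) summable_on UNIV"
proof (rule summable_on_comparison_test)
  show "(\<lambda>i. 2 * (cmod (x i))\<^sup>2 + 2 * (cmod (y i))\<^sup>2) summable_on UNIV"
    by (intro summable_on_add summable_on_cmult_right assms)
  fix i
  have "(cmod (x i + y i))\<^sup>2 \<le> (cmod (x i) + cmod (y i))\<^sup>2"
    by (intro power_mono norm_triangle_ineq) auto
  also have "\<dots> \<le> 2 * (cmod (x i))\<^sup>2 + 2 * (cmod (y i))\<^sup>2"
    using sum_squares_bound[of "cmod (x i)" "cmod (y i)"] by (simp add: power2_sum)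
  finally show "(cmod (x i + y i))\<^sup>2 \<le> 2 * (cmod (x i))\<^sup>2 + 2 * (cmod (y i))\<^sup>2" .
qed auto

lift_definition cscale :: "complex \<Rightarrow> ell2 \<Rightarrow> ell2" is "\<lambda>c x i. c * x i"
  by (rule ell2_scale_aux)

instantiation ell2 :: real_normed_vector
begin

lift_definition zero_ell2 :: ell2 is "\<lambda>_. 0" by simp

lift_definition plus_ell2 :: "ell2 \<Rightarrow> ell2 \<Rightarrow> ell2" is "\<lambda>x y i. x i + y i"
  by (rule ell2_add_aux)

lift_definition uminus_ell2 :: "ell2 \<Rightarrow> ell2" is "\<lambda>x i. - x i" by simp

lift_definition minus_ell2 :: "ell2 \<Rightarrow> ell2 \<Rightarrow> ell2" is "\<lambda>x y i. x i - y i"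
  subgoal for x y using ell2_add_aux[of x "\<lambda>i. - y i"] by simp
  done

definition scaleR_ell2 :: "real \<Rightarrow> ell2 \<Rightarrow> ell2" where
  "scaleR_ell2 r = cscale (complex_of_real r)"

lift_definition norm_ell2 :: "ell2 \<Rightarrow> real" is "\<lambda>x. sqrt (\<Sum>\<^sub>\<infinity>i. (cmod (x i))\<^sup>2)" .

definition dist_ell2 :: "ell2 \<Rightarrow> ell2 \<Rightarrow> real" where "dist_ell2 x y = norm (x - y)"

definition sgn_ell2 :: "ell2 \<Rightarrow> ell2" where "sgn_ell2 x = inverse (norm x) *\<^sub>R x"

definition uniformity_ell2 :: "(ell2 \<times> ell2) filter" where
  "uniformity_ell2 = (INF e\<in>{0 <..}. principal {(x, y). dist x y < e})"

definition open_ell2 :: "ell2 set \<Rightarrow> bool" where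
  "open_ell2 U \<longleftrightarrow> (\<forall>x\<in>U. eventually (\<lambda>(x', y). x' = x \<longrightarrow> y \<in> U) uniformity)"

instance
proof
  fix x y z :: ell2 and r s :: real
  show "x + y + z = x + (y + z)" "x + y = y + x" "0 + x = x" "- x + x = 0" "x - y = x + - y"
    by (transfer; force)+
  show "r *\<^sub>R (x + y) = r *\<^sub>R x + r *\<^sub>R y" "(r + s) *\<^sub>R x = r *\<^sub>R x + s *\<^sub>R x"
    "r *\<^sub>R s *\<^sub>R x = (r * s) *\<^sub>R x" "1 *\<^sub>R x = x"
    unfolding scaleR_ell2_def by (transfer; force simp: algebra_simps)+
  show "dist x y = norm (x - y)" by (rule dist_ell2_def)
  show "sgn x = inverse (norm x) *\<^sub>R x" by (rule sgn_ell2_def)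
  show "uniformity = (INF e\<in>{0 <..}. principal {(x :: ell2, y). dist x y < e})"
    by (rule uniformity_ell2_def)
  show "open U \<longleftrightarrow> (\<forall>x\<in>U. eventually (\<lambda>(x', y). x' = x \<longrightarrow> y \<in> U) uniformity)" for U :: "ell2 set"
    by (rule open_ell2_def)
  show "norm x = 0 \<longleftrightarrow> x = 0"
  proof transfer
    fix x :: "nat \<Rightarrow> complex"
    assume s: "(\<lambda>i. (cmod (x i))\<^sup>2) summable_on UNIV"
    show "(sqrt (\<Sum>\<^sub>\<infinity>i. (cmod (x i))\<^sup>2) = 0) = (x = (\<lambda>_. 0))"
    proof
      assume "sqrt (\<Sum>\<^sub>\<infinity>i. (cmod (x i))\<^sup>2) = 0"
      then have "(\<Sum>\<^sub>\<infinity>i. (cmod (x i))\<^sup>2) \<le> 0" by simp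
      from nonneg_infsum_le_0D[OF this s] show "x = (\<lambda>_. 0)" by auto
    qed simp
  qed
  show "norm (r *\<^sub>R x) = \<bar>r\<bar> * norm x"
    unfolding scaleR_ell2_def
    by transfer (simp add: norm_mult power_mult_distrib infsum_cmult_right' real_sqrt_mult)
  show "norm (x + y) \<le> norm x + norm y"
  proof transfer
    fix x y :: "nat \<Rightarrow> complex"
    assume s: "(\<lambda>i. (cmod (x i))\<^sup>2) summable_on UNIV" "(\<lambda>i. (cmod (y i))\<^sup>2) summable_on UNIV"
    let ?n = "\<lambda>x. sqrt (\<Sum>\<^sub>\<infinity>i. (cmod (x i))\<^sup>2)"
    have "(\<Sum>\<^sub>\<infinity>i. (cmod (x i + y i))\<^sup>2) \<le> (?n x + ?n y)\<^sup>2"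
    proof (rule infsum_le_finite_sums[OF ell2_add_aux[OF s]])
      fix F :: "nat set" assume F: "finite F"
      have "L2_set (\<lambda>i. cmod (x i + y i)) F \<le> L2_set (\<lambda>i. cmod (x i) + cmod (y i)) F"
        by (rule L2_set_mono) (auto intro: norm_triangle_ineq)
      also have "\<dots> \<le> L2_set (\<lambda>i. cmod (x i)) F + L2_set (\<lambda>i. cmod (y i)) F"
        by (rule L2_set_triangle_ineq)
      also have "\<dots> \<le> ?n x + ?n y"
        unfolding L2_set_def
        by (intro add_mono real_sqrt_le_mono finite_sum_le_infsum s F) auto
      finally have "(L2_set (\<lambda>i. cmod (x i + y i)) F)\<^sup>2 \<le> (?n x + ?n y)\<^sup>2"
        by (intro power_mono) auto
      then show "(\<Sum>i\<in>F. (cmod (x i + y i))\<^sup>2) \<le> (?n x + ?n y)\<^sup>2"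
        by (simp add: L2_set_def sum_nonneg)
    qed
    then show "sqrt (\<Sum>\<^sub>\<infinity>i. (cmod (x i + y i))\<^sup>2) \<le> ?n x + ?n y"
      by (intro real_le_lsqrt) (auto intro!: infsum_nonneg add_nonneg_nonneg)
  qed
qed

end

subsection \<open>Bounded operators and spectrum\<close>

text \<open>Bounded operators on \<^typ>\<open>ell2\<close> are taken from the library type of bounded real-linear maps
  with the operator norm. All operators considered below are complex-linear, and a two-sided
  inverse of a complex-linear map is again complex-linear, so real-linearity in the following two
  definitions makes no difference. The operator \<open>cmul z\<close> is \<open>z\<close> times the identity.\<close>

definition cmul :: "complex \<Rightarrow> ell2 \<Rightarrow>\<^sub>L ell2" where
  "cmul c = Blinfun (cscale c)"

lemma norm_cscale: "norm (cscale c x) = cmod c * norm x"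
  by transfer (simp add: norm_mult power_mult_distrib infsum_cmult_right' real_sqrt_mult)

lemma blinfun_apply_cmul [simp]: "blinfun_apply (cmul c) x = cscale c x"
proof -
  have "bounded_linear (cscale c)"
  proof (rule bounded_linear_intro)
    show "cscale c (x + y) = cscale c x + cscale c y" for x y
      by transfer (simp add: algebra_simps)
    show "cscale c (r *\<^sub>R x) = r *\<^sub>R cscale c x" for r x
      unfolding scaleR_ell2_def by transfer (simp add: algebra_simps)
    show "norm (cscale c x) \<le> norm x * cmod c" for x
      by (simp add: norm_cscale)
  qed
  then show ?thesis by (simp add: cmul_def bounded_linear_Blinfun_apply)
qed

definition is_op_inverse :: "ell2 \<Rightarrow>\<^sub>L ell2 \<Rightarrow> ell2 \<Rightarrow>\<^sub>L ell2 \<Rightarrow> bool" where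
  "is_op_inverse S R \<longleftrightarrow> R o\<^sub>L S = id_blinfun \<and> S o\<^sub>L R = id_blinfun"

definition op_inverse :: "ell2 \<Rightarrow>\<^sub>L ell2 \<Rightarrow> ell2 \<Rightarrow>\<^sub>L ell2" where
  "op_inverse S = (THE R. is_op_inverse S R)"

definition spectrum :: "ell2 \<Rightarrow>\<^sub>L ell2 \<Rightarrow> complex set" where
  "spectrum A = {z. \<not> (\<exists>R. is_op_inverse (cmul z - A) R)}"

lemma is_op_inverse_unique:
  assumes "is_op_inverse S R" "is_op_inverse S R'"
  shows "R = R'"
proof (rule blinfun_eqI)
  fix x
  have "S (R' x) = x" "R (S y) = y" for y
    using assms unfolding is_op_inverse_def
    by (metis blinfun_apply_blinfun_compose blinfun_apply_id_blinfun id_apply)+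
  then show "R x = R' x" by metis
qed

lemma op_inverse_eq: "is_op_inverse S R \<Longrightarrow> op_inverse S = R"
  unfolding op_inverse_def by (blast intro: the_equality is_op_inverse_unique)

subsection \<open>Symbols and semi-infinite matrices\<close>

text \<open>A Laurent series is represented by its coefficient family \<^typ>\<open>int \<Rightarrow> complex\<close>.\<close>

definition laurent :: "(int \<Rightarrow> complex) \<Rightarrow> complex \<Rightarrow> complex" where
  "laurent a z = (\<Sum>\<^sub>\<infinity>i. a i * z powi i)"

definition wiener :: "(int \<Rightarrow> complex) set" where
  "wiener = {a. (\<lambda>i. cmod (a i)) summable_on UNIV}"

text \<open>In \<open>a'(z) = (\<Sum>i. i a\<^sub>i z\<^bsup>i-1\<^esup>)\<close> the coefficient of \<open>z\<^bsup>i\<^esup>\<close> is \<open>(i + 1) a\<^bsub>i+1\<^esub>\<close>.\<close>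

definition laurent_deriv :: "(int \<Rightarrow> complex) \<Rightarrow> int \<Rightarrow> complex" where
  "laurent_deriv a i = of_int (i + 1) * a (i + 1)"

definition wiener1 :: "(int \<Rightarrow> complex) set" where
  "wiener1 = {a \<in> wiener. laurent_deriv a \<in> wiener}"

definition annulus_symbols :: "(int \<Rightarrow> complex) set" where
  "annulus_symbols = {a. \<exists>r R. 0 \<le> r \<and> r < 1 \<and> 1 < R \<and>
     (\<forall>z. r < cmod z \<and> cmod z < R \<longrightarrow> (\<lambda>i. a i * z powi i) summable_on UNIV) \<and>
     laurent a analytic_on {z. r < cmod z \<and> cmod z < R}}"

type_synonym inf_matrix = "nat \<Rightarrow> nat \<Rightarrow> complex"

text \<open>Entries \<open>a\<^bsub>j-i\<^esub>\<close> do not depend on whether indexing starts at 0 or at 1.\<close>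

definition toeplitz :: "(int \<Rightarrow> complex) \<Rightarrow> inf_matrix" where
  "toeplitz a i j = a (int j - int i)"

definition fmatrices :: "inf_matrix set" where
  "fmatrices = {E. (\<lambda>(i, j). cmod (E i j)) summable_on UNIV}"

definition CQT :: "inf_matrix set" where
  "CQT = {\<lambda>i j. toeplitz a i j + E i j | a E. a \<in> wiener1 \<and> E \<in> fmatrices}"

definition AQT :: "inf_matrix set" where
  "AQT = {\<lambda>i j. toeplitz a i j + E i j | a E. a \<in> annulus_symbols \<and> E \<in> fmatrices}"

text \<open>The operator \<open>x \<mapsto> M x\<close>; well-defined for \<open>M \<in> CQT\<close> by \<open>matrix_op_CQT\<close> below.\<close>

definition matrix_op :: "inf_matrix \<Rightarrow> ell2 \<Rightarrow>\<^sub>L ell2" where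
  "matrix_op M = Blinfun (\<lambda>x. Abs_ell2 (\<lambda>i. \<Sum>\<^sub>\<infinity>j. M i j * ell2_nth x j))"

lemma ell2_summable: "(\<lambda>i. (cmod (ell2_nth x i))\<^sup>2) summable_on UNIV"
  using ell2_nth[of x] by simp

lemma norm_ell2_sq: "(norm x)\<^sup>2 = (\<Sum>\<^sub>\<infinity>i. (cmod (ell2_nth x i))\<^sup>2)"
  by (simp add: norm_ell2.rep_eq infsum_nonneg)

lemma schur_test:
  fixes M :: inf_matrix
  assumes row: "\<And>i F. finite F \<Longrightarrow> (\<Sum>j\<in>F. cmod (M i j)) \<le> C"
    and col: "\<And>j F. finite F \<Longrightarrow> (\<Sum>i\<in>F. cmod (M i j)) \<le> C"
  shows "(\<lambda>j. M i j * ell2_nth x j) summable_on UNIV" (is ?A)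
    and "finite F \<Longrightarrow> (\<Sum>i\<in>F. (cmod (\<Sum>\<^sub>\<infinity>j. M i j * ell2_nth x j))\<^sup>2) \<le> (C * norm x)\<^sup>2" (is "_ \<Longrightarrow> ?B")
proof -
  let ?m = "\<lambda>i j. cmod (M i j)" and ?x = "\<lambda>j. cmod (ell2_nth x j)"
  have C0: "0 \<le> C" using row[of "{}"] by simp
  have mC: "?m i j \<le> C" for i j using row[of "{j}" i] by simp
  have sm: "(\<lambda>j. ?m i j) summable_on UNIV" for i
    by (rule nonneg_bdd_above_summable_on) (auto intro!: bdd_aboveI2[where M = C] row)
  have smx2: "(\<lambda>j. ?m i j * (?x j)\<^sup>2) summable_on UNIV" for i
    by (rule summable_on_comparison_test[OF summable_on_cmult_right[OF ell2_summable[of x], of C]])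
      (auto intro!: mult_right_mono mC)
  have smx: "(\<lambda>j. ?m i j * ?x j) summable_on UNIV" for i
  proof (rule summable_on_comparison_test[OF summable_on_add[OF sm[of i] smx2[of i]]])
    fix j
    have "?x j \<le> 1 + (?x j)\<^sup>2" using sum_squares_bound[of 1 "?x j"] norm_ge_zero[of "ell2_nth x j"]
      unfolding one_power2 mult_1_right by linarith
    then show "?m i j * ?x j \<le> ?m i j + ?m i j * (?x j)\<^sup>2"
      using mult_left_mono[of "?x j" "1 + (?x j)\<^sup>2" "?m i j"] by (simp add: algebra_simps)
  qed auto
  then have abs: "(\<lambda>j. cmod (M i j * ell2_nth x j)) summable_on UNIV" for i
    by (simp add: norm_mult)
  then show ?A by (rule abs_summable_summable)
  have sq: "(cmod (\<Sum>\<^sub>\<infinity>j. M i j * ell2_nth x j))\<^sup>2 \<le> C * (\<Sum>\<^sub>\<infinity>j. ?m i j * (?x j)\<^sup>2)" for i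
  proof -
    let ?S = "\<Sum>\<^sub>\<infinity>j. ?m i j * (?x j)\<^sup>2"
    have S0: "0 \<le> ?S" by (rule infsum_nonneg) auto
    have "(\<Sum>\<^sub>\<infinity>j. ?m i j * ?x j) \<le> sqrt (C * ?S)"
    proof (rule infsum_le_finite_sums[OF smx])
      fix F :: "nat set" assume F: "finite F"
      have "(\<Sum>j\<in>F. ?m i j * ?x j)\<^sup>2 = (\<Sum>j\<in>F. sqrt (?m i j) * (sqrt (?m i j) * ?x j))\<^sup>2"
        by (simp add: mult.assoc[symmetric])
      also have "\<dots> \<le> (\<Sum>j\<in>F. (sqrt (?m i j))\<^sup>2) * (\<Sum>j\<in>F. (sqrt (?m i j) * ?x j)\<^sup>2)"
        by (rule Cauchy_Schwarz_ineq_sum)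
      also have "\<dots> = (\<Sum>j\<in>F. ?m i j) * (\<Sum>j\<in>F. ?m i j * (?x j)\<^sup>2)"
        by (simp add: power_mult_distrib)
      also have "\<dots> \<le> C * ?S"
        by (intro mult_mono row finite_sum_le_infsum smx2 F C0 sum_nonneg) auto
      finally show "(\<Sum>j\<in>F. ?m i j * ?x j) \<le> sqrt (C * ?S)"
        by (rule real_le_rsqrt)
    qed
    moreover have "cmod (\<Sum>\<^sub>\<infinity>j. M i j * ell2_nth x j) \<le> (\<Sum>\<^sub>\<infinity>j. ?m i j * ?x j)"
      using norm_infsum_bound[OF abs[of i]] by (simp add: norm_mult)
    ultimately have "cmod (\<Sum>\<^sub>\<infinity>j. M i j * ell2_nth x j) \<le> sqrt (C * ?S)" by linarith
    then have "(cmod (\<Sum>\<^sub>\<infinity>j. M i j * ell2_nth x j))\<^sup>2 \<le> (sqrt (C * ?S))\<^sup>2"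
      by (intro power_mono) auto
    then show ?thesis using C0 S0 by simp
  qed
  assume F: "finite F"
  have "(\<Sum>i\<in>F. (cmod (\<Sum>\<^sub>\<infinity>j. M i j * ell2_nth x j))\<^sup>2) \<le> (\<Sum>i\<in>F. C * (\<Sum>\<^sub>\<infinity>j. ?m i j * (?x j)\<^sup>2))"
    by (intro sum_mono sq)
  also have "\<dots> = C * (\<Sum>i\<in>F. (\<Sum>\<^sub>\<infinity>j. ?m i j * (?x j)\<^sup>2))"
    by (simp add: sum_distrib_left)
  also have "(\<Sum>i\<in>F. (\<Sum>\<^sub>\<infinity>j. ?m i j * (?x j)\<^sup>2)) = (\<Sum>\<^sub>\<infinity>j. (\<Sum>i\<in>F. ?m i j * (?x j)\<^sup>2))"
    using F
  proof (induction F rule: finite_induct)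
    case (insert k F)
    have "(\<lambda>j. \<Sum>i\<in>F. ?m i j * (?x j)\<^sup>2) summable_on UNIV"
      using insert.hyps(1) by (induction F rule: finite_induct) (auto intro!: summable_on_add smx2)
    with insert smx2 show ?case by (simp add: infsum_add)
  qed simp
  also have "C * \<dots> \<le> C * (C * (norm x)\<^sup>2)"
  proof (intro mult_left_mono C0)
    have le: "(\<Sum>i\<in>F. ?m i j * (?x j)\<^sup>2) \<le> C * (?x j)\<^sup>2" for j
      using mult_right_mono[OF col[OF F, of j], of "(?x j)\<^sup>2"] by (simp add: sum_distrib_right)
    have s: "(\<lambda>j. C * (?x j)\<^sup>2) summable_on UNIV"
      by (intro summable_on_cmult_right ell2_summable)
    have "(\<Sum>\<^sub>\<infinity>j. (\<Sum>i\<in>F. ?m i j * (?x j)\<^sup>2)) \<le> (\<Sum>\<^sub>\<infinity>j. C * (?x j)\<^sup>2)"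
      by (rule infsum_mono[OF summable_on_comparison_test[OF s] s]) (auto intro!: le sum_nonneg)
    then show "(\<Sum>\<^sub>\<infinity>j. (\<Sum>i\<in>F. ?m i j * (?x j)\<^sup>2)) \<le> C * (norm x)\<^sup>2"
      by (simp add: norm_ell2_sq infsum_cmult_right')
  qed
  finally show ?B by (simp add: power2_eq_square mult_ac)
qed

lemma matrix_op_bounded:
  fixes M :: inf_matrix
  assumes row: "\<And>i F. finite F \<Longrightarrow> (\<Sum>j\<in>F. cmod (M i j)) \<le> C"
    and col: "\<And>j F. finite F \<Longrightarrow> (\<Sum>i\<in>F. cmod (M i j)) \<le> C"
  shows "((\<lambda>j. M i j * ell2_nth x j) has_sum ell2_nth (matrix_op M x) i) UNIV"
proof -
  note S = schur_test[of M C, OF row col]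
  have C0: "0 \<le> C" using row[of "{}"] by simp
  define g where "g = (\<lambda>x i. \<Sum>\<^sub>\<infinity>j. M i j * ell2_nth x j)"
  have gs: "(\<lambda>i. (cmod (g x i))\<^sup>2) summable_on UNIV" for x
    unfolding g_def
    by (rule nonneg_bdd_above_summable_on)
      (auto intro!: bdd_aboveI2[where M = "(C * norm x)\<^sup>2"] S(2))
  have nth: "ell2_nth (Abs_ell2 (g x)) = g x" for x
    using gs[of x] by (simp add: Abs_ell2_inverse)
  have "bounded_linear (\<lambda>x. Abs_ell2 (g x))"
  proof (rule bounded_linear_intro)
    show "Abs_ell2 (g (x + y)) = Abs_ell2 (g x) + Abs_ell2 (g y)" for x y
    proof -
      have "g (x + y) i = g x i + g y i" for i
        using infsum_add[OF S(1)[of i x] S(1)[of i y]]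
        by (simp add: g_def plus_ell2.rep_eq ring_distribs)
      then show ?thesis
        by (simp add: ell2_nth_inject[symmetric] nth plus_ell2.rep_eq fun_eq_iff)
    qed
    show "Abs_ell2 (g (r *\<^sub>R x)) = r *\<^sub>R Abs_ell2 (g x)" for r x
    proof -
      have "g (r *\<^sub>R x) i = complex_of_real r * g x i" for i
        by (simp add: g_def scaleR_ell2_def cscale.rep_eq mult.left_commute infsum_cmult_right')
      then show ?thesis
        by (simp add: ell2_nth_inject[symmetric] nth scaleR_ell2_def cscale.rep_eq fun_eq_iff)
    qed
    show "norm (Abs_ell2 (g x)) \<le> norm x * C" for x
    proof (rule power2_le_imp_le)
      have "(\<Sum>\<^sub>\<infinity>i. (cmod (g x i))\<^sup>2) \<le> (C * norm x)\<^sup>2"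
        by (rule infsum_le_finite_sums[OF gs]) (simp add: g_def S(2))
      then show "(norm (Abs_ell2 (g x)))\<^sup>2 \<le> (norm x * C)\<^sup>2"
        by (simp add: norm_ell2_sq nth mult.commute)
    qed (simp add: C0)
  qed
  then have "matrix_op M x = Abs_ell2 (g x)"
    by (simp add: matrix_op_def g_def bounded_linear_Blinfun_apply)
  then show ?thesis
    using has_sum_infsum[OF S(1)[of i x]] nth[of x] by (simp add: g_def)
qed

lemma matrix_op_CQT:
  assumes "M \<in> CQT"
  shows "((\<lambda>j. M i j * ell2_nth x j) has_sum ell2_nth (matrix_op M x) i) UNIV"
proof -
  obtain a E where M: "M = (\<lambda>i j. toeplitz a i j + E i j)"
    and "a \<in> wiener1" and "E \<in> fmatrices"
    using assms by (auto simp: CQT_def)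
  then have a: "(\<lambda>i. cmod (a i)) summable_on UNIV"
    and E: "(\<lambda>(i, j). cmod (E i j)) summable_on UNIV"
    by (auto simp: wiener1_def wiener_def fmatrices_def)
  let ?ca = "\<Sum>\<^sub>\<infinity>i. cmod (a i)" and ?ce = "\<Sum>\<^sub>\<infinity>(i, j). cmod (E i j)"
  show ?thesis
  proof (rule matrix_op_bounded[where C = "?ca + ?ce"])
    fix i :: nat and F :: "nat set" assume F: "finite F"
    have "(\<Sum>j\<in>F. cmod (toeplitz a i j)) = (\<Sum>k\<in>(\<lambda>j. int j - int i) ` F. cmod (a k))"
      by (subst sum.reindex) (auto simp: toeplitz_def inj_on_def)
    also have "\<dots> \<le> ?ca" by (rule finite_sum_le_infsum[OF a]) (auto simp: F)
    finally have 1: "(\<Sum>j\<in>F. cmod (toeplitz a i j)) \<le> ?ca" .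
    have "(\<Sum>j\<in>F. cmod (E i j)) = (\<Sum>(k, j)\<in>Pair i ` F. cmod (E k j))"
      by (subst sum.reindex) (auto simp: inj_on_def)
    also have "\<dots> \<le> ?ce" by (rule finite_sum_le_infsum[OF E]) (auto simp: F)
    finally have 2: "(\<Sum>j\<in>F. cmod (E i j)) \<le> ?ce" .
    have "(\<Sum>j\<in>F. cmod (M i j)) \<le> (\<Sum>j\<in>F. cmod (toeplitz a i j) + cmod (E i j))"
      unfolding M by (intro sum_mono norm_triangle_ineq)
    with 1 2 show "(\<Sum>j\<in>F. cmod (M i j)) \<le> ?ca + ?ce" by (simp add: sum.distrib)
  next
    fix j :: nat and F :: "nat set" assume F: "finite F"
    have "(\<Sum>i\<in>F. cmod (toeplitz a i j)) = (\<Sum>k\<in>(\<lambda>i. int j - int i) ` F. cmod (a k))"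
      by (subst sum.reindex) (auto simp: toeplitz_def inj_on_def)
    also have "\<dots> \<le> ?ca" by (rule finite_sum_le_infsum[OF a]) (auto simp: F)
    finally have 1: "(\<Sum>i\<in>F. cmod (toeplitz a i j)) \<le> ?ca" .
    have "(\<Sum>i\<in>F. cmod (E i j)) = (\<Sum>(i, k)\<in>(\<lambda>i. (i, j)) ` F. cmod (E i k))"
      by (subst sum.reindex) (auto simp: inj_on_def)
    also have "\<dots> \<le> ?ce" by (rule finite_sum_le_infsum[OF E]) (auto simp: F)
    finally have 2: "(\<Sum>i\<in>F. cmod (E i j)) \<le> ?ce" .
    have "(\<Sum>i\<in>F. cmod (M i j)) \<le> (\<Sum>i\<in>F. cmod (toeplitz a i j) + cmod (E i j))"
      unfolding M by (intro sum_mono norm_triangle_ineq)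
    with 1 2 show "(\<Sum>i\<in>F. cmod (M i j)) \<le> ?ca + ?ce" by (simp add: sum.distrib)
  qed
qed

subsection \<open>Contours and the functional calculus\<close>

definition compact_domain :: "complex set \<Rightarrow> bool" where
  "compact_domain \<Omega> \<longleftrightarrow> compact \<Omega> \<and> \<Omega> \<noteq> {} \<and> connected (interior \<Omega>) \<and> closure (interior \<Omega>) = \<Omega>"

definition curve_length :: "(real \<Rightarrow> complex) \<Rightarrow> real \<Rightarrow> real \<Rightarrow> ereal" where
  "curve_length \<gamma> s t =
     Sup {ereal (\<Sum>k<n. dist (\<gamma> (p k)) (\<gamma> (p (Suc k)))) | n p.
            p 0 = s \<and> p n = t \<and> (\<forall>k<n. p k \<le> p (Suc k))}"

text \<open>Parametrization by arc length in the literal sense. A differentiable curve with unit speed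
  everywhere has this property; conversely it only bounds the speed by 1 at every point.\<close>

definition arc_length_param :: "(real \<Rightarrow> complex) \<Rightarrow> real \<Rightarrow> real \<Rightarrow> bool" where
  "arc_length_param \<gamma> s0 s1 \<longleftrightarrow>
     (\<forall>s t. s0 \<le> s \<and> s \<le> t \<and> t \<le> s1 \<longrightarrow> curve_length \<gamma> s t = ereal (t - s))"

text \<open>The derivative at the end points is one-sided. The library's winding number is defined for
  paths on the unit interval, hence the affine reparametrization.\<close>

definition boundary_param :: "complex set \<Rightarrow> (real \<Rightarrow> complex) \<Rightarrow> real \<Rightarrow> real \<Rightarrow> bool" where
  "boundary_param \<Omega> \<gamma> s0 s1 \<longleftrightarrow>
     s0 < s1 \<and>
     \<gamma> ` {s0..s1} = frontier \<Omega> \<and>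
     \<gamma> s0 = \<gamma> s1 \<and> inj_on \<gamma> {s0..<s1} \<and>
     (\<forall>s\<in>{s0..s1}. \<gamma> differentiable (at s within {s0..s1})) \<and>
     arc_length_param \<gamma> s0 s1 \<and>
     (\<forall>w\<in>interior \<Omega>. winding_number (\<gamma> \<circ> linepath s0 s1) w = 1)"

text \<open>\<open>f(\<gamma>(s)) (\<gamma>(s) I - A)\<^sup>-\<^sup>1 \<gamma>'(s)\<close>, with values in the normed space of bounded operators\<close>

definition cauchy_integrand ::
    "(complex \<Rightarrow> complex) \<Rightarrow> (real \<Rightarrow> complex) \<Rightarrow> real \<Rightarrow> real \<Rightarrow> ell2 \<Rightarrow>\<^sub>L ell2 \<Rightarrow> real \<Rightarrow> ell2 \<Rightarrow>\<^sub>L ell2"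
  where
  "cauchy_integrand f \<gamma> s0 s1 A s =
     cmul (f (\<gamma> s) * vector_derivative \<gamma> (at s within {s0..s1})) o\<^sub>L op_inverse (cmul (\<gamma> s) - A)"

definition fun_of_op ::
    "(complex \<Rightarrow> complex) \<Rightarrow> (real \<Rightarrow> complex) \<Rightarrow> real \<Rightarrow> real \<Rightarrow> ell2 \<Rightarrow>\<^sub>L ell2 \<Rightarrow> ell2 \<Rightarrow>\<^sub>L ell2"
  where
  "fun_of_op f \<gamma> s0 s1 A =
     cmul (1 / (2 * of_real pi * \<i>)) o\<^sub>L integral {s0..s1} (cauchy_integrand f \<gamma> s0 s1 A)"

end

theory Submission
  imports Defs
begin

text \<open>For \<open>z\<close> on the boundary the resolvent \<open>R\<close> of \<open>A\<close> at \<open>z\<close> exists. If \<open>b = z - a\<close> vanished at a point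
  \<open>\<zeta>\<close> of the circle, the images under \<open>z I - A\<close> of the vectors \<open>(1, \<zeta>, \<dots>, \<zeta>\<^bsup>m-1\<^esup>, 0, \<dots>)\<close> of norm
  \<open>\<surd>m\<close> would stay bounded, contradicting the existence of \<open>R\<close>. Hence \<open>1 / b\<close> is Lipschitz on the
  circle, and Bessel's inequality gives an inverse \<open>c\<close> of \<open>b\<close> in the Wiener algebra.

  A product of Toeplitz matrices differs from the Toeplitz matrix of the product by a product of
  Hankel matrices, which is summable if one of the symbols has a derivative in the Wiener class. So
  \<open>P = T(c) (z I - A) - I\<close> and \<open>Q = (z I - A) T(c) - I\<close> are summable, and \<open>R = T(c) - R Q = T(c) - P R\<close>
  shows that \<open>R - T(c)\<close> is summable, with a bound depending only on the norms of \<open>b\<close>, \<open>c\<close>, \<open>R\<close> and \<open>E\<close>.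

  Weighted norms of \<open>c\<close> (linear weights for the derivative, exponential ones for analyticity)
  are obtained from \<open>c = p + u * c\<close>, where \<open>p\<close> is a truncation of \<open>c\<close> and \<open>u = 1 - p * b\<close> is small.
  By the resolvent identity they are locally bounded in \<open>z\<close>, hence bounded on the boundary curve,
  and integrating entrywise along the curve gives the symbol and the correction of \<open>f(A)\<close>.\<close>

subsection \<open>Unconditional sums of nonnegative quantities\<close>

text \<open>The curve has a derivative at every point, but this derivative is only known to be
  bounded, not continuous. The Henstock-Kurzweil integral copes with this: it integrates every
  derivative, and uniform approximation extends this to a derivative times a continuous factor.
  Absolute integrability does not come for free with it, so sums of absolute values of integrals are
  estimated over finite index sets, with phases inserted before integrating.

  All bounds on the resolvents must be uniform over the boundary, since infinitely many coefficients
  are integrated at once. The weight in which the inverse symbol is finite depends on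
  \<open>z\<close> at first; compactness selects a common one.

  Operators are compared through their entries. As the operator type is only real-linear, complex
  linearity has to be carried along: it is what makes the entries determine the operator.

  Sums of absolute values live in \<open>ennreal\<close>, where they always exist and may be swapped
  freely, so that finiteness is checked only at the end.\<close>

definition esum :: "('a \<Rightarrow> ennreal) \<Rightarrow> ennreal" where
  "esum f = (\<integral>\<^sup>+ x. f x \<partial>count_space UNIV)"

lemma esum_cong: "(\<And>x. f x = g x) \<Longrightarrow> esum f = esum g"
  by presburger

lemma esum_mono: "(\<And>x. f x \<le> g x) \<Longrightarrow> esum f \<le> esum g"
  unfolding esum_def by (rule nn_integral_mono) auto

lemma esum_cmult: "esum (\<lambda>x. c * f x) = c * esum f"
  unfolding esum_def by (rule nn_integral_cmult) auto

lemma esum_multc: "esum (\<lambda>x. f x * c) = esum f * c"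
  unfolding esum_def by (rule nn_integral_multc) auto

lemma esum_add: "esum (\<lambda>x. f x + g x) = esum f + esum g"
  unfolding esum_def by (rule nn_integral_add) auto

lemma esum_pair: "esum (\<lambda>(x, y). f x y) = esum (\<lambda>x. esum (f x))"
  unfolding esum_def
  using nn_integral_fst_count_space[of "\<lambda>(x, y). f x y"] by simp

lemma esum_swap: "esum (\<lambda>x. esum (\<lambda>y. f x y)) = esum (\<lambda>y. esum (\<lambda>x. f x y))"
  unfolding esum_def
  using nn_integral_fst_count_space[of "\<lambda>(x, y). f x y"]
    nn_integral_snd_count_space[of "\<lambda>(x, y). f x y"] by simp

lemma esum_reindex:
  assumes "bij g"
  shows "esum (\<lambda>x. f (g x)) = esum f"
  unfolding esum_def using nn_integral_bij_count_space[of g UNIV UNIV f] assms by simp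

lemma esum_inj_le:
  assumes "inj g"
  shows "esum (\<lambda>x. f (g x)) \<le> esum f"
proof -
  have "esum (\<lambda>x. f (g x)) = (\<integral>\<^sup>+ y. f y \<partial>count_space (range g))"
    unfolding esum_def
    by (rule nn_integral_bij_count_space) (use assms in \<open>auto simp: bij_betw_def\<close>)
  also have "\<dots> = esum (\<lambda>y. f y * indicator (range g) y)"
    unfolding esum_def by (subst nn_integral_count_space_indicator) auto
  also have "\<dots> \<le> esum f"
    by (rule esum_mono) (auto simp: indicator_def)
  finally show ?thesis .
qed

lemma esum_finite_le: "finite F \<Longrightarrow> (\<Sum>x\<in>F. f x) \<le> esum f"
proof -
  assume F: "finite F"
  have "(\<Sum>x\<in>F. f x) = (\<integral>\<^sup>+ x. f x \<partial>count_space F)"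
    using F by (simp add: nn_integral_count_space_finite)
  also have "\<dots> = esum (\<lambda>x. f x * indicator F x)"
    unfolding esum_def by (subst nn_integral_count_space_indicator) auto
  also have "\<dots> \<le> esum f"
    by (rule esum_mono) (auto simp: indicator_def)
  finally show ?thesis .
qed

lemma esum_ge: "f x \<le> esum f"
  using esum_finite_le[of "{x}" f] by simp

lemma esum_eq_infsum:
  assumes "g summable_on UNIV" and "\<And>x. 0 \<le> g x"
  shows "esum (\<lambda>x. ennreal (g x)) = ennreal (infsum g UNIV)"
proof -
  have "(\<lambda>x. norm (g x)) summable_on UNIV" using assms by simp
  note * = this[unfolded abs_summable_equivalent]
  show ?thesis
    unfolding esum_def using nn_integral_conv_infsetsum[OF *] infsetsum_infsum[OF *] assms by simp
qed

lemma esum_le_finite_sums: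
  assumes "\<And>F. finite F \<Longrightarrow> (\<Sum>x\<in>F. g x) \<le> C" and "\<And>x. 0 \<le> g x"
  shows "esum (\<lambda>x. ennreal (g x)) \<le> ennreal C" "g summable_on UNIV"
proof -
  show s: "g summable_on UNIV"
    by (rule nonneg_bdd_above_summable_on) (use assms in \<open>auto intro!: bdd_aboveI2[where M = C]\<close>)
  have "infsum g UNIV \<le> C" by (rule infsum_le_finite_sums[OF s]) (use assms in auto)
  then show "esum (\<lambda>x. ennreal (g x)) \<le> ennreal C"
    using esum_eq_infsum[OF s] assms by (simp add: ennreal_leI)
qed

lemma finite_sum_le_esum:
  assumes "esum (\<lambda>x. ennreal (g x)) \<le> ennreal C" "0 \<le> C" "\<And>x. 0 \<le> g x" "finite F"
  shows "(\<Sum>x\<in>F. g x) \<le> C"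
proof -
  have "ennreal (\<Sum>x\<in>F. g x) = (\<Sum>x\<in>F. ennreal (g x))" using assms by simp
  also have "\<dots> \<le> ennreal C" using esum_finite_le[OF assms(4)] assms(1) order_trans by blast
  finally show ?thesis using assms by (simp add: ennreal_le_iff)
qed

lemma esum_finite_iff:
  fixes f :: "'a \<Rightarrow> 'b::real_normed_vector"
  shows "esum (\<lambda>x. ennreal (norm (f x))) < top \<longleftrightarrow> (\<lambda>x. norm (f x)) summable_on UNIV"
proof
  assume "(\<lambda>x. norm (f x)) summable_on UNIV"
  from esum_eq_infsum[OF this] show "esum (\<lambda>x. ennreal (norm (f x))) < top" by simp
next
  assume L: "esum (\<lambda>x. ennreal (norm (f x))) < top"
  define C where "C = enn2real (esum (\<lambda>x. ennreal (norm (f x))))"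
  have "esum (\<lambda>x. ennreal (norm (f x))) \<le> ennreal C" "0 \<le> C" using L by (auto simp: C_def)
  from finite_sum_le_esum[OF this] show "(\<lambda>x. norm (f x)) summable_on UNIV"
    by (intro esum_le_finite_sums(2)[where C = C]) auto
qed

lemma esum_imp_summable:
  fixes f :: "'a \<Rightarrow> 'b::banach"
  shows "esum (\<lambda>x. ennreal (norm (f x))) < top \<Longrightarrow> f summable_on UNIV"
  by (simp add: esum_finite_iff abs_summable_summable)

text \<open>No summability is required: a divergent \<open>infsum\<close> is 0.\<close>

lemma norm_infsum_le_esum:
  fixes f :: "'a \<Rightarrow> 'b::banach"
  shows "ennreal (norm (infsum f UNIV)) \<le> esum (\<lambda>x. ennreal (norm (f x)))"
proof (cases "(\<lambda>x. norm (f x)) summable_on UNIV")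
  case True
  from esum_eq_infsum[OF this] norm_infsum_bound[OF True] show ?thesis by (simp add: ennreal_leI)
next
  case False
  then show ?thesis unfolding esum_finite_iff[symmetric] by (simp add: less_top[symmetric])
qed

lemma esum_abs_summable_on_prod:
  fixes f :: "'a \<Rightarrow> 'b \<Rightarrow> 'c::banach"
  assumes "esum (\<lambda>x. esum (\<lambda>y. ennreal (norm (f x y)))) < top"
  shows "(\<lambda>(x, y). f x y) summable_on UNIV"
proof (rule esum_imp_summable)
  have "esum (\<lambda>p. ennreal (norm (case p of (x, y) \<Rightarrow> f x y))) = esum (\<lambda>(x, y). ennreal (norm (f x y)))"
    by (rule esum_cong) auto
  then show "esum (\<lambda>p. ennreal (norm (case p of (x, y) \<Rightarrow> f x y))) < top"
    using assms by (simp add: esum_pair)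
qed

lemma infsum_swap_esum:
  fixes f :: "'a \<Rightarrow> 'b \<Rightarrow> 'c::banach"
  assumes "esum (\<lambda>x. esum (\<lambda>y. ennreal (norm (f x y)))) < top"
  shows "(\<Sum>\<^sub>\<infinity>x. \<Sum>\<^sub>\<infinity>y. f x y) = (\<Sum>\<^sub>\<infinity>y. \<Sum>\<^sub>\<infinity>x. f x y)"
  using esum_abs_summable_on_prod[OF assms] by (intro infsum_swap_banach) simp

text \<open>The shape in which products are estimated: the inner sums of the second factor have a
  common bound, and the first factor is summed last.\<close>

lemma esum_double_le:
  fixes u :: "'a \<Rightarrow> ennreal" and v :: "'a \<Rightarrow> 'b \<Rightarrow> ennreal"
  assumes "\<And>x. esum (v x) \<le> C"
  shows "esum (\<lambda>x. esum (\<lambda>y. u x * v x y)) \<le> esum u * C"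
proof -
  have "esum (\<lambda>x. esum (\<lambda>y. u x * v x y)) = esum (\<lambda>x. u x * esum (v x))"
    by (simp add: esum_cmult)
  also have "\<dots> \<le> esum (\<lambda>x. u x * C)" by (intro esum_mono mult_left_mono assms) auto
  also have "\<dots> = esum u * C" by (rule esum_multc)
  finally show ?thesis .
qed

subsection \<open>Weighted Wiener norms and convolution\<close>

text \<open>Extended-valued, since weighted norms are manipulated before they are known to be
  finite.\<close>

definition wnorm :: "(int \<Rightarrow> real) \<Rightarrow> (int \<Rightarrow> complex) \<Rightarrow> ennreal" where
  "wnorm v a = esum (\<lambda>k. ennreal (v k * cmod (a k)))"

abbreviation wnorm1 :: "(int \<Rightarrow> complex) \<Rightarrow> ennreal" where
  "wnorm1 \<equiv> wnorm (\<lambda>_. 1)"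

definition conv :: "(int \<Rightarrow> complex) \<Rightarrow> (int \<Rightarrow> complex) \<Rightarrow> int \<Rightarrow> complex" where
  "conv a b k = (\<Sum>\<^sub>\<infinity>j. a j * b (k - j))"

definition cunit :: "int \<Rightarrow> complex" where
  "cunit k = (if k = 0 then 1 else 0)"

text \<open>Submultiplicativity makes the weighted space a convolution algebra (a Beurling algebra);
  the lower bound 1 places it inside the Wiener algebra.\<close>

definition weight :: "(int \<Rightarrow> real) \<Rightarrow> bool" where
  "weight v \<longleftrightarrow> (\<forall>k. 1 \<le> v k) \<and> (\<forall>j k. v (j + k) \<le> v j * v k)"

lemma weight_ge1: "weight v \<Longrightarrow> 1 \<le> v k"
  and weight_ge0: "weight v \<Longrightarrow> 0 \<le> v k"
  and weight_submult: "weight v \<Longrightarrow> v (j + k) \<le> v j * v k"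
  unfolding weight_def by (auto intro: order_trans[of 0 1])

lemma weight_one [simp]: "weight (\<lambda>_. 1)"
  by (simp add: weight_def)

lemma wiener_iff: "a \<in> wiener \<longleftrightarrow> wnorm1 a < top"
  unfolding wiener_def wnorm_def using esum_finite_iff[of a] by simp

lemma wnorm_mono: "(\<And>k. v k \<le> w k) \<Longrightarrow> wnorm v a \<le> wnorm w a"
  unfolding wnorm_def by (intro esum_mono ennreal_leI mult_right_mono) auto

lemma wnorm1_le: "weight v \<Longrightarrow> wnorm1 a \<le> wnorm v a"
  by (rule wnorm_mono) (rule weight_ge1)

lemma cmod_le_wnorm1: "ennreal (cmod (a k)) \<le> wnorm1 a"
  unfolding wnorm_def using esum_ge[of "\<lambda>k. ennreal (1 * cmod (a k))" k] by simp

lemma wnorm_cmult: "(\<And>k. 0 \<le> v k) \<Longrightarrow> wnorm v (\<lambda>k. c * a k) = ennreal (cmod c) * wnorm v a"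
  unfolding wnorm_def
  by (simp add: esum_cmult[symmetric] ennreal_mult'[symmetric] norm_mult mult_ac)

lemma wnorm_add: "(\<And>k. 0 \<le> v k) \<Longrightarrow> wnorm v (\<lambda>k. a k + b k) \<le> wnorm v a + wnorm v b"
  unfolding wnorm_def esum_add[symmetric]
  by (intro esum_mono)
    (simp add: ennreal_plus[symmetric] distrib_left[symmetric] ennreal_leI mult_left_mono norm_triangle_ineq
      del: ennreal_plus)

lemma wnorm_diff: "(\<And>k. 0 \<le> v k) \<Longrightarrow> wnorm v (\<lambda>k. a k - b k) \<le> wnorm v a + wnorm v b"
  using wnorm_add[of v a "\<lambda>k. - b k"] by (simp add: wnorm_def)

lemma esum_shift: "esum (\<lambda>k. f (k + c)) = esum f" for c :: int
  by (rule esum_reindex) (simp add: bij_plus_right[unfolded add.commute])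

text \<open>Splitting the weight as \<open>v j * v (k - j)\<close> turns the double sum into a
  product, after a shift in \<open>k\<close>.\<close>

lemma wnorm_conv:
  assumes "\<And>k. 0 \<le> v k" "\<And>j k. v (j + k) \<le> v j * v k"
  shows "wnorm v (conv a b) \<le> wnorm v a * wnorm v b"
proof -
  have "ennreal (v k * cmod (conv a b k))
      \<le> esum (\<lambda>j. ennreal (v j * cmod (a j)) * ennreal (v (k - j) * cmod (b (k - j))))" for k
  proof -
    have "ennreal (v k * cmod (conv a b k)) = ennreal (v k) * ennreal (cmod (conv a b k))"
      using assms by (simp add: ennreal_mult')
    also have "\<dots> \<le> ennreal (v k) * esum (\<lambda>j. ennreal (cmod (a j * b (k - j))))"
      unfolding conv_def by (intro mult_left_mono norm_infsum_le_esum) auto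
    also have "\<dots> = esum (\<lambda>j. ennreal (v k) * ennreal (cmod (a j * b (k - j))))"
      by (rule esum_cmult[symmetric])
    also have "\<dots> \<le> esum (\<lambda>j. ennreal (v j * cmod (a j)) * ennreal (v (k - j) * cmod (b (k - j))))"
    proof (rule esum_mono)
      fix j
      have "v k * (cmod (a j) * cmod (b (k - j))) \<le> (v j * v (k - j)) * (cmod (a j) * cmod (b (k - j)))"
        using assms(2)[of j "k - j"] by (intro mult_right_mono) auto
      then show "ennreal (v k) * ennreal (cmod (a j * b (k - j)))
          \<le> ennreal (v j * cmod (a j)) * ennreal (v (k - j) * cmod (b (k - j)))"
        using assms(1) by (simp add: ennreal_mult'[symmetric] ennreal_mult[symmetric] norm_mult ennreal_leI mult_ac)
    qed
    finally show ?thesis .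
  qed
  then have "wnorm v (conv a b)
      \<le> esum (\<lambda>k. esum (\<lambda>j. ennreal (v j * cmod (a j)) * ennreal (v (k - j) * cmod (b (k - j)))))"
    unfolding wnorm_def by (intro esum_mono)
  also have "\<dots> = esum (\<lambda>j. ennreal (v j * cmod (a j)) * esum (\<lambda>k. ennreal (v (k - j) * cmod (b (k - j)))))"
    by (subst esum_swap) (simp add: esum_cmult)
  also have "\<dots> = esum (\<lambda>j. ennreal (v j * cmod (a j)) * wnorm v b)"
    using esum_shift[of "\<lambda>k. ennreal (v k * cmod (b k))" "- j" for j] by (simp add: wnorm_def)
  also have "\<dots> = wnorm v a * wnorm v b" by (simp add: esum_multc wnorm_def)
  finally show ?thesis .
qed

lemma wnorm_conv_weight: "weight v \<Longrightarrow> wnorm v (conv a b) \<le> wnorm v a * wnorm v b"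
  by (intro wnorm_conv weight_ge0 weight_submult)

lemma esum_conv_finite:
  assumes "a \<in> wiener" "b \<in> wiener"
  shows "esum (\<lambda>j. ennreal (cmod (a j * b (k - j)))) < top"
proof -
  have "esum (\<lambda>j. ennreal (cmod (a j * b (k - j)))) \<le> esum (\<lambda>j. ennreal (cmod (a j)) * wnorm1 b)"
    by (intro esum_mono) (simp add: norm_mult ennreal_mult cmod_le_wnorm1 mult_left_mono)
  also have "\<dots> = wnorm1 a * wnorm1 b" by (simp add: esum_multc wnorm_def)
  finally show ?thesis using assms unfolding wiener_iff
    by (metis ennreal_mult_less_top order_le_less_trans)
qed

lemma conv_summable:
  assumes "a \<in> wiener" "b \<in> wiener"
  shows "(\<lambda>j. a j * b (k - j)) summable_on UNIV"
  by (rule esum_imp_summable) (rule esum_conv_finite[OF assms])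

lemma infsum_shift: "(\<Sum>\<^sub>\<infinity>k. f (k + c)) = (\<Sum>\<^sub>\<infinity>k. f k)" for c :: int
  by (rule infsum_reindex_bij_betw) (simp add: bij_plus_right[unfolded add.commute])

lemma conv_assoc:
  assumes "a \<in> wiener" "b \<in> wiener" "c \<in> wiener"
  shows "conv (conv a b) c = conv a (conv b c)"
proof
  fix k
  \<comment> \<open>The premise for interchanging the sums. The last factor is bounded by the norm
    of \<open>c\<close>, which no single coefficient exceeds.\<close>
  have fin: "esum (\<lambda>i. esum (\<lambda>j. ennreal (cmod (a j * b (i - j) * c (k - i))))) < top"
  proof -
    have "esum (\<lambda>i. esum (\<lambda>j. ennreal (cmod (a j * b (i - j) * c (k - i)))))
        \<le> esum (\<lambda>i. esum (\<lambda>j. ennreal (cmod (a j)) * ennreal (cmod (b (i - j))) * wnorm1 c))"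
      by (intro esum_mono) (simp add: norm_mult ennreal_mult cmod_le_wnorm1 mult_left_mono)
    also have "\<dots> = esum (\<lambda>j. ennreal (cmod (a j)) * esum (\<lambda>i. ennreal (cmod (b (i - j)))) * wnorm1 c)"
      by (subst esum_swap) (simp add: esum_cmult esum_multc)
    also have "\<dots> = esum (\<lambda>j. ennreal (cmod (a j)) * wnorm1 b * wnorm1 c)"
      using esum_shift[of "\<lambda>k. ennreal (cmod (b k))" "- j" for j] by (simp add: wnorm_def)
    also have "\<dots> = wnorm1 a * wnorm1 b * wnorm1 c" by (simp add: esum_multc wnorm_def)
    also have "\<dots> < top" using assms by (simp add: wiener_iff ennreal_mult_less_top)
    finally show ?thesis .
  qed
  have "conv (conv a b) c k = (\<Sum>\<^sub>\<infinity>i. \<Sum>\<^sub>\<infinity>j. a j * b (i - j) * c (k - i))"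
    by (simp add: conv_def infsum_cmult_left')
  also have "\<dots> = (\<Sum>\<^sub>\<infinity>j. \<Sum>\<^sub>\<infinity>i. a j * b (i - j) * c (k - i))"
    by (rule infsum_swap_esum) (rule fin)
  also have "\<dots> = (\<Sum>\<^sub>\<infinity>j. a j * (\<Sum>\<^sub>\<infinity>i. b (i - j) * c (k - i)))"
    by (simp add: infsum_cmult_right' mult.assoc)
  also have "\<dots> = conv a (conv b c) k"
    unfolding conv_def
  proof (rule infsum_cong)
    fix j
    show "a j * (\<Sum>\<^sub>\<infinity>i. b (i - j) * c (k - i)) = a j * (\<Sum>\<^sub>\<infinity>i. b i * c (k - j - i))"
      using infsum_shift[of "\<lambda>i. b i * c (k - j - i)" "- j"] by simp
  qed
  finally show "conv (conv a b) c k = conv a (conv b c) k" .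
qed

lemma conv_commute: "conv a b = conv b a"
proof
  fix k
  have "bij (\<lambda>j. k - j :: int)" by (rule involuntory_imp_bij) simp
  from infsum_reindex_bij_betw[OF this, of "\<lambda>j. b j * a (k - j)"]
  show "conv a b k = conv b a k" by (simp add: conv_def mult.commute)
qed

lemma conv_cunit [simp]: "conv cunit a = a" "conv a cunit = a"
proof -
  show "conv cunit a = a"
  proof
    fix k
    have "conv cunit a k = (\<Sum>\<^sub>\<infinity>j\<in>{0}. cunit j * a (k - j))"
      unfolding conv_def by (rule infsum_cong_neutral) (auto simp: cunit_def)
    then show "conv cunit a k = a k" by (simp add: cunit_def)
  qed
  then show "conv a cunit = a" by (simp add: conv_commute)
qed

lemma cunit_wiener: "cunit \<in> wiener"
proof -
  have "(\<lambda>i. cmod (cunit i)) summable_on UNIV \<longleftrightarrow> (\<lambda>i. cmod (cunit i)) summable_on {0}"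
    by (rule summable_on_cong_neutral) (auto simp: cunit_def)
  then show ?thesis by (simp add: wiener_def)
qed

lemma wiener_diff: "a \<in> wiener \<Longrightarrow> b \<in> wiener \<Longrightarrow> (\<lambda>k. a k - b k) \<in> wiener"
  unfolding wiener_iff using wnorm_diff[of "\<lambda>_. 1" a b]
  by (simp add: order_le_less_trans)

lemma wiener_cmult: "a \<in> wiener \<Longrightarrow> (\<lambda>k. c * a k) \<in> wiener"
  unfolding wiener_iff by (subst wnorm_cmult) (auto simp: ennreal_mult_less_top)

lemma conv_diff_left:
  assumes "a \<in> wiener" "b \<in> wiener" "c \<in> wiener"
  shows "conv (\<lambda>k. a k - b k) c = (\<lambda>k. conv a c k - conv b c k)"
proof
  fix k
  have "((\<lambda>j. a j * c (k - j) - b j * c (k - j)) has_sum (conv a c k - conv b c k)) UNIV"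
    unfolding conv_def
    using has_sum_add[OF has_sum_infsum[OF conv_summable[OF assms(1,3), of k]]
        has_sum_uminusI[OF has_sum_infsum[OF conv_summable[OF assms(2,3), of k]]]] by simp
  then show "conv (\<lambda>k. a k - b k) c k = conv a c k - conv b c k"
    by (simp add: conv_def left_diff_distrib infsumI)
qed

lemma conv_add_left:
  assumes "a \<in> wiener" "b \<in> wiener" "c \<in> wiener"
  shows "conv (\<lambda>k. a k + b k) c = (\<lambda>k. conv a c k + conv b c k)"
  using infsum_add[OF conv_summable[OF assms(1,3)] conv_summable[OF assms(2,3)]]
  by (auto simp: conv_def distrib_right)

lemma conv_cmult_left: "conv (\<lambda>k. s * a k) c = (\<lambda>k. s * conv a c k)"
  by (simp add: conv_def fun_eq_iff mult.assoc infsum_cmult_right')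

lemma wnorm_finite_support:
  assumes "finite {k. p k \<noteq> 0}" "\<And>k. 0 \<le> v k"
  shows "wnorm v p < top"
proof -
  have "(\<lambda>k. norm (v k * cmod (p k))) summable_on UNIV"
    by (rule finite_nonzero_values_imp_summable_on) (rule finite_subset[OF _ assms(1)], auto)
  from this[folded esum_finite_iff] show ?thesis
    using assms(2) by (simp add: wnorm_def abs_mult)
qed

lemma wiener_truncation:
  assumes c: "c \<in> wiener" and e: "e > 0"
  obtains p where "finite {k. p k \<noteq> 0}" "wnorm1 (\<lambda>k. c k - p k) \<le> ennreal e"
proof -
  let ?g = "\<lambda>k. cmod (c k)"
  have s: "?g summable_on UNIV" using c by (simp add: wiener_def)
  obtain F where F: "finite F" "dist (sum ?g F) (infsum ?g UNIV) \<le> e"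
    using infsum_finite_approximation[OF s e] by blast
  define p where "p k = (if k \<in> F then c k else 0)" for k
  have "esum (\<lambda>k. ennreal (cmod (c k - p k))) \<le> ennreal e"
  proof (rule esum_le_finite_sums)
    fix G :: "int set" assume G: "finite G"
    have "(\<Sum>k\<in>G. cmod (c k - p k)) = (\<Sum>k\<in>G - F. ?g k)"
      by (rule sum.mono_neutral_cong_right) (auto simp: G p_def)
    also have "\<dots> = sum ?g (G \<union> F) - sum ?g F"
      using sum.union_disjoint[of "G - F" F ?g] G F by (simp add: Int_commute)
    also have "sum ?g (G \<union> F) \<le> infsum ?g UNIV"
      by (rule finite_sum_le_infsum[OF s]) (use G F in auto)
    finally show "(\<Sum>k\<in>G. cmod (c k - p k)) \<le> e"
      using F(2) by (simp add: dist_real_def)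
  qed auto
  moreover have "finite {k. p k \<noteq> 0}"
    by (rule finite_subset[OF _ F(1)]) (auto simp: p_def)
  ultimately show thesis using that by (simp add: wnorm_def)
qed

text \<open>As soon as one factor on the right is cut off at \<open>N\<close>, the product is at
  least \<open>N\<close>, because the other factor is at least 1.\<close>

lemma weight_min:
  assumes v: "weight v" and N: "1 \<le> N"
  shows "weight (\<lambda>k. min (v k) N)"
  unfolding weight_def
proof (intro conjI allI)
  show "1 \<le> min (v k) N" for k using weight_ge1[OF v] N by simp
  fix j k
  have 1: "1 \<le> v j" "1 \<le> v k" using weight_ge1[OF v] by auto
  have "v j * N \<ge> N" "N * v k \<ge> N" "N * N \<ge> N"
    using 1 N mult_right_mono[of 1 "v j" N] mult_left_mono[of 1 "v k" N] mult_left_mono[of 1 N N] by auto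
  then show "min (v (j + k)) N \<le> min (v j) N * min (v k) N"
    using weight_submult[OF v, of j k] by (auto simp: min_def)
qed

text \<open>The weighted norm of \<open>c\<close> is not known to be finite beforehand; truncating the weight at
  level \<open>N\<close> keeps it submultiplicative and makes the norm of \<open>c\<close> finite, so that the term
  \<open>u * c\<close> can be absorbed.\<close>

lemma wnorm_absorb:
  assumes v: "weight v" and c: "c \<in> wiener"
    and eq: "c = (\<lambda>k. p k + conv u c k)"
    and u: "wnorm v u \<le> ennreal q" and q: "0 \<le> q" "q < 1"
  shows "wnorm v c \<le> ennreal (1 / (1 - q)) * wnorm v p"
proof (cases "wnorm v p = top")
  case True
  then show ?thesis using q by (simp add: ennreal_mult_top)
next
  case False
  define P where "P = enn2real (wnorm v p)"
  have P: "wnorm v p = ennreal P" "0 \<le> P" using False by (auto simp: P_def less_top)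
  have trunc: "wnorm (\<lambda>k. min (v k) N) c \<le> ennreal (1 / (1 - q) * P)" if N: "1 \<le> N" for N
  proof -
    let ?w = "\<lambda>k. min (v k) N"
    note w = weight_min[OF v N]
    have "wnorm ?w c \<le> wnorm (\<lambda>_. N) c" by (rule wnorm_mono) simp
    also have "\<dots> = ennreal N * wnorm1 c"
      using N by (simp add: wnorm_def ennreal_mult' esum_cmult)
    also have "\<dots> < top" using c by (simp add: wiener_iff ennreal_mult_less_top)
    finally have fin: "wnorm ?w c < top" .
    define X where "X = enn2real (wnorm ?w c)"
    have X: "wnorm ?w c = ennreal X" "0 \<le> X" using fin by (auto simp: X_def less_top)
    have "wnorm ?w c \<le> wnorm ?w p + wnorm ?w (conv u c)"
      by (subst (1) eq) (intro wnorm_add weight_ge0 w)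
    also have "\<dots> \<le> wnorm v p + wnorm ?w u * wnorm ?w c"
      by (intro add_mono wnorm_conv_weight w wnorm_mono) auto
    also have "\<dots> \<le> ennreal P + ennreal q * ennreal X"
      unfolding P X by (intro add_mono mult_right_mono order_trans[OF wnorm_mono u]) auto
    also have "\<dots> = ennreal (P + q * X)" using P X q by (simp add: ennreal_mult)
    finally have "ennreal X \<le> ennreal (P + q * X)" unfolding X .
    then have "X \<le> P + q * X" using X P q by (subst (asm) ennreal_le_iff) auto
    \<comment> \<open>Absorption of \<open>q * X\<close> is legitimate because \<open>X\<close> is a
      real number; this is what the cut-off of the weight was for.\<close>
    then have "X \<le> 1 / (1 - q) * P" using q by (simp add: field_simps)
    then show ?thesis by (simp add: X ennreal_leI)
  qed
  have "wnorm v c \<le> ennreal (1 / (1 - q) * P)"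
    unfolding wnorm_def
  proof (rule esum_le_finite_sums)
    fix F :: "int set" assume F: "finite F"
    \<comment> \<open>High enough for the cut-off weight to agree with \<open>v\<close> on
      \<open>F\<close>. The bound does not depend on \<open>N\<close>.\<close>
    define N where "N = Max (insert 1 (v ` F))"
    have N: "1 \<le> N" "\<And>k. k \<in> F \<Longrightarrow> v k \<le> N" using F by (auto simp: N_def)
    have "(\<Sum>k\<in>F. v k * cmod (c k)) = (\<Sum>k\<in>F. min (v k) N * cmod (c k))"
      using N by (intro sum.cong) (auto simp: min_def)
    also have "\<dots> \<le> 1 / (1 - q) * P"
    proof (rule finite_sum_le_esum[OF _ _ _ F])
      show "esum (\<lambda>k. ennreal (min (v k) N * cmod (c k))) \<le> ennreal (1 / (1 - q) * P)"
        using trunc[OF N(1)] by (simp add: wnorm_def)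
    qed (use P q weight_ge0[OF weight_min[OF v N(1)]] in auto)
    finally show "(\<Sum>k\<in>F. v k * cmod (c k)) \<le> 1 / (1 - q) * P" .
  qed (use weight_ge0[OF v] in auto)
  then show ?thesis using P q by (simp add: ennreal_mult[symmetric])
qed

text \<open>In the weight \<open>v\<close> itself, \<open>u\<close> has finite but possibly large
  norm. The interpolating weight \<open>vt t\<close> bounds it by \<open>(1 - t)\<close> times the
  small unweighted norm plus \<open>t\<close> times the large one, which is below 1 for small
  \<open>t\<close>. This is why part of the weight is lost.\<close>

lemma weighted_inverse:
  assumes v: "weight v" and b: "wnorm v b < top" and c: "c \<in> wiener" and inv: "conv c b = cunit"
    and vt: "\<And>t. 0 < t \<Longrightarrow> t \<le> 1 \<Longrightarrow> weight (vt t)"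
      "\<And>t k. 0 < t \<Longrightarrow> t \<le> 1 \<Longrightarrow> vt t k \<le> (1 - t) + t * v k"
  shows "\<exists>t. 0 < t \<and> t \<le> 1 \<and> wnorm (vt t) c < top"
proof -
  have bw: "b \<in> wiener" using wnorm1_le[OF v, of b] b by (simp add: wiener_iff order_le_less_trans)
  define B where "B = enn2real (wnorm1 b)"
  have B: "wnorm1 b = ennreal B" "0 \<le> B" using bw by (auto simp: B_def less_top wiener_iff)
  \<comment> \<open>The tolerance makes the unweighted norm of \<open>u\<close> at most
    \<open>1 / 2\<close>; adding 1 to \<open>B\<close> keeps the denominator positive.\<close>
  obtain p where p: "finite {k. p k \<noteq> 0}"
    and cp: "wnorm1 (\<lambda>k. c k - p k) \<le> ennreal (1 / (2 * (B + 1)))"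
    using wiener_truncation[OF c, of "1 / (2 * (B + 1))"] B by auto
  have pw: "p \<in> wiener" using wnorm_finite_support[OF p, of "\<lambda>_. 1"] by (simp add: wiener_iff)
  define u where "u = conv (\<lambda>k. c k - p k) b"
  have u: "u = (\<lambda>k. cunit k - conv p b k)"
    unfolding u_def by (simp add: conv_diff_left c pw bw inv)
  have u1: "wnorm1 u \<le> ennreal (1 / 2)"
  proof -
    have "wnorm1 u \<le> wnorm1 (\<lambda>k. c k - p k) * wnorm1 b"
      unfolding u_def by (rule wnorm_conv_weight) simp
    also have "\<dots> \<le> ennreal (1 / (2 * (B + 1))) * ennreal B"
      unfolding B by (intro mult_right_mono cp) auto
    also have "\<dots> = ennreal (1 / (2 * (B + 1)) * B)"
      using B by (intro ennreal_mult[symmetric]) auto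
    also have "\<dots> \<le> ennreal (1 / 2)"
      by (rule ennreal_leI) (use B in \<open>simp add: field_simps\<close>)
    finally show ?thesis .
  qed
  have "wnorm v u \<le> wnorm v cunit + wnorm v (conv p b)"
    unfolding u by (intro wnorm_diff weight_ge0 v)
  also have "\<dots> \<le> wnorm v cunit + wnorm v p * wnorm v b"
    by (intro add_mono wnorm_conv_weight v order_refl)
  also have "\<dots> < top"
    using b wnorm_finite_support[OF p, of v] weight_ge0[OF v]
      wnorm_finite_support[of cunit v] by (simp add: ennreal_mult_less_top cunit_def)
  finally have uv: "wnorm v u < top" .
  define U where "U = enn2real (wnorm v u)"
  have U: "wnorm v u = ennreal U" "0 \<le> U" using uv by (auto simp: U_def less_top)
  \<comment> \<open>Chosen so that \<open>t * U \<le> 1 / 4\<close>; with the \<open>1 / 2\<close>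
    from the unweighted norm the total is \<open>3 / 4\<close>.\<close>
  define t where "t = 1 / (4 * (U + 1))"
  have t: "0 < t" "t \<le> 1" "t * U \<le> 1 / 4" using U by (auto simp: t_def field_simps)
  note w = vt(1)[OF t(1,2)]
  have "wnorm (vt t) u \<le> wnorm (\<lambda>k. (1 - t) + t * v k) u"
    by (rule wnorm_mono) (rule vt(2)[OF t(1,2)])
  also have "\<dots> = ennreal (1 - t) * wnorm1 u + ennreal t * wnorm v u"
    using t weight_ge0[OF v]
    by (simp add: wnorm_def esum_cmult[symmetric] esum_add[symmetric] ennreal_mult[symmetric]
        ennreal_plus[symmetric] distrib_right mult.assoc del: ennreal_plus)
  also have "\<dots> \<le> ennreal (1 - t) * ennreal (1 / 2) + ennreal t * ennreal U"
    unfolding U by (intro add_mono mult_left_mono u1) auto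
  also have "\<dots> = ennreal ((1 - t) * (1 / 2)) + ennreal (t * U)"
    using t U by (intro arg_cong2[of _ _ _ _ plus] ennreal_mult[symmetric]) auto
  also have "\<dots> = ennreal ((1 - t) * (1 / 2) + t * U)"
    using t U by (intro ennreal_plus[symmetric]) auto
  also have "\<dots> \<le> ennreal (3 / 4)"
  proof (rule ennreal_leI)
    have "(1 - t) * (1 / 2) \<le> 1 / 2" using t(1) by simp
    from add_mono[OF this t(3)] show "(1 - t) * (1 / 2) + t * U \<le> 3 / 4" by simp
  qed
  finally have q: "wnorm (vt t) u \<le> ennreal (3 / 4)" .
  \<comment> \<open>By associativity \<open>u * c = (c - p) * (b * c) = c - p\<close>.\<close>
  have "conv u c = (\<lambda>k. c k - p k)"
    unfolding u_def using conv_assoc[OF wiener_diff[OF c pw] bw c] inv by (simp add: conv_commute)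
  then have "c = (\<lambda>k. p k + conv u c k)" by simp
  from wnorm_absorb[OF w c this q]
  have "wnorm (vt t) c \<le> ennreal 4 * wnorm (vt t) p" by simp
  also have "\<dots> < top"
    using wnorm_finite_support[OF p, of "vt t"] weight_ge0[OF w] by (simp add: ennreal_mult_less_top)
  finally show ?thesis using t by blast
qed

text \<open>The symbol \<open>z - a\<close> of \<open>z I - A\<close>.\<close>

definition shifted :: "complex \<Rightarrow> (int \<Rightarrow> complex) \<Rightarrow> int \<Rightarrow> complex" where
  "shifted z a k = z * cunit k - a k"

lemma shifted_wiener: "a \<in> wiener \<Longrightarrow> shifted z a \<in> wiener"
  using wiener_diff[OF wiener_cmult[OF cunit_wiener, of z], of a] by (simp add: shifted_def[abs_def])

text \<open>Multiply \<open>z - a = (z - w) + (w - a)\<close> by both inverses. The result is stated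
  as a fixed-point equation for \<open>d\<close>, as \<open>wnorm_absorb\<close> requires.\<close>

lemma resolvent_identity:
  assumes a: "a \<in> wiener" and c: "c \<in> wiener" "conv c (shifted z a) = cunit"
    and d: "d \<in> wiener" "conv d (shifted w a) = cunit"
  shows "d = (\<lambda>k. c k + (z - w) * conv c d k)"
proof -
  note sw = shifted_wiener[OF a]
  have "shifted z a = (\<lambda>k. (z - w) * cunit k + shifted w a k)"
    by (auto simp: shifted_def algebra_simps)
  then have e: "conv (shifted z a) d = (\<lambda>k. (z - w) * d k + cunit k)"
    using conv_add_left[OF wiener_cmult[OF cunit_wiener, of "z - w"] sw[of w] d(1)] d(2)
      conv_cmult_left[of "z - w" cunit d] by (simp add: conv_commute)
  have "d = conv (conv c (shifted z a)) d" by (simp add: c)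
  also have "\<dots> = conv c (conv (shifted z a) d)" by (rule conv_assoc) (use c d sw in auto)
  also have "\<dots> = conv (\<lambda>k. (z - w) * d k + cunit k) c" unfolding e by (rule conv_commute)
  also have "\<dots> = (\<lambda>k. (z - w) * conv d c k + c k)"
    using conv_add_left[OF wiener_cmult[OF d(1), of "z - w"] cunit_wiener c(1)]
      conv_cmult_left[of "z - w" d c] by simp
  finally show ?thesis by (simp add: conv_commute add.commute)
qed

text \<open>Carries a weighted bound from \<open>c\<close> to a neighbouring inverse
  \<open>d\<close>, of which only the unweighted norm is known to be finite. The factor 2 is
  \<open>1 / (1 - 1 / 2)\<close>.\<close>

lemma resolvent_locally_bounded:
  assumes v: "weight v" and a: "a \<in> wiener"
    and c: "c \<in> wiener" "conv c (shifted z a) = cunit"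
    and d: "d \<in> wiener" "conv d (shifted w a) = cunit"
    and C: "wnorm v c \<le> ennreal C" "0 \<le> C" and near: "cmod (z - w) * C \<le> 1 / 2"
  shows "wnorm v d \<le> ennreal (2 * C)"
proof -
  define u where "u = (\<lambda>k. (z - w) * c k)"
  have "d = (\<lambda>k. c k + conv u d k)"
    unfolding u_def using resolvent_identity[OF a c d] by (simp add: conv_cmult_left)
  moreover have "wnorm v u \<le> ennreal (1 / 2)"
  proof -
    have "wnorm v u = ennreal (cmod (z - w)) * wnorm v c"
      unfolding u_def by (rule wnorm_cmult) (rule weight_ge0[OF v])
    also have "\<dots> \<le> ennreal (cmod (z - w)) * ennreal C" by (intro mult_left_mono C) auto
    also have "\<dots> = ennreal (cmod (z - w) * C)" using C by (simp add: ennreal_mult)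
    also have "\<dots> \<le> ennreal (1 / 2)" by (rule ennreal_leI[OF near])
    finally show ?thesis .
  qed
  ultimately have "wnorm v d \<le> ennreal (1 / (1 - 1 / 2)) * wnorm v c"
    by (intro wnorm_absorb[OF v d(1)]) auto
  also have "\<dots> \<le> ennreal 2 * ennreal C" by (intro mult_mono C) auto
  finally show ?thesis using C by (simp add: ennreal_mult)
qed

lemma weight_linear: "0 \<le> t \<Longrightarrow> weight (\<lambda>k. 1 + t * real_of_int \<bar>k\<bar>)"
  unfolding weight_def
proof (intro conjI allI)
  assume t: "0 \<le> t"
  show "1 \<le> 1 + t * real_of_int \<bar>k\<bar>" for k using t by simp
  fix j k :: int
  have "t * real_of_int \<bar>j + k\<bar> \<le> t * (real_of_int \<bar>j\<bar> + real_of_int \<bar>k\<bar>)"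
    using t by (intro mult_left_mono) auto
  moreover have "0 \<le> (t * real_of_int \<bar>j\<bar>) * (t * real_of_int \<bar>k\<bar>)" using t by simp
  ultimately show "1 + t * real_of_int \<bar>j + k\<bar> \<le> (1 + t * real_of_int \<bar>j\<bar>) * (1 + t * real_of_int \<bar>k\<bar>)"
    by (simp add: algebra_simps)
qed

lemma weight_exp: "0 \<le> t \<Longrightarrow> weight (\<lambda>k. exp (t * real_of_int \<bar>k\<bar>))"
  unfolding weight_def
proof (intro conjI allI)
  assume t: "0 \<le> t"
  show "1 \<le> exp (t * real_of_int \<bar>k\<bar>)" for k using t by simp
  fix j k :: int
  have "t * real_of_int \<bar>j + k\<bar> \<le> t * (real_of_int \<bar>j\<bar> + real_of_int \<bar>k\<bar>)"
    using t by (intro mult_left_mono) auto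
  then show "exp (t * real_of_int \<bar>j + k\<bar>) \<le> exp (t * real_of_int \<bar>j\<bar>) * exp (t * real_of_int \<bar>k\<bar>)"
    by (simp add: exp_add[symmetric] distrib_left)
qed

text \<open>Convexity of \<open>exp\<close> between 0 and \<open>x\<close>; this is the
  interpolation condition of \<open>weighted_inverse\<close> for exponential weights.\<close>

lemma exp_convex_weight:
  assumes "0 < t" "t \<le> (1::real)"
  shows "exp (t * x) \<le> (1 - t) + t * exp x"
  using convex_onD[OF exp_convex, of t 0 x] assms by simp

subsection \<open>Fourier coefficients and inverses in the Wiener algebra\<close>

definition fourier :: "(real \<Rightarrow> complex) \<Rightarrow> int \<Rightarrow> complex" where
  "fourier g k = integral {0..2*pi} (\<lambda>t. g t * cis (- (of_int k * t))) / (2 * of_real pi)"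

lemma fourier_has_integral:
  assumes "continuous_on {0..2*pi} g"
  shows "((\<lambda>t. g t * cis (- (of_int k * t))) has_integral (2 * of_real pi * fourier g k)) {0..2*pi}"
proof -
  have "(\<lambda>t. g t * cis (- (of_int k * t))) integrable_on {0..2*pi}"
    by (intro integrable_continuous_real continuous_intros assms)
  then show ?thesis by (simp add: fourier_def has_integral_integral)
qed

lemma cis_has_integral:
  "((\<lambda>t. cis (of_int m * t)) has_integral (if m = 0 then 2 * of_real pi else 0)) {0..2*pi}"
proof (cases "m = 0")
  case True
  then show ?thesis using has_integral_const_real[of "1::complex" 0 "2*pi"]
    by (simp add: scaleR_conv_of_real)
next
  case False
  have "((\<lambda>t. cis (of_int m * t)) has_integral
      (cis (of_int m * (2*pi)) / (\<i> * of_int m) - cis (of_int m * 0) / (\<i> * of_int m))) {0..2*pi}"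
  proof (rule fundamental_theorem_of_calculus)
    fix x :: real
    have "((\<lambda>t. exp (\<i> * of_int m * t) / (\<i> * of_int m)) has_field_derivative exp (\<i> * of_int m * z)) (at z)" for z
      using False by (auto intro!: derivative_eq_intros)
    from has_vector_derivative_real_field[OF this[of "of_real x"]]
    have "((\<lambda>t. exp (\<i> * of_int m * of_real t) / (\<i> * of_int m)) has_vector_derivative
        exp (\<i> * of_int m * of_real x)) (at x within {0..2*pi})"
      by (rule has_vector_derivative_at_within)
    then show "((\<lambda>t. cis (of_int m * t) / (\<i> * of_int m)) has_vector_derivative cis (of_int m * x))
        (at x within {0..2*pi})"
      by (simp add: cis_conv_exp mult.assoc)
  qed simp
  moreover have "cis (of_int m * (2*pi)) = 1"
    using cis_multiple_2pi[of "of_int m"] by (simp add: mult_ac)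
  ultimately show ?thesis using False by simp
qed

text \<open>For the partial Fourier sum \<open>P\<close> over \<open>F\<close>, the integrals of
  \<open>g * cnj P\<close> and of \<open>P * cnj P\<close> agree, and the square of
  \<open>cmod (g - P)\<close> is nonnegative. Of \<open>g\<close> itself only the bound
  \<open>M\<close> is kept.\<close>

lemma bessel:
  assumes g: "continuous_on {0..2*pi} g" and M: "\<And>t. t \<in> {0..2*pi} \<Longrightarrow> cmod (g t) \<le> M"
    and F: "finite F"
  shows "(\<Sum>k\<in>F. (cmod (fourier g k))\<^sup>2) \<le> M\<^sup>2"
proof -
  define P where "P t = (\<Sum>k\<in>F. fourier g k * cis (of_int k * t))" for t
  define S where "S = (\<Sum>k\<in>F. (cmod (fourier g k))\<^sup>2)"
  have S: "of_real S = (\<Sum>k\<in>F. cnj (fourier g k) * fourier g k)"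
    unfolding S_def of_real_sum complex_norm_square by (simp add: mult.commute)
  have cP: "cnj (P t) = (\<Sum>k\<in>F. cnj (fourier g k) * cis (- (of_int k * t)))" for t
    by (simp add: P_def cis_cnj)
  have 1: "((\<lambda>t. g t * cnj (P t)) has_integral (2 * of_real pi * of_real S)) {0..2*pi}"
  proof -
    have "((\<lambda>t. \<Sum>k\<in>F. cnj (fourier g k) * (g t * cis (- (of_int k * t)))) has_integral
        (\<Sum>k\<in>F. cnj (fourier g k) * (2 * of_real pi * fourier g k))) {0..2*pi}"
      by (intro has_integral_sum F has_integral_mult_right fourier_has_integral g)
    then show ?thesis by (simp add: cP S sum_distrib_left mult_ac)
  qed
  have 2: "((\<lambda>t. P t * cnj (P t)) has_integral (2 * of_real pi * of_real S)) {0..2*pi}"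
  proof -
    have "((\<lambda>t. \<Sum>k\<in>F. \<Sum>l\<in>F. (fourier g k * cnj (fourier g l)) * cis (of_int (k - l) * t)) has_integral
       (\<Sum>k\<in>F. \<Sum>l\<in>F. (fourier g k * cnj (fourier g l)) * (if k - l = 0 then 2 * of_real pi else 0)))
       {0..2*pi}"
      by (intro has_integral_sum F has_integral_mult_right cis_has_integral)
    moreover have "(\<Sum>k\<in>F. \<Sum>l\<in>F. (fourier g k * cnj (fourier g l)) * cis (of_int (k - l) * t)) = P t * cnj (P t)" for t
      by (subst cP, subst P_def) (auto simp: sum_product cis_mult algebra_simps intro!: sum.cong)
    moreover have "(\<Sum>k\<in>F. \<Sum>l\<in>F. (fourier g k * cnj (fourier g l)) * (if k - l = 0 then 2 * of_real pi else 0))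
        = 2 * of_real pi * of_real S"
      unfolding S sum_distrib_left
      by (intro sum.cong refl) (simp add: F if_distrib sum.delta' mult_ac cong: if_cong)
    ultimately show ?thesis by simp
  qed
  have "((\<lambda>t. 2 * Re (g t * cnj (P t)) - Re (P t * cnj (P t))) has_integral (2 * (2 * pi * S) - 2 * pi * S)) {0..2*pi}"
    using has_integral_diff[OF has_integral_mult_right[OF has_integral_linear[OF 1 bounded_linear_Re]]
        has_integral_linear[OF 2 bounded_linear_Re], of 2]
    by (simp add: o_def)
  moreover have "((\<lambda>t. M\<^sup>2) has_integral (2 * pi) * M\<^sup>2) {0..2*pi}"
    using has_integral_const_real[of "M\<^sup>2" 0 "2*pi"] by simp
  ultimately have "2 * (2 * pi * S) - 2 * pi * S \<le> (2 * pi) * M\<^sup>2"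
  proof (rule has_integral_le)
    fix t assume t: "t \<in> {0..2*pi}"
    have "0 \<le> (cmod (g t - P t))\<^sup>2" by simp
    also have "(cmod (g t - P t))\<^sup>2 = (cmod (g t))\<^sup>2 - (2 * Re (g t * cnj (P t)) - Re (P t * cnj (P t)))"
      unfolding cmod_power2 by (simp add: power2_eq_square algebra_simps)
    finally show "2 * Re (g t * cnj (P t)) - Re (P t * cnj (P t)) \<le> M\<^sup>2"
      using power_mono[OF M[OF t], of 2] by simp
  qed
  then have "2 * pi * S \<le> 2 * pi * M\<^sup>2" by simp
  then show ?thesis by (simp add: S_def)
qed

text \<open>The shifted period is cut at \<open>2*pi\<close> and the overhang is moved back by
  periodicity.\<close>

lemma fourier_shift:
  assumes g: "continuous_on UNIV g" and per: "\<And>t. g (t + 2*pi) = g t" and s: "0 \<le> s" "s \<le> 2*pi"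
  shows "fourier (\<lambda>t. g (t + s)) k = cis (of_int k * s) * fourier g k"
proof -
  define G where "G t = g t * cis (- (of_int k * t))" for t
  have cG: "continuous_on A G" for A
    unfolding G_def by (intro continuous_intros continuous_on_subset[OF g]) auto
  have perG: "G (t + 2*pi) = G t" for t
  proof -
    have "cis (- (of_int k * (t + 2*pi))) = cis (- (of_int k * t)) * cis (2 * pi * of_int (-k))"
      by (simp add: cis_mult algebra_simps)
    then show ?thesis using cis_multiple_2pi[of "of_int (-k)"] by (simp add: G_def per)
  qed
  have int: "G integrable_on {u..v}" for u v by (intro integrable_continuous_real cG)
  have "integral {0..2*pi} (\<lambda>t. G (t + s)) = integral {s..2*pi + s} G"
    using integral_shift_real_ivl[of s s "2*pi + s" G] by simp
  also have "\<dots> = integral {s..2*pi} G + integral {2*pi..2*pi + s} G"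
    by (rule Henstock_Kurzweil_Integration.integral_combine[symmetric]) (use s int in auto)
  also have "integral {2*pi..2*pi + s} G = integral {0..s} (\<lambda>t. G (t + 2*pi))"
    using integral_shift_real_ivl[of "2*pi" "2*pi" "2*pi + s" G] by simp
  also have "\<dots> = integral {0..s} G" by (simp add: perG)
  also have "integral {s..2*pi} G + integral {0..s} G = integral {0..2*pi} G"
    using Henstock_Kurzweil_Integration.integral_combine[of 0 s "2*pi" G] s int by (simp add: add.commute)
  finally have I: "integral {0..2*pi} (\<lambda>t. G (t + s)) = integral {0..2*pi} G" .
  have "g (t + s) * cis (- (of_int k * t)) = cis (of_int k * s) * G (t + s)" for t
    by (simp add: G_def cis_mult algebra_simps)
  then have "fourier (\<lambda>t. g (t + s)) k = integral {0..2*pi} (\<lambda>t. cis (of_int k * s) * G (t + s)) / (2 * of_real pi)"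
    by (simp add: fourier_def)
  also have "\<dots> = cis (of_int k * s) * fourier g k"
    by (simp add: integral_mult_right I) (simp add: fourier_def G_def[abs_def])
  finally show ?thesis .
qed

lemma fourier_diff:
  assumes "continuous_on {0..2*pi} g" "continuous_on {0..2*pi} h"
  shows "fourier (\<lambda>t. g t - h t) k = fourier g k - fourier h k"
proof -
  have "((\<lambda>t. (g t - h t) * cis (- (of_int k * t))) has_integral
      (2 * of_real pi * fourier g k - 2 * of_real pi * fourier h k)) {0..2*pi}"
    using has_integral_diff[OF assms[THEN fourier_has_integral], of k k] by (simp add: left_diff_distrib)
  then show ?thesis by (simp add: fourier_def[of "\<lambda>t. g t - h t"] integral_unique diff_divide_distrib)
qed

lemma laurent_cis: "laurent b (cis t) = (\<Sum>\<^sub>\<infinity>k. b k * cis (of_int k * t))"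
  by (simp add: laurent_def cis_power_int)

text \<open>The Laurent series converges uniformly on the circle, so it may be integrated term by
  term; each term shifts the Fourier index by \<open>j\<close>.\<close>

lemma fourier_conv:
  assumes b: "b \<in> wiener" and g: "continuous_on {0..2*pi} g"
  shows "fourier (\<lambda>t. laurent b (cis t) * g t) k = conv b (fourier g) k"
proof -
  have bdd: "bounded (g ` {0..2*pi})"
    by (intro compact_imp_bounded compact_continuous_image g) simp
  then obtain M where "\<forall>x\<in>g ` {0..2*pi}. cmod x \<le> M" unfolding bounded_iff by blast
  then have M: "cmod (g t) \<le> M" if "t \<in> {0..2*pi}" for t using that by blast
  let ?f = "\<lambda>j t. b j * (g t * cis (- (of_int (k - j) * t)))"
  have "uniform_limit {0..2*pi} (\<lambda>X t. \<Sum>j\<in>X. ?f j t) (\<lambda>t. \<Sum>\<^sub>\<infinity>j. ?f j t) (finite_subsets_at_top UNIV)"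
  proof (rule Weierstrass_m_test_general)
    show "cmod (?f j t) \<le> cmod (b j) * M" if "t \<in> {0..2*pi}" for j t
      using M[OF that] by (simp add: norm_mult mult_left_mono)
    show "(\<lambda>j. cmod (b j) * M) summable_on UNIV"
      using b by (intro summable_on_cmult_left) (simp add: wiener_def)
  qed
  then obtain I J where I: "\<And>X. ((\<lambda>t. \<Sum>j\<in>X. ?f j t) has_integral I X) {0..2*pi}"
    and J: "((\<lambda>t. \<Sum>\<^sub>\<infinity>j. ?f j t) has_integral J) {0..2*pi}"
    and lim: "(I \<longlongrightarrow> J) (finite_subsets_at_top UNIV)"
    by (rule uniform_limit_integral) (auto intro!: continuous_intros g)
  have "(\<lambda>t. \<Sum>\<^sub>\<infinity>j. ?f j t) = (\<lambda>t. laurent b (cis t) * g t * cis (- (of_int k * t)))"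
  proof
    fix t
    have "(\<Sum>\<^sub>\<infinity>j. ?f j t) = (\<Sum>\<^sub>\<infinity>j. b j * cis (of_int j * t) * (g t * cis (- (of_int k * t))))"
      by (intro infsum_cong) (simp add: cis_mult algebra_simps)
    also have "\<dots> = laurent b (cis t) * (g t * cis (- (of_int k * t)))"
      unfolding laurent_cis by (rule infsum_cmult_left')
    finally show "(\<Sum>\<^sub>\<infinity>j. ?f j t) = laurent b (cis t) * g t * cis (- (of_int k * t))"
      by (simp only: mult.assoc)
  qed
  with J have J': "fourier (\<lambda>t. laurent b (cis t) * g t) k = J / (2 * of_real pi)"
    by (simp add: fourier_def integral_unique)
  \<comment> \<open>The limit theorem only provides some integrals \<open>I X\<close>; for finite
    \<open>X\<close> uniqueness identifies them with the partial sums of the convolution.\<close>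
  have "I X = (\<Sum>j\<in>X. b j * (2 * of_real pi * fourier g (k - j)))" if "finite X" for X
    by (rule has_integral_unique[OF I])
      (intro has_integral_sum that has_integral_mult_right fourier_has_integral g)
  then have "eventually (\<lambda>X. I X = (\<Sum>j\<in>X. b j * (2 * of_real pi * fourier g (k - j)))) (finite_subsets_at_top UNIV)"
    by (intro eventually_finite_subsets_at_top_weakI) auto
  from Lim_transform_eventually[OF lim this]
  have "((\<lambda>X. \<Sum>j\<in>X. b j * (2 * of_real pi * fourier g (k - j))) \<longlongrightarrow> J) (finite_subsets_at_top UNIV)" .
  then have "((\<lambda>j. b j * (2 * of_real pi * fourier g (k - j))) has_sum J) UNIV"
    by (simp add: has_sum_def)
  then have "(\<Sum>\<^sub>\<infinity>j. (2 * of_real pi) * (b j * fourier g (k - j))) = J"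
    by (simp add: infsumI mult_ac)
  then have "2 * of_real pi * conv b (fourier g) k = J"
    by (simp add: conv_def infsum_cmult_right')
  then show ?thesis unfolding J' by auto
qed

lemma fourier_one: "fourier (\<lambda>_. 1) = cunit"
proof
  fix k
  show "fourier (\<lambda>_. 1) k = cunit k"
    using integral_unique[OF cis_has_integral[of "-k"]] by (simp add: fourier_def cunit_def)
qed

lemma norm_cis_minus_one: "cmod (cis x - 1) = 2 * \<bar>sin (x / 2)\<bar>"
proof -
  have "(cmod (cis x - 1))\<^sup>2 = (2 * \<bar>sin (x / 2)\<bar>)\<^sup>2"
  proof -
    have "(cmod (cis x - 1))\<^sup>2 = 2 - 2 * cos x"
      using sin_cos_squared_add[of x] unfolding cmod_power2 by (simp add: power2_eq_square algebra_simps)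
    also have "cos x = 1 - 2 * (sin (x / 2))\<^sup>2" using cos_double_sin[of "x / 2"] by simp
    finally show ?thesis by (simp add: power_mult_distrib)
  qed
  then show ?thesis by (rule power2_eq_imp_eq) auto
qed

lemma norm_cis_diff_le: "cmod (cis x - cis y) \<le> \<bar>x - y\<bar>"
proof -
  have "cis x - cis y = cis y * (cis (x - y) - 1)" by (simp add: algebra_simps cis_mult)
  then have "cmod (cis x - cis y) = 2 * \<bar>sin ((x - y) / 2)\<bar>" by (simp add: norm_mult norm_cis_minus_one)
  also have "\<dots> \<le> 2 * \<bar>(x - y) / 2\<bar>" by (intro mult_left_mono abs_sin_x_le_abs_x) simp
  finally show ?thesis by simp
qed

text \<open>\<open>sin x / x\<close> tends to 1 at 0, so it exceeds \<open>1 / 2\<close> nearby. The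
  lower bound lets the Fourier coefficients of \<open>g(t + s) - g(t)\<close> control
  \<open>k\<close> times those of \<open>g\<close>.\<close>

lemma norm_cis_minus_one_ge: "\<exists>e>0. \<forall>x. \<bar>x\<bar> < e \<longrightarrow> \<bar>x\<bar> / 2 \<le> cmod (cis x - 1)"
proof -
  have "((\<lambda>x::real. sin x / x) \<longlongrightarrow> 1) (at 0)"
    using DERIV_sin[of "0::real"] by (simp add: has_field_derivative_iff)
  then have "eventually (\<lambda>x::real. 1 / 2 < sin x / x) (at 0)" by (rule order_tendstoD) simp
  then obtain d where d: "d > 0" "\<And>x::real. x \<noteq> 0 \<Longrightarrow> \<bar>x\<bar> < d \<Longrightarrow> 1 / 2 < sin x / x"
    by (auto simp: eventually_at dist_real_def)
  have "\<bar>x\<bar> / 2 \<le> cmod (cis x - 1)" if "\<bar>x\<bar> < d" for x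
  proof (cases "x = 0")
    case False
    then have "1 / 2 \<le> \<bar>sin (x / 2) / (x / 2)\<bar>"
      using d(2)[of "x / 2"] that by (intro order_trans[OF less_imp_le abs_ge_self]) auto
    then have "1 / 2 * \<bar>x / 2\<bar> \<le> \<bar>sin (x / 2) / (x / 2)\<bar> * \<bar>x / 2\<bar>" by (rule mult_right_mono) simp
    also have "\<dots> = \<bar>sin (x / 2)\<bar>" using False by (simp add: abs_mult abs_divide)
    finally show ?thesis by (simp add: norm_cis_minus_one)
  qed simp
  then show ?thesis using d by blast
qed

text \<open>The term at 0 is 0 by the convention \<open>1 / 0 = 0\<close>, and the overlap of the
  two ranges at 0 does no harm.\<close>

lemma summable_on_inverse_squares_int: "(\<lambda>k::int. 1 / (real_of_int k)\<^sup>2) summable_on UNIV"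
proof -
  have nat: "(\<lambda>n::nat. 1 / (real n)\<^sup>2) summable_on UNIV"
  proof (rule norm_summable_imp_summable_on)
    show "summable (\<lambda>n::nat. norm (1 / (real n)\<^sup>2))"
      using inverse_power_summable[of 2, where 'a = real] by (simp add: field_simps)
  qed
  have "(\<lambda>k::int. 1 / (real_of_int k)\<^sup>2) summable_on (range int)"
    by (subst summable_on_reindex) (use nat in \<open>auto simp: o_def\<close>)
  moreover have "(\<lambda>k::int. 1 / (real_of_int k)\<^sup>2) summable_on (range (\<lambda>n. - int n))"
    by (subst summable_on_reindex) (use nat in \<open>auto simp: o_def inj_on_def\<close>)
  ultimately have "(\<lambda>k::int. 1 / (real_of_int k)\<^sup>2) summable_on (range int \<union> range (\<lambda>n. - int n))"
    by (rule summable_on_union)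
  moreover have "range int \<union> range (\<lambda>n. - int n) = UNIV"
  proof -
    have "k \<in> range int \<union> range (\<lambda>n. - int n)" for k
      by (cases k rule: int_cases2) auto
    then show ?thesis by auto
  qed
  ultimately show ?thesis by simp
qed

text \<open>Bessel's inequality for the difference \<open>h(t + s) - h(t)\<close>, divided by \<open>s\<close>, replaces the
  estimate for the derivative of \<open>h = 1 / b\<close>.\<close>

lemma fourier_lipschitz_wiener:
  assumes g: "continuous_on UNIV g" and per: "\<And>t. g (t + 2*pi) = g t"
    and lip: "\<And>s t. cmod (g s - g t) \<le> L * \<bar>s - t\<bar>"
  shows "fourier g \<in> wiener"
proof -
  obtain e where e: "e > 0" "\<And>x. \<bar>x\<bar> < e \<Longrightarrow> \<bar>x\<bar> / 2 \<le> cmod (cis x - 1)"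
    using norm_cis_minus_one_ge by blast
  have sq: "(\<Sum>k\<in>F. (real_of_int k)\<^sup>2 * (cmod (fourier g k))\<^sup>2) \<le> 4 * L\<^sup>2" if F: "finite F" for F
  proof -
    define N where "N = Max (insert 1 ((\<lambda>k. real_of_int \<bar>k\<bar>) ` F))"
    have N: "1 \<le> N" "\<And>k. k \<in> F \<Longrightarrow> real_of_int \<bar>k\<bar> \<le> N" using F by (auto simp: N_def)
    \<comment> \<open>The step depends on \<open>F\<close>: every \<open>k * s\<close> must lie
      where the lower bound for \<open>cis\<close> holds, and \<open>fourier_shift\<close> allows at
      most one period. The final estimate is uniform in \<open>F\<close> because \<open>s\<close>
      cancels.\<close>
    define s where "s = min (2*pi) (e / (2 * N))"
    have s: "0 < s" "s \<le> 2*pi" using e N by (auto simp: s_def)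
    have ks: "\<bar>real_of_int k * s\<bar> < e" if "k \<in> F" for k
    proof -
      have "\<bar>real_of_int k * s\<bar> \<le> N * (e / (2 * N))"
        unfolding abs_mult using N(2)[OF that] N(1) s e by (intro mult_mono) (auto simp: s_def)
      also have "\<dots> < e" using e N by simp
      finally show ?thesis .
    qed
    have fs: "fourier (\<lambda>t. g (t + s) - g t) k = (cis (of_int k * s) - 1) * fourier g k" for k
    proof -
      have "continuous_on {0..2*pi} (\<lambda>t. g (t + s))"
        by (rule continuous_on_compose2[OF g]) (auto intro!: continuous_intros)
      then have "fourier (\<lambda>t. g (t + s) - g t) k = fourier (\<lambda>t. g (t + s)) k - fourier g k"
        by (rule fourier_diff) (rule continuous_on_subset[OF g], simp)
      then show ?thesis using fourier_shift[OF g per, of s k] s by (simp add: algebra_simps)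
    qed
    have "(\<Sum>k\<in>F. (s / 2)\<^sup>2 * ((real_of_int k)\<^sup>2 * (cmod (fourier g k))\<^sup>2))
        \<le> (\<Sum>k\<in>F. (cmod (fourier (\<lambda>t. g (t + s) - g t) k))\<^sup>2)"
    proof (rule sum_mono)
      fix k assume "k \<in> F"
      then have "\<bar>real_of_int k * s\<bar> / 2 * cmod (fourier g k) \<le> cmod (cis (of_int k * s) - 1) * cmod (fourier g k)"
        using e(2)[OF ks] by (intro mult_right_mono) auto
      then have "(\<bar>real_of_int k * s\<bar> / 2 * cmod (fourier g k))\<^sup>2 \<le> (cmod (fourier (\<lambda>t. g (t + s) - g t) k))\<^sup>2"
        unfolding fs norm_mult by (rule power_mono) simp
      then show "(s / 2)\<^sup>2 * ((real_of_int k)\<^sup>2 * (cmod (fourier g k))\<^sup>2)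
          \<le> (cmod (fourier (\<lambda>t. g (t + s) - g t) k))\<^sup>2"
        by (simp add: power_mult_distrib power_divide mult_ac)
    qed
    also have "\<dots> \<le> (L * s)\<^sup>2"
    proof (rule bessel[OF _ _ F])
      show "continuous_on {0..2*pi} (\<lambda>t. g (t + s) - g t)"
        by (intro continuous_intros continuous_on_compose2[OF g]) auto
      show "cmod (g (t + s) - g t) \<le> L * s" for t using lip[of "t + s" t] s by simp
    qed
    finally have "(s / 2)\<^sup>2 * (\<Sum>k\<in>F. (real_of_int k)\<^sup>2 * (cmod (fourier g k))\<^sup>2) \<le> (s / 2)\<^sup>2 * (4 * L\<^sup>2)"
      by (simp add: sum_distrib_left power_mult_distrib power_divide mult.commute[of "L\<^sup>2"])
    then show ?thesis using s by (simp add: mult_le_cancel_left)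
  qed
  have "(\<lambda>k. (real_of_int k)\<^sup>2 * (cmod (fourier g k))\<^sup>2) summable_on UNIV"
    by (rule esum_le_finite_sums(2)[OF sq]) auto
  then have "(\<lambda>k. 1 / (real_of_int k)\<^sup>2 + (real_of_int k)\<^sup>2 * (cmod (fourier g k))\<^sup>2) summable_on (UNIV - {0})"
    by (intro summable_on_add) (auto intro: summable_on_subset_banach[OF _ subset_UNIV] summable_on_inverse_squares_int)
  \<comment> \<open>Arithmetic-geometric mean: the product of \<open>1 / |k|\<close> and
    \<open>|k| * x\<close> is \<open>x\<close>. This breaks down at index 0, which is added back
    afterwards.\<close>
  then have "(\<lambda>k. cmod (fourier g k)) summable_on (UNIV - {0})"
  proof (rule summable_on_comparison_test)
    fix k :: int assume "k \<in> UNIV - {0}"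
    then have k: "real_of_int k \<noteq> 0" by simp
    define x where "x = cmod (fourier g k)"
    have "2 * (1 / \<bar>real_of_int k\<bar>) * (\<bar>real_of_int k\<bar> * x) \<le> (1 / \<bar>real_of_int k\<bar>)\<^sup>2 + (\<bar>real_of_int k\<bar> * x)\<^sup>2"
      by (rule sum_squares_bound)
    moreover have "2 * (1 / \<bar>real_of_int k\<bar>) * (\<bar>real_of_int k\<bar> * x) = 2 * x" using k by simp
    ultimately have "2 * x \<le> 1 / (real_of_int k)\<^sup>2 + (real_of_int k)\<^sup>2 * x\<^sup>2"
      by (simp add: power_mult_distrib power_divide)
    moreover have "0 \<le> x" by (simp add: x_def)
    ultimately show "cmod (fourier g k) \<le> 1 / (real_of_int k)\<^sup>2 + (real_of_int k)\<^sup>2 * (cmod (fourier g k))\<^sup>2"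
      unfolding x_def by linarith
  qed auto
  then have "(\<lambda>k. cmod (fourier g k)) summable_on insert 0 (UNIV - {0})"
    by (subst summable_on_insert_iff)
  then show ?thesis by (simp add: wiener_def insert_UNIV)
qed

text \<open>The term with index \<open>k\<close> has Lipschitz constant
  \<open>|k| * cmod (b k)\<close>, and the linear weight makes these constants summable.\<close>

lemma laurent_lipschitz:
  assumes b: "wnorm (\<lambda>k. 1 + \<bar>real_of_int k\<bar>) b < top"
  shows "\<exists>L\<ge>0. \<forall>s t. cmod (laurent b (cis s) - laurent b (cis t)) \<le> L * \<bar>s - t\<bar>"
proof -
  have "esum (\<lambda>k. ennreal (norm ((1 + \<bar>real_of_int k\<bar>) * cmod (b k)))) < top"
    using b by (simp add: wnorm_def abs_mult)
  then have sm: "(\<lambda>k. (1 + \<bar>real_of_int k\<bar>) * cmod (b k)) summable_on UNIV"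
    by (rule esum_imp_summable)
  then have s1: "(\<lambda>k. \<bar>real_of_int k\<bar> * cmod (b k)) summable_on UNIV"
    by (rule summable_on_comparison_test) (auto intro: mult_right_mono)
  have s0: "(\<lambda>k. cmod (b k)) summable_on UNIV"
    using sm by (rule summable_on_comparison_test) (auto simp: distrib_right)
  let ?L = "\<Sum>\<^sub>\<infinity>k. \<bar>real_of_int k\<bar> * cmod (b k)"
  have sb: "(\<lambda>k. b k * cis (of_int k * t)) summable_on UNIV" for t
    by (rule abs_summable_summable) (simp add: norm_mult s0)
  have "cmod (laurent b (cis s) - laurent b (cis t)) \<le> ?L * \<bar>s - t\<bar>" for s t
  proof -
    let ?d = "\<lambda>k. b k * cis (of_int k * s) - b k * cis (of_int k * t)"
    have le: "cmod (?d k) \<le> \<bar>real_of_int k\<bar> * cmod (b k) * \<bar>s - t\<bar>" for k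
    proof -
      have "cmod (?d k) = cmod (b k) * cmod (cis (of_int k * s) - cis (of_int k * t))"
        by (simp add: norm_mult[symmetric] right_diff_distrib)
      also have "\<dots> \<le> cmod (b k) * \<bar>of_int k * s - of_int k * t\<bar>"
        by (intro mult_left_mono norm_cis_diff_le) auto
      also have "\<bar>of_int k * s - of_int k * t\<bar> = \<bar>real_of_int k\<bar> * \<bar>s - t\<bar>"
        by (simp add: right_diff_distrib[symmetric] abs_mult)
      finally show ?thesis by (simp add: mult_ac)
    qed
    have s2: "(\<lambda>k. \<bar>real_of_int k\<bar> * cmod (b k) * \<bar>s - t\<bar>) summable_on UNIV"
      by (intro summable_on_cmult_left s1)
    have "(?d has_sum (laurent b (cis s) - laurent b (cis t))) UNIV"
      unfolding laurent_cis
      using has_sum_add[OF has_sum_infsum[OF sb[of s]] has_sum_uminusI[OF has_sum_infsum[OF sb[of t]]]]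
      by simp
    from norm_infsum_le[OF this has_sum_infsum[OF s2] le]
    show ?thesis by (simp add: infsum_cmult_left')
  qed
  moreover have "?L \<ge> 0" by (rule infsum_nonneg) auto
  ultimately show ?thesis by blast
qed

text \<open>An elementary case of Wiener's lemma. Only the unweighted norm of \<open>c\<close> comes
  out finite; the weighted ones are recovered by \<open>weighted_inverse\<close>.\<close>

lemma wiener_inverse:
  assumes b: "wnorm (\<lambda>k. 1 + \<bar>real_of_int k\<bar>) b < top"
    and nz: "\<And>t. laurent b (cis t) \<noteq> 0"
  shows "\<exists>c\<in>wiener. conv c b = cunit"
proof -
  let ?\<phi> = "\<lambda>t. laurent b (cis t)"
  have bw: "b \<in> wiener"
    using order_le_less_trans[OF wnorm_mono b, of "\<lambda>_. 1"] by (simp add: wiener_iff)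
  obtain L where L: "L \<ge> 0" "\<And>s t. cmod (?\<phi> s - ?\<phi> t) \<le> L * \<bar>s - t\<bar>"
    using laurent_lipschitz[OF b] by blast
  have cont: "continuous_on UNIV ?\<phi>"
    by (rule lipschitz_on_continuous_on[of L]) (rule lipschitz_onI, use L in \<open>auto simp: dist_norm\<close>)
  have per: "?\<phi> (t + 2*pi) = ?\<phi> t" for t
    by (simp add: cis_mult[symmetric])
  have "\<exists>d>0. \<forall>t. d \<le> cmod (?\<phi> t)"
  proof -
    have "continuous_on {0..2*pi} (\<lambda>t. cmod (?\<phi> t))"
      by (intro continuous_intros continuous_on_subset[OF cont]) auto
    from continuous_attains_inf[OF compact_Icc _ this]
    obtain t0 where t0: "t0 \<in> {0..2*pi}" "\<And>t. t \<in> {0..2*pi} \<Longrightarrow> cmod (?\<phi> t0) \<le> cmod (?\<phi> t)"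
      by auto
    have "cmod (?\<phi> t0) \<le> cmod (?\<phi> t)" for t
    proof -
      \<comment> \<open>The minimum was taken over one period; \<open>Arg2pi\<close> brings every
        \<open>t\<close> into it.\<close>
      have "cis t = cis (Arg2pi (cis t))"
        using Arg2pi_eq[of "cis t"] by (simp add: cis_conv_exp)
      moreover have "Arg2pi (cis t) \<in> {0..2*pi}" using Arg2pi_ge_0 Arg2pi_lt_2pi[of "cis t"] by auto
      ultimately show ?thesis using t0(2)[of "Arg2pi (cis t)"] by simp
    qed
    moreover have "cmod (?\<phi> t0) > 0" using nz by simp
    ultimately show ?thesis by blast
  qed
  then obtain d where d: "d > 0" "\<And>t. d \<le> cmod (?\<phi> t)" by blast
  let ?h = "\<lambda>t. 1 / ?\<phi> t"
  have ch: "continuous_on UNIV ?h" by (intro continuous_intros cont) (use nz in auto)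
  have "fourier ?h \<in> wiener"
  proof (rule fourier_lipschitz_wiener[OF ch])
    show "?h (t + 2*pi) = ?h t" for t by (simp only: per)
    fix s t
    have "cmod (?h s - ?h t) = cmod (?\<phi> t - ?\<phi> s) / (cmod (?\<phi> s) * cmod (?\<phi> t))"
      using nz by (simp add: diff_frac_eq norm_divide norm_mult)
    also have "\<dots> \<le> (L * \<bar>t - s\<bar>) / (d * d)"
      using d L by (intro frac_le mult_mono) (auto simp: less_imp_le)
    finally show "cmod (?h s - ?h t) \<le> L / (d * d) * \<bar>s - t\<bar>" by (simp add: abs_minus_commute)
  qed
  moreover have "conv b (fourier ?h) k = cunit k" for k
    using fourier_conv[OF bw continuous_on_subset[OF ch subset_UNIV], of k] nz
    by (simp add: fourier_one[symmetric])
  ultimately show ?thesis using conv_commute by (metis ext)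
qed

subsection \<open>Completeness and matrix entries of operators\<close>

lemma norm_ell2_nth_le: "cmod (ell2_nth x i) \<le> norm x"
proof -
  have "(\<Sum>k\<in>{i}. (cmod (ell2_nth x k))\<^sup>2) \<le> (\<Sum>\<^sub>\<infinity>k. (cmod (ell2_nth x k))\<^sup>2)"
    by (rule finite_sum_le_infsum[OF ell2_summable]) auto
  then have "(cmod (ell2_nth x i))\<^sup>2 \<le> (norm x)\<^sup>2" by (simp add: norm_ell2_sq)
  then show ?thesis by (rule power2_le_imp_le) simp
qed

lemma norm_ell2_le:
  assumes "\<And>F. finite F \<Longrightarrow> (\<Sum>i\<in>F. (cmod (ell2_nth x i))\<^sup>2) \<le> e\<^sup>2" "0 \<le> e"
  shows "norm x \<le> e"
proof (rule power2_le_imp_le)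
  show "(norm x)\<^sup>2 \<le> e\<^sup>2"
    unfolding norm_ell2_sq by (rule infsum_le_finite_sums[OF ell2_summable]) (use assms in auto)
qed (use assms in auto)

lemma sum_ell2_nth_le: "finite F \<Longrightarrow> (\<Sum>i\<in>F. (cmod (ell2_nth x i))\<^sup>2) \<le> (norm x)\<^sup>2"
  unfolding norm_ell2_sq by (rule finite_sum_le_infsum[OF ell2_summable]) auto

text \<open>Completeness passes to the space of bounded operators, where integrability is obtained
  from uniform limits.\<close>

instance ell2 :: banach
proof
  fix X :: "nat \<Rightarrow> ell2" assume X: "Cauchy X"
  have "Cauchy (\<lambda>n. ell2_nth (X n) i)" for i
  proof (rule CauchyI)
    fix e :: real assume "0 < e"
    then obtain M where M: "\<And>m n. m \<ge> M \<Longrightarrow> n \<ge> M \<Longrightarrow> norm (X m - X n) < e"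
      using CauchyD[OF X] by blast
    have "cmod (ell2_nth (X m) i - ell2_nth (X n) i) < e" if "m \<ge> M" "n \<ge> M" for m n
      using norm_ell2_nth_le[of "X m - X n" i] M[OF that] by (simp add: minus_ell2.rep_eq)
    then show "\<exists>M. \<forall>m\<ge>M. \<forall>n\<ge>M. cmod (ell2_nth (X m) i - ell2_nth (X n) i) < e" by blast
  qed
  then have "\<forall>i. \<exists>l. (\<lambda>n. ell2_nth (X n) i) \<longlonglongrightarrow> l" by (simp add: Cauchy_convergent_iff convergent_def)
  then obtain y where y: "\<And>i. (\<lambda>n. ell2_nth (X n) i) \<longlonglongrightarrow> y i" by metis
  \<comment> \<open>The bound is independent of the finite set \<open>F\<close>; this upgrades
    convergence of coordinates to convergence in norm.\<close>
  have close: "(\<Sum>i\<in>F. (cmod (ell2_nth (X m) i - y i))\<^sup>2) \<le> e\<^sup>2"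
    if M: "\<And>m n. m \<ge> M \<Longrightarrow> n \<ge> M \<Longrightarrow> norm (X m - X n) < e" and m: "m \<ge> M" and F: "finite F"
    for M m e and F :: "nat set"
  proof (rule LIMSEQ_le_const2)
    show "(\<lambda>n. \<Sum>i\<in>F. (cmod (ell2_nth (X m) i - ell2_nth (X n) i))\<^sup>2)
        \<longlonglongrightarrow> (\<Sum>i\<in>F. (cmod (ell2_nth (X m) i - y i))\<^sup>2)"
      by (intro tendsto_intros y)
    have "(\<Sum>i\<in>F. (cmod (ell2_nth (X m) i - ell2_nth (X n) i))\<^sup>2) \<le> e\<^sup>2" if "n \<ge> M" for n
    proof -
      have "(\<Sum>i\<in>F. (cmod (ell2_nth (X m - X n) i))\<^sup>2) \<le> (norm (X m - X n))\<^sup>2"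
        by (rule sum_ell2_nth_le[OF F])
      also have "\<dots> \<le> e\<^sup>2" using M[OF m that] by (intro power_mono) auto
      finally show ?thesis by (simp add: minus_ell2.rep_eq)
    qed
    then show "\<exists>N. \<forall>n\<ge>N. (\<Sum>i\<in>F. (cmod (ell2_nth (X m) i - ell2_nth (X n) i))\<^sup>2) \<le> e\<^sup>2" by blast
  qed
  obtain M1 where M1: "\<And>m n. m \<ge> M1 \<Longrightarrow> n \<ge> M1 \<Longrightarrow> norm (X m - X n) < 1"
    using CauchyD[OF X, of 1] by auto
  have "(\<lambda>i. (cmod (ell2_nth (X M1) i - y i))\<^sup>2) summable_on UNIV"
    by (rule nonneg_bdd_above_summable_on)
      (auto intro!: bdd_aboveI2[where M = "1\<^sup>2"] close[OF M1])
  \<comment> \<open>Square-summability of the limit, from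
    \<open>y = X M1 + (-1) * (X M1 - y)\<close>.\<close>
  from ell2_add_aux[OF ell2_summable[of "X M1"] ell2_scale_aux[OF this, of "-1"]]
  have ys: "(\<lambda>i. (cmod (y i))\<^sup>2) summable_on UNIV" by simp
  define Y where "Y = Abs_ell2 y"
  have Y: "ell2_nth Y = y" using ys by (simp add: Y_def Abs_ell2_inverse)
  have "X \<longlonglongrightarrow> Y"
  proof (rule LIMSEQ_I)
    fix e :: real assume e: "0 < e"
    then obtain M where M: "\<And>m n. m \<ge> M \<Longrightarrow> n \<ge> M \<Longrightarrow> norm (X m - X n) < e / 2"
      using CauchyD[OF X, of "e / 2"] by auto
    have "norm (X m - Y) \<le> e / 2" if "m \<ge> M" for m
      by (rule norm_ell2_le) (use close[OF M that] e in \<open>auto simp: minus_ell2.rep_eq Y\<close>)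
    then have "norm (X m - Y) < e" if "m \<ge> M" for m using that e by fastforce
    then show "\<exists>M. \<forall>m\<ge>M. norm (X m - Y) < e" by blast
  qed
  then show "convergent X" by (auto simp: convergent_def)
qed

lift_definition unitv :: "nat \<Rightarrow> ell2" is "\<lambda>j i. if i = j then 1 else 0"
proof -
  fix j :: nat
  have "(\<lambda>i. (cmod (if i = j then 1 else 0))\<^sup>2) summable_on UNIV \<longleftrightarrow>
      (\<lambda>i. (cmod (if i = j then 1 else 0))\<^sup>2) summable_on {j}"
    by (rule summable_on_cong_neutral) auto
  then show "(\<lambda>i. (cmod (if i = j then 1 else 0))\<^sup>2) summable_on UNIV" by simp
qed

lemma ell2_nth_add: "ell2_nth (x + y) i = ell2_nth x i + ell2_nth y i"
  and ell2_nth_diff: "ell2_nth (x - y) i = ell2_nth x i - ell2_nth y i"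
  and ell2_nth_zero: "ell2_nth 0 i = 0"
  and ell2_nth_cscale: "ell2_nth (cscale c x) i = c * ell2_nth x i"
  and ell2_nth_scaleR: "ell2_nth (r *\<^sub>R x) i = of_real r * ell2_nth x i"
  by (simp_all add: plus_ell2.rep_eq minus_ell2.rep_eq zero_ell2.rep_eq cscale.rep_eq scaleR_ell2_def)

lemma ell2_nth_sum: "ell2_nth (sum f F) i = (\<Sum>k\<in>F. ell2_nth (f k) i)"
  by (induction F rule: infinite_finite_induct) (simp_all add: ell2_nth_add ell2_nth_zero)

lemma ell2_eqI: "(\<And>i. ell2_nth x i = ell2_nth y i) \<Longrightarrow> x = y"
  by (simp add: ell2_nth_inject[symmetric] fun_eq_iff)

lemma bounded_linear_ell2_nth: "bounded_linear (\<lambda>x. ell2_nth x i)"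
  by (rule bounded_linear_intro[where K = 1])
    (simp_all add: ell2_nth_add ell2_nth_scaleR scaleR_conv_of_real norm_ell2_nth_le)

text \<open>By Pythagoras the squared norm of the remainder is the squared norm of \<open>x\<close>
  minus the partial sum over \<open>F\<close>, which tends to 0.\<close>

lemma ell2_expansion: "((\<lambda>j. cscale (ell2_nth x j) (unitv j)) has_sum x) UNIV"
proof -
  let ?q = "\<lambda>i. (cmod (ell2_nth x i))\<^sup>2"
  let ?s = "\<lambda>F. \<Sum>j\<in>F. cscale (ell2_nth x j) (unitv j)"
  have nsq: "(norm (?s F - x))\<^sup>2 = (norm x)\<^sup>2 - sum ?q F" if F: "finite F" for F
  proof -
    have nth: "ell2_nth (?s F - x) i = (if i \<in> F then 0 else - ell2_nth x i)" for i
      using F by (simp add: ell2_nth_diff ell2_nth_sum ell2_nth_cscale unitv.rep_eq if_distrib sum.delta cong: if_cong)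
    have "(?q has_sum sum ?q F) F" using F by (rule has_sum_finite)
    then have 1: "((\<lambda>i. if i \<in> F then ?q i else 0) has_sum sum ?q F) UNIV"
      by (subst has_sum_cong_neutral[where S = F and T = UNIV, symmetric]) auto
    have "((\<lambda>i. (cmod (ell2_nth (?s F - x) i))\<^sup>2) has_sum ((norm x)\<^sup>2 - sum ?q F)) UNIV"
    proof -
      have "((\<lambda>i. ?q i + - (if i \<in> F then ?q i else 0)) has_sum ((norm x)\<^sup>2 + - sum ?q F)) UNIV"
        unfolding norm_ell2_sq by (intro has_sum_add has_sum_infsum ell2_summable has_sum_uminusI 1)
      moreover have "(\<lambda>i. ?q i + - (if i \<in> F then ?q i else 0)) = (\<lambda>i. (cmod (ell2_nth (?s F - x) i))\<^sup>2)"
        by (auto simp: nth)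
      ultimately show ?thesis by simp
    qed
    then show ?thesis unfolding norm_ell2_sq[of "?s F - x"] by (rule infsumI)
  qed
  have "((\<lambda>F. sum ?q F) \<longlongrightarrow> (norm x)\<^sup>2) (finite_subsets_at_top UNIV)"
    using has_sum_infsum[OF ell2_summable[of x]] by (simp add: has_sum_def norm_ell2_sq)
  then have "((\<lambda>F. sqrt ((norm x)\<^sup>2 - sum ?q F)) \<longlongrightarrow> sqrt ((norm x)\<^sup>2 - (norm x)\<^sup>2)) (finite_subsets_at_top UNIV)"
    by (intro tendsto_intros)
  moreover have "eventually (\<lambda>F. sqrt ((norm x)\<^sup>2 - sum ?q F) = norm (?s F - x)) (finite_subsets_at_top UNIV)"
    by (rule eventually_finite_subsets_at_top_weakI) (simp flip: nsq)
  ultimately have "((\<lambda>F. norm (?s F - x)) \<longlongrightarrow> 0) (finite_subsets_at_top UNIV)"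
    by (auto intro: Lim_transform_eventually)
  then show ?thesis
    unfolding has_sum_def by (rule Lim_null[THEN iffD2, OF tendsto_norm_zero_cancel])
qed

definition entry :: "ell2 \<Rightarrow>\<^sub>L ell2 \<Rightarrow> nat \<Rightarrow> nat \<Rightarrow> complex" where
  "entry P i j = ell2_nth (P (unitv j)) i"

text \<open>Bounded operators are real-linear by type; only under this condition may the complex
  coefficients of \<open>ell2_expansion\<close> be pulled out.\<close>

definition clinear_op :: "ell2 \<Rightarrow>\<^sub>L ell2 \<Rightarrow> bool" where
  "clinear_op P \<longleftrightarrow> (\<forall>c x. P (cscale c x) = cscale c (P x))"

lemma norm_unitv: "norm (unitv j) = 1"
proof -
  have "(norm (unitv j))\<^sup>2 = (\<Sum>\<^sub>\<infinity>i\<in>{j}. (cmod (ell2_nth (unitv j) i))\<^sup>2)"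
    unfolding norm_ell2_sq by (rule infsum_cong_neutral) (auto simp: unitv.rep_eq)
  then have "(norm (unitv j))\<^sup>2 = 1\<^sup>2" by (simp add: unitv.rep_eq)
  then show ?thesis by (rule power2_eq_imp_eq) auto
qed

lemma norm_entry_le: "cmod (entry P i j) \<le> norm P"
  using norm_ell2_nth_le[of "P (unitv j)" i] norm_blinfun[of P "unitv j"]
  by (simp add: entry_def norm_unitv)

lemma bounded_linear_entry: "bounded_linear (\<lambda>P. entry P i j)"
  unfolding entry_def
  by (rule bounded_linear_compose[OF bounded_linear_ell2_nth])
    (rule blinfun.bounded_linear_left)

lemma entry_diff: "entry (P - Q) i j = entry P i j - entry Q i j"
  by (simp add: entry_def blinfun.diff_left ell2_nth_diff)

lemma clinear_has_sum:
  assumes "clinear_op P"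
  shows "((\<lambda>j. entry P i j * ell2_nth x j) has_sum ell2_nth (P x) i) UNIV"
proof -
  have "bounded_linear (\<lambda>v. ell2_nth (P v) i)"
    by (rule bounded_linear_compose[OF bounded_linear_ell2_nth]) (rule blinfun.bounded_linear_right)
  from has_sum_bounded_linear[OF this ell2_expansion[of x]] show ?thesis
    using assms by (simp add: clinear_op_def o_def ell2_nth_cscale entry_def mult.commute)
qed

lemma clinear_op_eqI:
  assumes "clinear_op P" "clinear_op Q" "\<And>i j. entry P i j = entry Q i j"
  shows "P = Q"
proof (rule blinfun_eqI, rule ell2_eqI)
  fix x i
  show "ell2_nth (P x) i = ell2_nth (Q x) i"
    using clinear_has_sum[OF assms(1), of i x] clinear_has_sum[OF assms(2), of i x] assms(3)
    by (auto intro: has_sum_unique)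
qed

lemma entry_compose:
  assumes "clinear_op P"
  shows "((\<lambda>k. entry P i k * entry Q k j) has_sum entry (P o\<^sub>L Q) i j) UNIV"
  using clinear_has_sum[OF assms, of i "Q (unitv j)"] by (simp add: entry_def)

lemma clinear_cmul: "clinear_op (cmul z)"
  by (auto simp: clinear_op_def ell2_nth_cscale intro: ell2_eqI)

lemma clinear_id: "clinear_op id_blinfun"
  by (simp add: clinear_op_def)

lemma clinear_diff: "clinear_op P \<Longrightarrow> clinear_op Q \<Longrightarrow> clinear_op (P - Q)"
  by (auto simp: clinear_op_def blinfun.diff_left ell2_nth_diff ell2_nth_cscale right_diff_distrib intro: ell2_eqI)

lemma clinear_compose: "clinear_op P \<Longrightarrow> clinear_op Q \<Longrightarrow> clinear_op (P o\<^sub>L Q)"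
  by (simp add: clinear_op_def)

lemma clinear_inverse:
  assumes S: "clinear_op S" and inv: "is_op_inverse S R"
  shows "clinear_op R"
  unfolding clinear_op_def
proof (intro allI)
  fix c x
  have RS: "R (S y) = y" and SR: "S (R y) = y" for y
    using inv unfolding is_op_inverse_def
    by (metis blinfun_apply_blinfun_compose blinfun_apply_id_blinfun id_apply)+
  have "S (cscale c (R x)) = cscale c x" using S SR by (simp add: clinear_op_def)
  then show "R (cscale c x) = cscale c (R x)" using RS by metis
qed

lemma entry_cmul: "entry (cmul z) i j = z * (if i = j then 1 else 0)"
  and entry_id: "entry id_blinfun i j = (if i = j then 1 else 0)"
  by (auto simp: entry_def ell2_nth_cscale unitv.rep_eq)

lemma entry_cmul_compose: "entry (cmul z o\<^sub>L P) i j = z * entry P i j"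
  by (simp add: entry_def ell2_nth_cscale)

subsection \<open>Matrices with bounded absolute row and column sums\<close>

text \<open>The hypotheses of the Schur test; they guarantee that \<open>matrix_op M\<close> is a
  bounded operator with entries \<open>M\<close>.\<close>

definition schur_bound :: "real \<Rightarrow> inf_matrix \<Rightarrow> bool" where
  "schur_bound C M \<longleftrightarrow> 0 \<le> C \<and>
     (\<forall>i. esum (\<lambda>j. ennreal (cmod (M i j))) \<le> ennreal C) \<and>
     (\<forall>j. esum (\<lambda>i. ennreal (cmod (M i j))) \<le> ennreal C)"

definition fnorm :: "inf_matrix \<Rightarrow> ennreal" where
  "fnorm M = esum (\<lambda>i. esum (\<lambda>j. ennreal (cmod (M i j))))"

lemma fmatrices_iff: "M \<in> fmatrices \<longleftrightarrow> fnorm M < top"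
proof -
  have "fnorm M = esum (\<lambda>(i, j). ennreal (cmod (M i j)))"
    by (simp add: fnorm_def esum_pair)
  also have "\<dots> = esum (\<lambda>p. ennreal (norm (case p of (i, j) \<Rightarrow> cmod (M i j))))"
    by (rule esum_cong) auto
  finally show ?thesis
    unfolding fmatrices_def using esum_finite_iff[of "\<lambda>(i, j). cmod (M i j)"]
    by (simp add: case_prod_unfold)
qed

lemma matrix_op_has_sum:
  assumes "schur_bound C M"
  shows "((\<lambda>j. M i j * ell2_nth x j) has_sum ell2_nth (matrix_op M x) i) UNIV"
  by (rule matrix_op_bounded[where C = C])
    (use assms in \<open>auto simp: schur_bound_def intro!: finite_sum_le_esum\<close>)

lemma entry_matrix_op:
  assumes "schur_bound C M"
  shows "entry (matrix_op M) i j = M i j"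
proof -
  have "((\<lambda>k. M i k * ell2_nth (unitv j) k) has_sum (\<Sum>k\<in>{j}. M i k * ell2_nth (unitv j) k)) UNIV"
    by (rule has_sum_finite_neutralI[where B = "{j}"]) (auto simp: unitv.rep_eq)
  from has_sum_unique[OF matrix_op_has_sum[OF assms] this] show ?thesis
    by (simp add: entry_def unitv.rep_eq)
qed

lemma clinear_matrix_op:
  assumes "schur_bound C M"
  shows "clinear_op (matrix_op M)"
  unfolding clinear_op_def
proof (intro allI, rule ell2_eqI)
  fix c x i
  have "((\<lambda>j. M i j * ell2_nth (cscale c x) j) has_sum c * ell2_nth (matrix_op M x) i) UNIV"
    using has_sum_cmult_right[OF matrix_op_has_sum[OF assms, of i x], of c]
    by (simp add: ell2_nth_cscale mult_ac)
  from has_sum_unique[OF matrix_op_has_sum[OF assms] this]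
  show "ell2_nth (matrix_op M (cscale c x)) i = ell2_nth (cscale c (matrix_op M x)) i"
    by (simp add: ell2_nth_cscale)
qed

lemma esum_toeplitz_row: "esum (\<lambda>j. ennreal (cmod (toeplitz a i j))) \<le> wnorm1 a"
  and esum_toeplitz_col: "esum (\<lambda>i. ennreal (cmod (toeplitz a i j))) \<le> wnorm1 a"
proof -
  have "inj (\<lambda>j. int j - int i)" by (auto simp: inj_on_def)
  from esum_inj_le[OF this, of "\<lambda>k. ennreal (cmod (a k))"]
  show "esum (\<lambda>j. ennreal (cmod (toeplitz a i j))) \<le> wnorm1 a" by (simp add: toeplitz_def wnorm_def)
  have "inj (\<lambda>i. int j - int i)" by (auto simp: inj_on_def)
  from esum_inj_le[OF this, of "\<lambda>k. ennreal (cmod (a k))"]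
  show "esum (\<lambda>i. ennreal (cmod (toeplitz a i j))) \<le> wnorm1 a" by (simp add: toeplitz_def wnorm_def)
qed

lemma esum_row_le_fnorm: "esum (\<lambda>j. ennreal (cmod (M i j))) \<le> fnorm M"
  and esum_col_le_fnorm: "esum (\<lambda>i. ennreal (cmod (M i j))) \<le> fnorm M"
proof -
  show "esum (\<lambda>j. ennreal (cmod (M i j))) \<le> fnorm M"
    unfolding fnorm_def by (rule esum_ge)
  show "esum (\<lambda>i. ennreal (cmod (M i j))) \<le> fnorm M"
    unfolding fnorm_def by (intro esum_mono esum_ge)
qed

lemma schur_bound_cqt:
  assumes "wnorm1 a \<le> ennreal \<alpha>" "fnorm E \<le> ennreal \<epsilon>" "0 \<le> \<alpha>" "0 \<le> \<epsilon>"
  shows "schur_bound (\<alpha> + \<epsilon>) (\<lambda>i j. toeplitz a i j + E i j)"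
proof -
  have le: "ennreal (cmod (x + y)) \<le> ennreal (cmod x) + ennreal (cmod y)" for x y
    by (simp add: ennreal_plus[symmetric] ennreal_leI norm_triangle_ineq del: ennreal_plus)
  have e: "ennreal \<alpha> + ennreal \<epsilon> = ennreal (\<alpha> + \<epsilon>)" using assms by simp
  have "esum (\<lambda>j. ennreal (cmod (toeplitz a i j + E i j))) \<le> ennreal (\<alpha> + \<epsilon>)" for i
  proof -
    have "esum (\<lambda>j. ennreal (cmod (toeplitz a i j + E i j)))
        \<le> esum (\<lambda>j. ennreal (cmod (toeplitz a i j))) + esum (\<lambda>j. ennreal (cmod (E i j)))"
      unfolding esum_add[symmetric] by (intro esum_mono le)
    also have "\<dots> \<le> ennreal \<alpha> + ennreal \<epsilon>"
      by (intro add_mono order_trans[OF esum_toeplitz_row assms(1)] order_trans[OF esum_row_le_fnorm assms(2)])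
    finally show ?thesis by (simp add: e)
  qed
  moreover have "esum (\<lambda>i. ennreal (cmod (toeplitz a i j + E i j))) \<le> ennreal (\<alpha> + \<epsilon>)" for j
  proof -
    have "esum (\<lambda>i. ennreal (cmod (toeplitz a i j + E i j)))
        \<le> esum (\<lambda>i. ennreal (cmod (toeplitz a i j))) + esum (\<lambda>i. ennreal (cmod (E i j)))"
      unfolding esum_add[symmetric] by (intro esum_mono le)
    also have "\<dots> \<le> ennreal \<alpha> + ennreal \<epsilon>"
      by (intro add_mono order_trans[OF esum_toeplitz_col assms(1)] order_trans[OF esum_col_le_fnorm assms(2)])
    finally show ?thesis by (simp add: e)
  qed
  ultimately show ?thesis using assms by (simp add: schur_bound_def)
qed

lemma schur_bound_cqt_exists:
  assumes "a \<in> wiener" "E \<in> fmatrices"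
  obtains C where "schur_bound C (\<lambda>i j. toeplitz a i j + E i j)"
proof -
  have "wnorm1 a \<le> ennreal (enn2real (wnorm1 a))" "fnorm E \<le> ennreal (enn2real (fnorm E))"
    using assms by (simp_all add: wiener_iff fmatrices_iff)
  from schur_bound_cqt[OF this] show thesis using that by simp
qed

lemma schur_bound_toeplitz:
  assumes "a \<in> wiener"
  obtains C where "schur_bound C (toeplitz a)"
proof -
  have "(\<lambda>i j. 0) \<in> fmatrices" by (simp add: fmatrices_iff fnorm_def esum_def)
  from schur_bound_cqt_exists[OF assms this] show thesis using that by auto
qed

text \<open>Puts \<open>z I - A\<close> into the quasi-Toeplitz form to which
  \<open>laurent_nonzero\<close> and \<open>inverse_correction\<close> apply.\<close>

lemma cmul_minus_matrix_op:
  assumes a: "a \<in> wiener" and E: "E \<in> fmatrices"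
  shows "cmul z - matrix_op (\<lambda>i j. toeplitz a i j + E i j)
    = matrix_op (\<lambda>i j. toeplitz (shifted z a) i j + - E i j)"
proof -
  have E': "(\<lambda>i j. - E i j) \<in> fmatrices" using E by (simp add: fmatrices_iff fnorm_def)
  obtain C D where C: "schur_bound C (\<lambda>i j. toeplitz a i j + E i j)"
    and D: "schur_bound D (\<lambda>i j. toeplitz (shifted z a) i j + - E i j)"
    using schur_bound_cqt_exists[OF a E] schur_bound_cqt_exists[OF shifted_wiener[OF a] E'] by metis
  show ?thesis
  proof (rule clinear_op_eqI)
    show "clinear_op (cmul z - matrix_op (\<lambda>i j. toeplitz a i j + E i j))"
      by (intro clinear_diff clinear_cmul clinear_matrix_op[OF C])
    show "clinear_op (matrix_op (\<lambda>i j. toeplitz (shifted z a) i j + - E i j))"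
      by (rule clinear_matrix_op[OF D])
    show "entry (cmul z - matrix_op (\<lambda>i j. toeplitz a i j + E i j)) i j =
        entry (matrix_op (\<lambda>i j. toeplitz (shifted z a) i j + - E i j)) i j" for i j
      unfolding entry_diff entry_cmul entry_matrix_op[OF C] entry_matrix_op[OF D]
      by (simp add: toeplitz_def shifted_def cunit_def)
  qed
qed

subsection \<open>Invertibility forces a nonvanishing symbol\<close>

lemma norm_ell2_le_esum:
  assumes "esum (\<lambda>i. ennreal (cmod (ell2_nth x i))) \<le> ennreal K" "0 \<le> K"
  shows "norm x \<le> K"
proof (rule norm_ell2_le)
  fix F :: "nat set" assume F: "finite F"
  have "sqrt (\<Sum>i\<in>F. (cmod (ell2_nth x i))\<^sup>2) \<le> (\<Sum>i\<in>F. cmod (ell2_nth x i))"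
    using L2_set_le_sum[of F "\<lambda>i. cmod (ell2_nth x i)"] by (simp add: L2_set_def)
  also have "\<dots> \<le> K" by (rule finite_sum_le_esum[OF assms]) (auto simp: F)
  finally show "(\<Sum>i\<in>F. (cmod (ell2_nth x i))\<^sup>2) \<le> K\<^sup>2"
    by (rule sqrt_le_D)
qed (rule assms)

lemma linear_weight_wiener: "wnorm (\<lambda>k. 1 + \<bar>real_of_int k\<bar>) b < top \<Longrightarrow> b \<in> wiener"
  using order_le_less_trans[OF wnorm_mono[of "\<lambda>_. 1" "\<lambda>k. 1 + \<bar>real_of_int k\<bar>" b]]
  by (simp add: wiener_iff)

lemma esum_card: "finite A \<Longrightarrow> esum (indicator A) = of_nat (card A)"
  unfolding esum_def by (subst nn_integral_indicator) (auto simp: emeasure_count_space)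

text \<open>\<open>defect m j\<close> collects the rows \<open>i\<close> for which \<open>b\<^sub>j\<close> contributes to row \<open>i\<close> of
  \<open>T(b) x\<close>, \<open>x = (1, \<zeta>, \<dots>, \<zeta>\<^bsup>m-1\<^esup>, 0, \<dots>)\<close>, after \<open>b(\<zeta>) = 0\<close> has been used to replace the sum over
  \<open>-i \<le> j < m - i\<close> by the complementary one if \<open>i < m\<close>. There are at most \<open>2 \<bar>j\<bar>\<close> such rows,
  independently of \<open>m\<close>.\<close>

definition defect :: "nat \<Rightarrow> int \<Rightarrow> nat set" where
  "defect m j = {i. i < m \<and> (int i < - j \<or> int m - int i \<le> j) \<or> m \<le> i \<and> int i < int m - j}"

lemma card_defect: "esum (indicator (defect m j)) \<le> ennreal (2 * \<bar>real_of_int j\<bar>)"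
proof -
  \<comment> \<open>For \<open>j \<ge> 0\<close> only the last \<open>j\<close> rows below
    \<open>m\<close> are affected; for \<open>j < 0\<close> both the first \<open>-j\<close> rows
    and the \<open>-j\<close> rows from \<open>m\<close> on, whence the factor 2.\<close>
  define A where "A = (if 0 \<le> j then {m - nat j..<m} else {0..<nat (- j)} \<union> {m..<m + nat (- j)})"
  have "defect m j \<subseteq> A" by (auto simp: defect_def A_def)
  then have "esum (indicator (defect m j)) \<le> esum (indicator A)"
    by (intro esum_mono) (auto simp: indicator_def)
  also have "\<dots> = of_nat (card A)" by (rule esum_card) (simp add: A_def)
  also have "\<dots> \<le> ennreal (2 * \<bar>real_of_int j\<bar>)"
  proof -
    have "card A \<le> nat (2 * \<bar>j\<bar>)"
    proof (cases "0 \<le> j")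
      case False
      then show ?thesis
        using card_Un_le[of "{0..<nat (- j)}" "{m..<m + nat (- j)}"] by (simp add: A_def)
    qed (simp add: A_def)
    then have "real (card A) \<le> 2 * \<bar>real_of_int j\<bar>" by linarith
    then show ?thesis by (simp add: ennreal_of_nat_eq_real_of_nat ennreal_leI)
  qed
  finally show ?thesis .
qed

text \<open>The linear weight pays for the at most \<open>2 * |j|\<close> rows that
  \<open>b j\<close> reaches. This bounds even the sum of the absolute values of the image, hence
  its norm, by the same \<open>K\<close> for all \<open>m\<close>.\<close>

lemma laurent_nonzero:
  assumes b: "wnorm (\<lambda>k. 1 + \<bar>real_of_int k\<bar>) b < top" and E: "E \<in> fmatrices"
    and inv: "is_op_inverse (matrix_op (\<lambda>i j. toeplitz b i j + E i j)) R"
  shows "laurent b (cis t) \<noteq> 0"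
proof
  assume zero: "laurent b (cis t) = 0"
  note bw = linear_weight_wiener[OF b]
  define M where "M = (\<lambda>i j. toeplitz b i j + E i j)"
  define g where "g k = b k * cis (of_int k * t)" for k
  obtain C where C: "schur_bound C M" using schur_bound_cqt_exists[OF bw E] unfolding M_def by blast
  have "g summable_on UNIV"
    by (rule abs_summable_summable) (use bw in \<open>simp add: g_def norm_mult wiener_def\<close>)
  then have g0: "(g has_sum 0) UNIV"
    using zero has_sum_infsum unfolding laurent_cis g_def[symmetric] by metis
  define x where "x m = (\<Sum>k<m. cscale (cis (real k * t)) (unitv k))" for m :: nat
  have x: "ell2_nth (x m) i = (if i < m then cis (real i * t) else 0)" for m i
    by (simp add: x_def ell2_nth_sum ell2_nth_cscale unitv.rep_eq if_distrib sum.delta cong: if_cong)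
  have normx: "norm (x m) = sqrt m" for m
  proof -
    have "(norm (x m))\<^sup>2 = (\<Sum>\<^sub>\<infinity>i\<in>{..<m}. 1)"
      unfolding norm_ell2_sq by (rule infsum_cong_neutral) (auto simp: x)
    then have "(norm (x m))\<^sup>2 = real m" by simp
    then show ?thesis by (metis norm_ge_zero real_sqrt_unique)
  qed
  define B where "B = wnorm (\<lambda>k. 1 + \<bar>real_of_int k\<bar>) b"
  define K where "K = enn2real (2 * B + fnorm E)"
  have "2 * B + fnorm E < top" using b E by (simp add: B_def fmatrices_iff ennreal_mult_less_top)
  then have K: "2 * B + fnorm E = ennreal K" "0 \<le> K" by (auto simp: K_def less_top)
  have Sx: "norm (matrix_op M (x m)) \<le> K" for m
  proof (rule norm_ell2_le_esum)
    define T where "T i = (\<Sum>k<m. b (int k - int i) * cis (real k * t))" for i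
    define U where "U i = (\<Sum>k<m. E i k * cis (real k * t))" for i
    have y: "ell2_nth (matrix_op M (x m)) i = T i + U i" for i
    proof -
      have "((\<lambda>j. M i j * ell2_nth (x m) j) has_sum (T i + U i)) UNIV"
        by (rule has_sum_finite_neutralI[where B = "{..<m}"])
          (auto simp: x M_def T_def U_def toeplitz_def sum.distrib[symmetric] distrib_right)
      from has_sum_unique[OF matrix_op_has_sum[OF C] this] show ?thesis .
    qed
    have U: "ennreal (cmod (U i)) \<le> esum (\<lambda>k. ennreal (cmod (E i k)))" for i
    proof -
      have "cmod (U i) \<le> (\<Sum>k<m. cmod (E i k))"
        unfolding U_def by (rule order_trans[OF norm_sum]) (simp add: norm_mult)
      then have "ennreal (cmod (U i)) \<le> (\<Sum>k<m. ennreal (cmod (E i k)))"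
        by (simp add: ennreal_leI)
      also have "\<dots> \<le> esum (\<lambda>k. ennreal (cmod (E i k)))" by (rule esum_finite_le) simp
      finally show ?thesis .
    qed
    have T: "ennreal (cmod (T i)) \<le> esum (\<lambda>j. ennreal (cmod (b j)) * indicator (defect m j) i)" for i
    proof -
      \<comment> \<open>The coefficient indices \<open>k - i\<close> that occur in row
        \<open>i\<close>; up to a unimodular factor, \<open>T i\<close> is the sum of
        \<open>g\<close> over them.\<close>
      define J where "J = {- int i..<int m - int i}"
      have img: "J = (\<lambda>k. int k - int i) ` {..<m}"
      proof -
        have "j \<in> (\<lambda>k. int k - int i) ` {..<m}" if "j \<in> J" for j
          using that by (intro image_eqI[of _ _ "nat (j + int i)"]) (auto simp: J_def)
        then show ?thesis by (auto simp: J_def)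
      qed
      have "T i = (\<Sum>k<m. cis (real i * t) * g (int k - int i))"
        unfolding T_def g_def by (intro sum.cong refl) (simp add: cis_mult algebra_simps)
      also have "\<dots> = cis (real i * t) * (\<Sum>j\<in>J. g j)"
        unfolding img by (subst sum.reindex) (auto simp: inj_on_def sum_distrib_left)
      finally have Ti: "cmod (T i) = cmod (\<Sum>j\<in>J. g j)" by (simp add: norm_mult)
      show ?thesis
      proof (cases "i < m")
        case False
        have "ennreal (cmod (T i)) \<le> (\<Sum>j\<in>J. ennreal (cmod (b j)))"
          unfolding Ti sum_ennreal[OF norm_ge_zero]
          by (intro ennreal_leI order_trans[OF norm_sum]) (simp add: g_def norm_mult)
        also have "\<dots> = (\<Sum>j\<in>J. ennreal (cmod (b j)) * indicator (defect m j) i)"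
          using False by (intro sum.cong) (auto simp: J_def defect_def indicator_def)
        also have "\<dots> \<le> esum (\<lambda>j. ennreal (cmod (b j)) * indicator (defect m j) i)"
          by (rule esum_finite_le) (simp add: J_def)
        finally show ?thesis .
      next
        case True
        \<comment> \<open>Subtracting from the full sum, which is 0, leaves minus the terms in
          \<open>J\<close> and expresses them by those outside \<open>J\<close>.\<close>
        have "((\<lambda>j. if j \<in> J then g j else 0) has_sum (\<Sum>j\<in>J. g j)) UNIV"
          by (rule has_sum_finite_neutralI[where B = J]) (auto simp: J_def)
        from has_sum_add[OF g0 has_sum_uminusI[OF this]]
        have "infsum (\<lambda>j. g j + - (if j \<in> J then g j else 0)) UNIV = - (\<Sum>j\<in>J. g j)"
          by (simp add: infsumI)
        then have "cmod (T i) = cmod (infsum (\<lambda>j. g j + - (if j \<in> J then g j else 0)) UNIV)"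
          by (simp add: Ti)
        then have "ennreal (cmod (T i)) \<le> esum (\<lambda>j. ennreal (cmod (g j + - (if j \<in> J then g j else 0))))"
          using norm_infsum_le_esum by simp
        also have "\<dots> \<le> esum (\<lambda>j. ennreal (cmod (b j)) * indicator (defect m j) i)"
          using True by (intro esum_mono) (auto simp: g_def norm_mult J_def defect_def indicator_def)
        finally show ?thesis .
      qed
    qed
    have "esum (\<lambda>i. ennreal (cmod (T i))) \<le> 2 * B"
    proof -
      have "esum (\<lambda>i. ennreal (cmod (T i)))
          \<le> esum (\<lambda>i. esum (\<lambda>j. ennreal (cmod (b j)) * indicator (defect m j) i))"
        by (intro esum_mono T)
      also have "\<dots> = esum (\<lambda>j. ennreal (cmod (b j)) * esum (indicator (defect m j)))"
        by (subst esum_swap) (simp add: esum_cmult)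
      also have "\<dots> \<le> esum (\<lambda>j. ennreal (cmod (b j)) * ennreal (2 * \<bar>real_of_int j\<bar>))"
        by (intro esum_mono mult_left_mono card_defect) auto
      also have "\<dots> \<le> esum (\<lambda>j. ennreal 2 * ennreal ((1 + \<bar>real_of_int j\<bar>) * cmod (b j)))"
      proof (rule esum_mono)
        fix j
        have "ennreal (cmod (b j)) * ennreal (2 * \<bar>real_of_int j\<bar>) = ennreal (cmod (b j) * (2 * \<bar>real_of_int j\<bar>))"
          by (rule ennreal_mult[symmetric]) auto
        also have "\<dots> \<le> ennreal (2 * ((1 + \<bar>real_of_int j\<bar>) * cmod (b j)))"
          by (rule ennreal_leI) (simp add: algebra_simps)
        also have "\<dots> = ennreal 2 * ennreal ((1 + \<bar>real_of_int j\<bar>) * cmod (b j))"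
          by (rule ennreal_mult) auto
        finally show "ennreal (cmod (b j)) * ennreal (2 * \<bar>real_of_int j\<bar>)
            \<le> ennreal 2 * ennreal ((1 + \<bar>real_of_int j\<bar>) * cmod (b j))" .
      qed
      also have "\<dots> = 2 * B" by (simp add: esum_cmult B_def wnorm_def)
      finally show ?thesis .
    qed
    moreover have "esum (\<lambda>i. ennreal (cmod (U i))) \<le> fnorm E"
      unfolding fnorm_def by (intro esum_mono U)
    moreover have "esum (\<lambda>i. ennreal (cmod (T i + U i))) \<le> esum (\<lambda>i. ennreal (cmod (T i))) + esum (\<lambda>i. ennreal (cmod (U i)))"
      unfolding esum_add[symmetric]
      by (intro esum_mono) (simp add: ennreal_plus[symmetric] ennreal_leI norm_triangle_ineq del: ennreal_plus)
    ultimately have "esum (\<lambda>i. ennreal (cmod (T i + U i))) \<le> 2 * B + fnorm E"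
      by (meson add_mono order_trans)
    then show "esum (\<lambda>i. ennreal (cmod (ell2_nth (matrix_op M (x m)) i))) \<le> ennreal K"
      by (simp add: y K)
  qed (rule K)
  obtain m :: nat where m: "(norm R * K)\<^sup>2 < real m" using reals_Archimedean2 by blast
  have "R (matrix_op M (x m)) = x m"
    using inv unfolding is_op_inverse_def M_def[symmetric]
    by (metis blinfun_apply_blinfun_compose blinfun_apply_id_blinfun id_apply)
  then have "sqrt m \<le> norm R * norm (matrix_op M (x m))"
    using norm_blinfun[of R "matrix_op M (x m)"] by (simp add: normx)
  also have "\<dots> \<le> norm R * K" by (intro mult_left_mono Sx) auto
  finally have "real m \<le> (norm R * K)\<^sup>2" by (rule sqrt_le_D)
  with m show False by simp
qed

subsection \<open>The inverse of a quasi-Toeplitz matrix\<close>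

lemma infsum_int_split:
  fixes f :: "int \<Rightarrow> complex"
  assumes "f summable_on UNIV"
  shows "(\<Sum>\<^sub>\<infinity>k. f k) = (\<Sum>\<^sub>\<infinity>n. f (int n)) + (\<Sum>\<^sub>\<infinity>n. f (- 1 - int n))"
proof -
  have U: "UNIV = range int \<union> range (\<lambda>n. - 1 - int n)"
  proof -
    have "k \<in> range int \<union> range (\<lambda>n. - 1 - int n)" for k
    proof (cases "0 \<le> k")
      case True
      then show ?thesis by (auto intro!: image_eqI[of _ _ "nat k"])
    next
      case False
      then show ?thesis by (auto intro!: image_eqI[of _ _ "nat (- 1 - k)"])
    qed
    then show ?thesis by auto
  qed
  have "(\<Sum>\<^sub>\<infinity>k. f k) = infsum f (range int) + infsum f (range (\<lambda>n. - 1 - int n))"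
    unfolding U by (rule infsum_Un_disjoint) (auto intro: summable_on_subset_banach[OF assms])
  then show ?thesis by (simp add: infsum_reindex inj_on_def o_def)
qed

text \<open>The product of the Hankel matrix of the negative coefficients of \<open>u\<close> with
  that of the positive coefficients of \<open>w\<close>; \<open>n\<close> encodes the intermediate
  index \<open>- 1 - n\<close>, which lies outside the semi-infinite matrix.\<close>

definition hankel :: "(int \<Rightarrow> complex) \<Rightarrow> (int \<Rightarrow> complex) \<Rightarrow> inf_matrix" where
  "hankel u w i j = (\<Sum>\<^sub>\<infinity>n. u (- 1 - int n - int i) * w (int j + 1 + int n))"

text \<open>The convolution sums over all integer intermediate indices, the matrix product over the
  nonnegative ones only.\<close>

lemma toeplitz_product:
  assumes "u \<in> wiener" "w \<in> wiener"
  shows "(\<Sum>\<^sub>\<infinity>k. toeplitz u i k * toeplitz w k j) = conv u w (int j - int i) - hankel u w i j"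
proof -
  let ?f = "\<lambda>k. u (k - int i) * w (int j - k)"
  have "bij (\<lambda>k. k - int i)"
    by (rule bij_betw_byWitness[where f' = "\<lambda>k. k + int i"]) auto
  from summable_on_reindex_bij_betw[OF this, of "\<lambda>l. u l * w (int j - int i - l)"]
  have "(\<lambda>k. u (k - int i) * w (int j - int i - (k - int i))) summable_on UNIV"
    using conv_summable[OF assms, of "int j - int i"] by simp
  then have s: "?f summable_on UNIV" by simp
  have "conv u w (int j - int i) = (\<Sum>\<^sub>\<infinity>k. ?f k)"
    unfolding conv_def using infsum_shift[of "\<lambda>l. u l * w (int j - int i - l)" "- int i"] by simp
  also have "\<dots> = (\<Sum>\<^sub>\<infinity>k. ?f (int k)) + (\<Sum>\<^sub>\<infinity>n. ?f (- 1 - int n))"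
    by (rule infsum_int_split[OF s])
  finally show ?thesis by (simp add: toeplitz_def hankel_def algebra_simps)
qed

text \<open>An index \<open>k\<close> has exactly \<open>nat k\<close> representations
  \<open>j + 1 + n\<close>, so \<open>g k\<close> is counted at most \<open>|k|\<close>
  times.\<close>

lemma esum_hankel_le:
  fixes g :: "int \<Rightarrow> ennreal"
  shows "esum (\<lambda>j. esum (\<lambda>n. g (int j + 1 + int n))) \<le> esum (\<lambda>k. ennreal \<bar>real_of_int k\<bar> * g k)"
proof -
  define I where "I j k = (indicator {int j + 1..} k :: ennreal)" for j k
  have "esum (\<lambda>n. g (int j + 1 + int n)) \<le> esum (\<lambda>k. I j k * g k)" for j
  proof -
    have "inj (\<lambda>n. int j + 1 + int n)" by (auto simp: inj_on_def)
    from esum_inj_le[OF this, of "\<lambda>k. I j k * g k"] show ?thesis by (simp add: I_def)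
  qed
  then have "esum (\<lambda>j. esum (\<lambda>n. g (int j + 1 + int n))) \<le> esum (\<lambda>j. esum (\<lambda>k. I j k * g k))"
    by (rule esum_mono)
  also have "\<dots> = esum (\<lambda>k. esum (\<lambda>j. I j k) * g k)"
    by (subst esum_swap) (simp add: esum_multc)
  also have "\<dots> \<le> esum (\<lambda>k. ennreal \<bar>real_of_int k\<bar> * g k)"
  proof (intro esum_mono mult_right_mono)
    fix k
    have "(\<lambda>j. I j k) = indicator {..<nat k}"
      by (auto simp: I_def indicator_def fun_eq_iff)
    then have "esum (\<lambda>j. I j k) = of_nat (nat k)" using esum_card[of "{..<nat k}"] by simp
    also have "\<dots> \<le> ennreal \<bar>real_of_int k\<bar>"
      unfolding ennreal_of_nat_eq_real_of_nat by (rule ennreal_leI) linarith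
    finally show "esum (\<lambda>j. I j k) \<le> ennreal \<bar>real_of_int k\<bar>" .
  qed simp
  finally show ?thesis .
qed

lemma esum_abs_weight_le:
  "esum (\<lambda>k. ennreal \<bar>real_of_int k\<bar> * ennreal (cmod (b k))) \<le> wnorm (\<lambda>k. 1 + \<bar>real_of_int k\<bar>) b"
  unfolding wnorm_def
proof (rule esum_mono)
  fix k
  have "ennreal \<bar>real_of_int k\<bar> * ennreal (cmod (b k)) = ennreal (\<bar>real_of_int k\<bar> * cmod (b k))"
    by (rule ennreal_mult[symmetric]) auto
  also have "\<dots> \<le> ennreal ((1 + \<bar>real_of_int k\<bar>) * cmod (b k))"
    by (rule ennreal_leI) (simp add: distrib_right)
  finally show "ennreal \<bar>real_of_int k\<bar> * ennreal (cmod (b k)) \<le> ennreal ((1 + \<bar>real_of_int k\<bar>) * cmod (b k))" .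
qed

text \<open>One outer sum costs the unweighted norm of one symbol; the remaining two sums cost the
  linear weight on the other. Both versions are needed, as \<open>b\<close> carries the weight on
  either side of \<open>c\<close>.\<close>

lemma fnorm_hankel_left: "fnorm (hankel u w) \<le> wnorm (\<lambda>k. 1 + \<bar>real_of_int k\<bar>) u * wnorm1 w"
  and fnorm_hankel_right: "fnorm (hankel u w) \<le> wnorm1 u * wnorm (\<lambda>k. 1 + \<bar>real_of_int k\<bar>) w"
proof -
  let ?U = "\<lambda>i n. ennreal (cmod (u (- 1 - int n - int i)))"
  let ?W = "\<lambda>j n. ennreal (cmod (w (int j + 1 + int n)))"
  have le: "fnorm (hankel u w) \<le> esum (\<lambda>i. esum (\<lambda>j. esum (\<lambda>n. ?U i n * ?W j n)))"
    unfolding fnorm_def hankel_def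
    by (intro esum_mono order_trans[OF norm_infsum_le_esum]) (simp add: norm_mult ennreal_mult)
  have "esum (\<lambda>j. ?W j n) \<le> wnorm1 w" for n
    using esum_inj_le[of "\<lambda>j. int j + 1 + int n" "\<lambda>k. ennreal (cmod (w k))"]
    by (simp add: wnorm_def inj_on_def)
  then have "esum (\<lambda>n. esum (\<lambda>j. ?U i n * ?W j n)) \<le> esum (?U i) * wnorm1 w" for i
    by (rule esum_double_le)
  then have "esum (\<lambda>i. esum (\<lambda>j. esum (\<lambda>n. ?U i n * ?W j n))) \<le> esum (\<lambda>i. esum (?U i) * wnorm1 w)"
    by (subst (2) esum_swap) (intro esum_mono)
  also have "\<dots> = esum (\<lambda>i. esum (?U i)) * wnorm1 w" by (rule esum_multc)
  also have "\<dots> \<le> wnorm (\<lambda>k. 1 + \<bar>real_of_int k\<bar>) u * wnorm1 w"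
  proof (rule mult_right_mono)
    have "esum (\<lambda>i. esum (?U i)) = esum (\<lambda>i. esum (\<lambda>n. ennreal (cmod (u (- (int i + 1 + int n))))))"
      by (simp add: algebra_simps)
    also have "\<dots> \<le> esum (\<lambda>k. ennreal \<bar>real_of_int k\<bar> * ennreal (cmod (u (- k))))"
      by (rule esum_hankel_le)
    also have "\<dots> = esum (\<lambda>k. ennreal \<bar>real_of_int k\<bar> * ennreal (cmod (u k)))"
    proof -
      have "bij (uminus :: int \<Rightarrow> int)" by (rule involuntory_imp_bij) simp
      from esum_reindex[OF this, of "\<lambda>k. ennreal \<bar>real_of_int k\<bar> * ennreal (cmod (u k))"] show ?thesis by simp
    qed
    finally show "esum (\<lambda>i. esum (?U i)) \<le> wnorm (\<lambda>k. 1 + \<bar>real_of_int k\<bar>) u"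
      using esum_abs_weight_le order_trans by blast
  qed simp
  finally show "fnorm (hankel u w) \<le> wnorm (\<lambda>k. 1 + \<bar>real_of_int k\<bar>) u * wnorm1 w" using le by simp
  have "esum (\<lambda>i. ?U i n) \<le> wnorm1 u" for n
    using esum_inj_le[of "\<lambda>i. - 1 - int n - int i" "\<lambda>k. ennreal (cmod (u k))"]
    by (simp add: wnorm_def inj_on_def)
  then have "esum (\<lambda>n. esum (\<lambda>i. ?W j n * ?U i n)) \<le> esum (?W j) * wnorm1 u" for j
    by (rule esum_double_le)
  then have "esum (\<lambda>j. esum (\<lambda>n. esum (\<lambda>i. ?W j n * ?U i n))) \<le> esum (\<lambda>j. esum (?W j) * wnorm1 u)"
    by (intro esum_mono)
  also have "\<dots> = esum (\<lambda>j. esum (?W j)) * wnorm1 u" by (rule esum_multc)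
  also have "\<dots> \<le> wnorm (\<lambda>k. 1 + \<bar>real_of_int k\<bar>) w * wnorm1 u"
    by (intro mult_right_mono order_trans[OF esum_hankel_le esum_abs_weight_le]) auto
  also have "esum (\<lambda>j. esum (\<lambda>n. esum (\<lambda>i. ?W j n * ?U i n))) = esum (\<lambda>i. esum (\<lambda>j. esum (\<lambda>n. ?U i n * ?W j n)))"
    by (subst (2) esum_swap, subst esum_swap) (simp only: mult.commute)
  finally show "fnorm (hankel u w) \<le> wnorm1 u * wnorm (\<lambda>k. 1 + \<bar>real_of_int k\<bar>) w"
    using le by (simp add: mult.commute)
qed

text \<open>Summable matrices absorb factors with bounded absolute row sums on the right, and, by
  transposition in \<open>fnorm_mult_right\<close>, factors with bounded column sums on the
  left.\<close>

lemma fnorm_mult_left: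
  assumes "\<And>i j. ennreal (cmod (P i j)) \<le> esum (\<lambda>k. ennreal (cmod (M i k)) * ennreal (cmod (N k j)))"
    and "\<And>k. esum (\<lambda>j. ennreal (cmod (N k j))) \<le> C"
  shows "fnorm P \<le> fnorm M * C"
proof -
  have "fnorm P \<le> esum (\<lambda>i. esum (\<lambda>j. esum (\<lambda>k. ennreal (cmod (M i k)) * ennreal (cmod (N k j)))))"
    unfolding fnorm_def by (intro esum_mono assms)
  also have "\<dots> = esum (\<lambda>i. esum (\<lambda>k. esum (\<lambda>j. ennreal (cmod (M i k)) * ennreal (cmod (N k j)))))"
    by (subst (2) esum_swap) simp
  also have "\<dots> \<le> esum (\<lambda>i. esum (\<lambda>k. ennreal (cmod (M i k))) * C)"
    by (intro esum_mono esum_double_le assms)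
  also have "\<dots> = fnorm M * C" by (simp add: esum_multc fnorm_def)
  finally show ?thesis .
qed

lemma fnorm_mult_right:
  assumes "\<And>i j. ennreal (cmod (P i j)) \<le> esum (\<lambda>k. ennreal (cmod (M i k)) * ennreal (cmod (N k j)))"
    and "\<And>k. esum (\<lambda>i. ennreal (cmod (M i k))) \<le> C"
  shows "fnorm P \<le> C * fnorm N"
proof -
  have "fnorm (\<lambda>j i. P i j) \<le> fnorm (\<lambda>j k. N k j) * C"
    by (rule fnorm_mult_left[where N = "\<lambda>k i. M i k"]) (use assms in \<open>simp_all add: mult.commute\<close>)
  moreover have tr: "fnorm (\<lambda>j i. Q i j) = fnorm Q" for Q
    unfolding fnorm_def by (rule esum_swap)
  ultimately show ?thesis unfolding tr[of P] tr[of N] by (simp only: mult.commute)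
qed

lemma fnorm_add: "fnorm (\<lambda>i j. M i j + N i j) \<le> fnorm M + fnorm N"
  unfolding fnorm_def esum_add[symmetric]
  by (intro esum_mono) (simp add: ennreal_plus[symmetric] ennreal_leI norm_triangle_ineq del: ennreal_plus)

lemma fnorm_uminus [simp]: "fnorm (\<lambda>i j. - M i j) = fnorm M"
  by (simp add: fnorm_def)

lemma norm_infsum_mult_le:
  "ennreal (cmod (\<Sum>\<^sub>\<infinity>k. f k * g k)) \<le> esum (\<lambda>k. ennreal (cmod (f k)) * ennreal (cmod (g k)))"
  using norm_infsum_le_esum[of "\<lambda>k. f k * g k"] by (simp add: norm_mult ennreal_mult)

text \<open>With \<open>P = T(c) S - I\<close> and \<open>Q = S T(c) - I\<close>, both in the class of summable matrices, one has
  \<open>R - T(c) = - R Q = - P R\<close>. The first equation bounds the row sums of \<open>R\<close>, which makes \<open>P R\<close>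
  summable.\<close>

lemma inverse_correction:
  assumes b: "wnorm (\<lambda>k. 1 + \<bar>real_of_int k\<bar>) b \<le> ennreal \<beta>" and E: "fnorm E \<le> ennreal \<epsilon>"
    and inv: "is_op_inverse (matrix_op (\<lambda>i j. toeplitz b i j + E i j)) R" and R: "norm R \<le> \<rho>"
    and c: "wnorm1 c \<le> ennreal \<kappa>" "conv c b = cunit" and nn: "0 \<le> \<beta>" "0 \<le> \<epsilon>" "0 \<le> \<kappa>"
  shows "fnorm (\<lambda>i j. entry R i j - toeplitz c i j)
    \<le> ennreal (\<kappa> * (\<beta> + \<epsilon>) * (\<kappa> + \<rho> * (\<kappa> * (\<beta> + \<epsilon>))))"
proof -
  define S where "S = matrix_op (\<lambda>i j. toeplitz b i j + E i j)"
  define T where "T = matrix_op (toeplitz c)"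
  define P where "P = (T o\<^sub>L S) - id_blinfun"
  define Q where "Q = (S o\<^sub>L T) - id_blinfun"
  have bw: "b \<in> wiener" using linear_weight_wiener[of b] b by (simp add: order_le_less_trans)
  have cw: "c \<in> wiener" using c(1) by (simp add: wiener_iff order_le_less_trans)
  have Ef: "E \<in> fmatrices" using E by (simp add: fmatrices_iff order_le_less_trans)
  obtain C where C: "schur_bound C (\<lambda>i j. toeplitz b i j + E i j)" using schur_bound_cqt_exists[OF bw Ef] .
  obtain D where D: "schur_bound D (toeplitz c)" using schur_bound_toeplitz[OF cw] .
  have linS: "clinear_op S" and linT: "clinear_op T"
    unfolding S_def T_def by (rule clinear_matrix_op[OF C], rule clinear_matrix_op[OF D])
  have linR: "clinear_op R" using clinear_inverse[OF linS] inv by (simp add: S_def)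
  have linP: "clinear_op P" and linQ: "clinear_op Q"
    unfolding P_def Q_def by (intro clinear_diff clinear_compose clinear_id linS linT)+
  have eS: "entry S i j = toeplitz b i j + E i j" and eT: "entry T i j = toeplitz c i j" for i j
    unfolding S_def T_def using entry_matrix_op[OF C] entry_matrix_op[OF D] by simp_all
  have RS: "R (S x) = x" and SR: "S (R x) = x" for x
    using inv unfolding is_op_inverse_def S_def[symmetric]
    by (metis blinfun_apply_blinfun_compose blinfun_apply_id_blinfun id_apply)+
  have PR: "P o\<^sub>L R = T - R"
    by (rule blinfun_eqI) (simp add: P_def blinfun.diff_left blinfun.diff_right SR)
  have RQ: "R o\<^sub>L Q = T - R"
    by (rule blinfun_eqI) (simp add: Q_def blinfun.diff_left blinfun.diff_right RS)
  have tsum: "(\<lambda>k. toeplitz u i k * toeplitz w k j) summable_on UNIV"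
    if u: "u \<in> wiener" and w: "w \<in> wiener" for u w i j
  proof (rule esum_imp_summable)
    have "esum (\<lambda>k. ennreal (cmod (toeplitz u i k * toeplitz w k j)))
        \<le> esum (\<lambda>k. ennreal (cmod (toeplitz u i k)) * wnorm1 w)"
      by (intro esum_mono) (simp add: norm_mult ennreal_mult toeplitz_def mult_left_mono cmod_le_wnorm1)
    also have "\<dots> \<le> wnorm1 u * wnorm1 w"
      unfolding esum_multc by (intro mult_right_mono esum_toeplitz_row) auto
    also have "\<dots> < top" using u w by (simp add: wiener_iff ennreal_mult_less_top)
    finally show "esum (\<lambda>k. ennreal (cmod (toeplitz u i k * toeplitz w k j))) < top" .
  qed
  have unit: "cunit (int j - int i) = (if i = j then 1 else 0)" for i j by (auto simp: cunit_def)
  define X where "X i j = (\<Sum>\<^sub>\<infinity>k. toeplitz c i k * E k j)" for i j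
  define Y where "Y i j = (\<Sum>\<^sub>\<infinity>k. E i k * toeplitz c k j)" for i j
  have eP: "entry P i j = - hankel c b i j + X i j" for i j
  proof -
    have 1: "((\<lambda>k. toeplitz c i k * toeplitz b k j + toeplitz c i k * E k j) has_sum entry (T o\<^sub>L S) i j) UNIV"
      using entry_compose[OF linT, of i S j] by (simp add: eS eT distrib_left)
    have 2: "((\<lambda>k. toeplitz c i k * toeplitz b k j) has_sum (cunit (int j - int i) - hankel c b i j)) UNIV"
      using has_sum_infsum[OF tsum[OF cw bw]] unfolding toeplitz_product[OF cw bw] c(2) .
    from has_sum_add[OF 1 has_sum_uminusI[OF 2]]
    have "X i j = entry (T o\<^sub>L S) i j - (cunit (int j - int i) - hankel c b i j)"
      by (simp add: X_def infsumI)
    then show ?thesis by (simp add: P_def entry_diff entry_id unit)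
  qed
  have eQ: "entry Q i j = - hankel b c i j + Y i j" for i j
  proof -
    have 1: "((\<lambda>k. toeplitz b i k * toeplitz c k j + E i k * toeplitz c k j) has_sum entry (S o\<^sub>L T) i j) UNIV"
      using entry_compose[OF linS, of i T j] by (simp add: eS eT distrib_right)
    have 2: "((\<lambda>k. toeplitz b i k * toeplitz c k j) has_sum (cunit (int j - int i) - hankel b c i j)) UNIV"
      using has_sum_infsum[OF tsum[OF bw cw]] unfolding toeplitz_product[OF bw cw] conv_commute[of b c] c(2) .
    from has_sum_add[OF 1 has_sum_uminusI[OF 2]]
    have "Y i j = entry (S o\<^sub>L T) i j - (cunit (int j - int i) - hankel b c i j)"
      by (simp add: Y_def infsumI)
    then show ?thesis by (simp add: Q_def entry_diff entry_id unit)
  qed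
  \<comment> \<open>A common bound for \<open>P\<close> and \<open>Q\<close>: the Hankel part
    contributes \<open>\<kappa> * \<beta>\<close>, the product with \<open>E\<close> contributes
    \<open>\<kappa> * \<epsilon>\<close>.\<close>
  define \<eta> where "\<eta> = \<kappa> * (\<beta> + \<epsilon>)"
  have \<eta>0: "0 \<le> \<eta>" using nn by (simp add: \<eta>_def)
  have \<eta>: "ennreal \<kappa> * ennreal \<beta> + ennreal \<kappa> * ennreal \<epsilon> = ennreal \<eta>"
    unfolding \<eta>_def distrib_left using nn by (simp add: ennreal_mult)
  have fX: "fnorm X \<le> ennreal \<kappa> * ennreal \<epsilon>"
  proof -
    have "fnorm X \<le> wnorm1 c * fnorm E"
      unfolding X_def by (rule fnorm_mult_right[OF norm_infsum_mult_le esum_toeplitz_col])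
    also have "\<dots> \<le> ennreal \<kappa> * ennreal \<epsilon>" by (intro mult_mono c E) auto
    finally show ?thesis .
  qed
  have fY: "fnorm Y \<le> ennreal \<kappa> * ennreal \<epsilon>"
  proof -
    have "fnorm Y \<le> fnorm E * wnorm1 c"
      unfolding Y_def by (rule fnorm_mult_left[OF norm_infsum_mult_le esum_toeplitz_row])
    also have "\<dots> \<le> ennreal \<epsilon> * ennreal \<kappa>" by (intro mult_mono c E) auto
    finally show ?thesis by (simp add: mult.commute)
  qed
  have fP: "fnorm (entry P) \<le> ennreal \<eta>"
  proof -
    have "fnorm (entry P) \<le> fnorm (\<lambda>i j. - hankel c b i j) + fnorm X"
      unfolding eP[abs_def] by (rule fnorm_add)
    also have "\<dots> \<le> ennreal \<kappa> * ennreal \<beta> + ennreal \<kappa> * ennreal \<epsilon>"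
      unfolding fnorm_uminus
      by (intro add_mono fX order_trans[OF fnorm_hankel_right] mult_mono c b) auto
    finally show ?thesis by (simp add: \<eta>)
  qed
  have fQ: "fnorm (entry Q) \<le> ennreal \<eta>"
  proof -
    have "fnorm (entry Q) \<le> fnorm (\<lambda>i j. - hankel b c i j) + fnorm Y"
      unfolding eQ[abs_def] by (rule fnorm_add)
    also have "\<dots> \<le> ennreal \<beta> * ennreal \<kappa> + ennreal \<kappa> * ennreal \<epsilon>"
      unfolding fnorm_uminus
      by (intro add_mono fY order_trans[OF fnorm_hankel_left] mult_mono c b) auto
    finally show ?thesis using \<eta> by (simp only: mult.commute)
  qed
  have \<rho>0: "0 \<le> \<rho>" using R norm_ge_zero order_trans by blast
  have row: "esum (\<lambda>j. ennreal (cmod (entry R i j))) \<le> ennreal (\<kappa> + \<rho> * \<eta>)" for i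
  proof -
    \<comment> \<open>Bounding each entry of \<open>R\<close> by the operator norm is crude, but
      enough: \<open>Q\<close> is summable over both indices.\<close>
    have "ennreal (cmod (entry (T - R) i j)) \<le> esum (\<lambda>k. ennreal \<rho> * ennreal (cmod (entry Q k j)))" for j
    proof -
      have "entry (T - R) i j = (\<Sum>\<^sub>\<infinity>k. entry R i k * entry Q k j)"
        using entry_compose[OF linR, of i Q j] by (simp add: RQ infsumI)
      then have "ennreal (cmod (entry (T - R) i j)) \<le> esum (\<lambda>k. ennreal (cmod (entry R i k)) * ennreal (cmod (entry Q k j)))"
        by (simp add: norm_infsum_mult_le)
      also have "\<dots> \<le> esum (\<lambda>k. ennreal \<rho> * ennreal (cmod (entry Q k j)))"
        by (intro esum_mono mult_right_mono ennreal_leI order_trans[OF norm_entry_le R]) auto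
      finally show ?thesis .
    qed
    then have "esum (\<lambda>j. ennreal (cmod (entry (T - R) i j))) \<le> esum (\<lambda>j. esum (\<lambda>k. ennreal \<rho> * ennreal (cmod (entry Q k j))))"
      by (intro esum_mono)
    also have "\<dots> = ennreal \<rho> * fnorm (entry Q)"
      by (subst esum_swap) (simp add: esum_cmult fnorm_def)
    also have "\<dots> \<le> ennreal \<rho> * ennreal \<eta>" by (intro mult_left_mono fQ) auto
    finally have 1: "esum (\<lambda>j. ennreal (cmod (entry (T - R) i j))) \<le> ennreal \<rho> * ennreal \<eta>" .
    have "esum (\<lambda>j. ennreal (cmod (entry R i j)))
        \<le> esum (\<lambda>j. ennreal (cmod (toeplitz c i j))) + esum (\<lambda>j. ennreal (cmod (entry (T - R) i j)))"
      unfolding esum_add[symmetric]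
    proof (rule esum_mono)
      fix j
      have "cmod (entry R i j) \<le> cmod (toeplitz c i j) + cmod (entry (T - R) i j)"
        using norm_triangle_ineq4[of "toeplitz c i j" "entry (T - R) i j"] by (simp add: entry_diff eT)
      then show "ennreal (cmod (entry R i j)) \<le> ennreal (cmod (toeplitz c i j)) + ennreal (cmod (entry (T - R) i j))"
        by (simp add: ennreal_plus[symmetric] ennreal_leI del: ennreal_plus)
    qed
    also have "\<dots> \<le> ennreal \<kappa> + ennreal \<rho> * ennreal \<eta>"
      by (intro add_mono 1 order_trans[OF esum_toeplitz_row c(1)])
    finally show ?thesis using nn \<rho>0 \<eta>0 by (simp add: ennreal_mult)
  qed
  have "fnorm (\<lambda>i j. entry R i j - toeplitz c i j) = fnorm (entry (T - R))"
    unfolding fnorm_def entry_diff eT by (simp add: norm_minus_commute)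
  also have "\<dots> \<le> fnorm (entry P) * ennreal (\<kappa> + \<rho> * \<eta>)"
  proof (rule fnorm_mult_left[OF _ row])
    fix i j
    have "entry (T - R) i j = (\<Sum>\<^sub>\<infinity>k. entry P i k * entry R k j)"
      using entry_compose[OF linP, of i R j] by (simp add: PR infsumI)
    then show "ennreal (cmod (entry (T - R) i j)) \<le> esum (\<lambda>k. ennreal (cmod (entry P i k)) * ennreal (cmod (entry R k j)))"
      by (simp add: norm_infsum_mult_le)
  qed
  also have "\<dots> \<le> ennreal \<eta> * ennreal (\<kappa> + \<rho> * \<eta>)" by (intro mult_right_mono fP) auto
  also have "\<dots> = ennreal (\<eta> * (\<kappa> + \<rho> * \<eta>))" using \<eta>0 nn \<rho>0 by (intro ennreal_mult[symmetric]) auto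
  finally show ?thesis by (simp add: \<eta>_def)
qed

subsection \<open>Integration along the boundary curve\<close>

text \<open>Lets the operator-valued integrand and its scalar entries share
  \<open>integrable_derivative_times\<close>.\<close>

lemma bounded_bilinear_cmul: "bounded_bilinear (\<lambda>c (P :: ell2 \<Rightarrow>\<^sub>L ell2). cmul c o\<^sub>L P)"
proof
  fix c d :: complex and P Q :: "ell2 \<Rightarrow>\<^sub>L ell2" and r :: real
  show "cmul (c + d) o\<^sub>L P = (cmul c o\<^sub>L P) + (cmul d o\<^sub>L P)"
    by (intro blinfun_eqI ell2_eqI) (simp add: blinfun.add_left ell2_nth_cscale ell2_nth_add distrib_right)
  show "cmul c o\<^sub>L (P + Q) = (cmul c o\<^sub>L P) + (cmul c o\<^sub>L Q)"
    by (intro blinfun_eqI ell2_eqI) (simp add: blinfun.add_left ell2_nth_cscale ell2_nth_add distrib_left)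
  show "cmul (r *\<^sub>R c) o\<^sub>L P = r *\<^sub>R (cmul c o\<^sub>L P)"
    by (intro blinfun_eqI ell2_eqI) (simp add: blinfun.scaleR_left ell2_nth_cscale ell2_nth_scaleR scaleR_conv_of_real)
  show "cmul c o\<^sub>L (r *\<^sub>R P) = r *\<^sub>R (cmul c o\<^sub>L P)"
    by (intro blinfun_eqI ell2_eqI) (simp add: blinfun.scaleR_left ell2_nth_cscale ell2_nth_scaleR)
  show "\<exists>K. \<forall>c (P :: ell2 \<Rightarrow>\<^sub>L ell2). norm (cmul c o\<^sub>L P) \<le> norm c * norm P * K"
  proof (intro exI[of _ 1] allI)
    fix c and P :: "ell2 \<Rightarrow>\<^sub>L ell2"
    have "norm (cmul c o\<^sub>L P) \<le> norm c * norm P"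
    proof (rule norm_blinfun_bound)
      fix x
      have "norm c * norm (P x) \<le> norm c * (norm P * norm x)"
        by (intro mult_left_mono norm_blinfun) auto
      then show "norm ((cmul c o\<^sub>L P) x) \<le> norm c * norm P * norm x"
        by (simp add: norm_cscale mult.assoc)
    qed simp
    then show "norm (cmul c o\<^sub>L P) \<le> norm c * norm P * 1" by simp
  qed
qed

lemma cmul_mult_compose: "cmul (c * d) o\<^sub>L P = cmul d o\<^sub>L (cmul c o\<^sub>L P)"
  by (intro blinfun_eqI ell2_eqI) (simp add: ell2_nth_cscale)

text \<open>On each piece of a fine division \<open>h\<close> is frozen at the tag. The fundamental
  theorem integrates the derivative times this constant, and boundedness of the derivative makes the
  error uniformly small.\<close>

lemma integrable_derivative_times:
  fixes prod :: "'a::banach \<Rightarrow> 'b::banach \<Rightarrow> 'c::banach" and \<gamma> \<gamma>' :: "real \<Rightarrow> 'a"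
  assumes prod: "bounded_bilinear prod"
    and vd: "\<And>s. s \<in> {a..b} \<Longrightarrow> (\<gamma> has_vector_derivative \<gamma>' s) (at s within {a..b})"
    and le: "\<And>s. s \<in> {a..b} \<Longrightarrow> norm (\<gamma>' s) \<le> L"
    and h: "continuous_on {a..b} h"
  shows "(\<lambda>s. prod (\<gamma>' s) (h s)) integrable_on {a..b}"
proof -
  interpret prod: bounded_bilinear prod by (rule prod)
  obtain K where K: "0 < K" "\<And>x y. norm (prod x y) \<le> norm x * norm y * K"
    using prod.pos_bounded by blast
  \<comment> \<open>A positive bound, so that the tolerance \<open>e / (L' * K)\<close> is
    positive.\<close>
  define L' where "L' = \<bar>L\<bar> + 1"
  have L'0: "0 < L'" by (simp add: L'_def)
  have L'1: "norm (\<gamma>' s) \<le> L'" if "s \<in> {a..b}" for s using le[OF that] by (simp add: L'_def)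
  note L' = L'0 L'1
  have "(\<lambda>s. prod (\<gamma>' s) (h s)) integrable_on cbox a b"
  proof (rule integrable_uniform_limit)
    fix e :: real assume e: "e > 0"
    then have "0 < e / (L' * K)" using K L' by simp
    then obtain d where "0 < d" and d: "\<And>x x'. \<lbrakk>x \<in> cbox a b; x' \<in> cbox a b; dist x' x < d\<rbrakk> \<Longrightarrow> dist (h x') (h x) < e / (L' * K)"
      using compact_uniformly_continuous[of "cbox a b" h] h unfolding uniformly_continuous_on_def
      by (metis compact_cbox interval_cbox)
    obtain p where ptag: "p tagged_division_of cbox a b" and finep: "(\<lambda>x. ball x d) fine p"
      using fine_division_exists[OF gauge_ball[OF \<open>0 < d\<close>], of a b] .
    have *: "\<forall>i\<in>snd ` p. \<exists>g. (\<forall>x\<in>i. norm (prod (\<gamma>' x) (h x) - g x) \<le> e) \<and> g integrable_on i"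
    proof clarsimp
      fix x l assume as: "(x, l) \<in> p"
      obtain u v where l: "l = cbox u v" using as ptag by blast
      have x: "x \<in> l" "l \<subseteq> cbox a b" using as ptag by auto
      show "\<exists>g. (\<forall>y\<in>l. norm (prod (\<gamma>' y) (h y) - g y) \<le> e) \<and> g integrable_on l"
      proof (intro exI conjI strip)
        have uv: "u \<le> v" "{u..v} \<subseteq> {a..b}" using x by (auto simp: l)
        have "(\<gamma>' has_integral (\<gamma> v - \<gamma> u)) {u..v}"
          using uv by (intro fundamental_theorem_of_calculus has_vector_derivative_within_subset[OF vd]) auto
        from has_integral_linear[OF this prod.bounded_linear_left[of "h x"]]
        show "(\<lambda>y. prod (\<gamma>' y) (h x)) integrable_on l"
          by (auto simp: l o_def integrable_on_def)
      next
        fix y assume y: "y \<in> l"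
        then have "y \<in> ball x d" using as finep by fastforce
        then have "dist (h y) (h x) < e / (L' * K)" using x y by (intro d) (auto simp: dist_commute)
        then have hh: "norm (h y - h x) \<le> e / (L' * K)" by (simp add: dist_norm)
        have "norm (prod (\<gamma>' y) (h y) - prod (\<gamma>' y) (h x)) \<le> norm (\<gamma>' y) * norm (h y - h x) * K"
          using K(2)[of "\<gamma>' y" "h y - h x"] by (simp add: prod.diff_right)
        also have "\<dots> \<le> L' * (e / (L' * K)) * K"
          using K L' x y by (intro mult_right_mono mult_mono L' hh) auto
        also have "\<dots> = e" using K L' by simp
        finally show "norm (prod (\<gamma>' y) (h y) - prod (\<gamma>' y) (h x)) \<le> e" .
      qed
    qed
    from e have "e \<ge> 0" by auto
    from approximable_on_division[OF this division_of_tagged_division[OF ptag] *]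
    show "\<exists>g. (\<forall>x\<in>cbox a b. norm (prod (\<gamma>' x) (h x) - g x) \<le> e) \<and> g integrable_on cbox a b"
      by metis
  qed
  then show ?thesis by simp
qed

text \<open>The chord is the polygonal length of the partition with a single piece.\<close>

lemma arc_length_param_dist_le:
  assumes "arc_length_param \<gamma> s0 s1" "s0 \<le> s" "s \<le> t" "t \<le> s1"
  shows "dist (\<gamma> s) (\<gamma> t) \<le> t - s"
proof -
  have "ereal (\<Sum>k<1. dist (\<gamma> ((\<lambda>k::nat. if k = 0 then s else t) k)) (\<gamma> ((\<lambda>k. if k = 0 then s else t) (Suc k))))
      \<le> curve_length \<gamma> s t"
    unfolding curve_length_def
    by (rule Sup_upper, rule CollectI, rule exI[of _ 1], rule exI[of _ "\<lambda>k. if k = 0 then s else t"]) (use assms in auto)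
  then show ?thesis using assms unfolding arc_length_param_def by simp
qed

lemma arc_length_param_lipschitz:
  assumes "arc_length_param \<gamma> s0 s1" "s \<in> {s0..s1}" "t \<in> {s0..s1}"
  shows "norm (\<gamma> s - \<gamma> t) \<le> \<bar>s - t\<bar>"
  using arc_length_param_dist_le[OF assms(1), of s t] arc_length_param_dist_le[OF assms(1), of t s] assms
  by (cases "s \<le> t") (auto simp: dist_norm norm_minus_commute)

text \<open>The Lipschitz bound passes to the limit of difference quotients; \<open>s0 < s1\<close>
  ensures that every \<open>s\<close>, end points included, is a limit point of the
  interval.\<close>

lemma norm_derivative_le_one:
  fixes \<gamma> :: "real \<Rightarrow> 'a::real_normed_vector"
  assumes vd: "(\<gamma> has_vector_derivative d) (at s within {s0..s1})" and s: "s \<in> {s0..s1}" "s0 < s1"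
    and lip: "\<And>s t. s \<in> {s0..s1} \<Longrightarrow> t \<in> {s0..s1} \<Longrightarrow> norm (\<gamma> s - \<gamma> t) \<le> \<bar>s - t\<bar>"
  shows "norm d \<le> 1"
proof (rule tendsto_lowerbound)
  let ?q = "\<lambda>t. norm (\<gamma> t - \<gamma> s - (t - s) *\<^sub>R d) / norm (t - s)"
  have "(?q \<longlongrightarrow> 0) (at s within {s0..s1})"
    using vd by (simp add: has_vector_derivative_def has_derivative_iff_norm)
  from tendsto_add[OF tendsto_const[of 1] this]
  show "((\<lambda>t. 1 + ?q t) \<longlongrightarrow> 1) (at s within {s0..s1})" by simp
  show "\<forall>\<^sub>F t in at s within {s0..s1}. norm d \<le> 1 + ?q t"
    unfolding eventually_at
  proof (intro exI[of _ 1] conjI ballI impI)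
    fix t assume t: "t \<in> {s0..s1}" "t \<noteq> s \<and> dist t s < 1"
    have "norm ((t - s) *\<^sub>R d) \<le> norm (\<gamma> t - \<gamma> s) + norm (\<gamma> t - \<gamma> s - (t - s) *\<^sub>R d)"
      using norm_triangle_ineq4[of "\<gamma> t - \<gamma> s" "\<gamma> t - \<gamma> s - (t - s) *\<^sub>R d"] by simp
    also have "\<dots> \<le> \<bar>t - s\<bar> + norm (\<gamma> t - \<gamma> s - (t - s) *\<^sub>R d)"
      using lip[OF t(1) s(1)] by simp
    finally have "\<bar>t - s\<bar> * norm d \<le> \<bar>t - s\<bar> + norm (\<gamma> t - \<gamma> s - (t - s) *\<^sub>R d)" by simp
    then show "norm d \<le> 1 + ?q t" using t(2) by (simp add: field_simps del: scaleR_left_diff_distrib)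
  qed simp
  show "at s within {s0..s1} \<noteq> bot"
    using s by (simp add: trivial_limit_within islimpt_Icc)
qed

text \<open>Multiplying each integral by its conjugate phase turns a finite sum of moduli into one
  integral, bounded by the supremum of its integrand times the length of the interval. No integral
  of an absolute value occurs.\<close>

lemma esum_integral_le:
  fixes \<gamma> \<gamma>' :: "real \<Rightarrow> complex" and \<psi> :: "'x \<Rightarrow> real \<Rightarrow> complex"
  assumes vd: "\<And>s. s \<in> {a..b} \<Longrightarrow> (\<gamma> has_vector_derivative \<gamma>' s) (at s within {a..b})"
    and le: "\<And>s. s \<in> {a..b} \<Longrightarrow> norm (\<gamma>' s) \<le> 1"
    and \<psi>: "\<And>x. continuous_on {a..b} (\<psi> x)" and ab: "a \<le> b"
    and M: "\<And>s. s \<in> {a..b} \<Longrightarrow> esum (\<lambda>x. ennreal (cmod (\<psi> x s))) \<le> ennreal M" "0 \<le> M"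
  shows "esum (\<lambda>x. ennreal (cmod (integral {a..b} (\<lambda>s. \<gamma>' s * \<psi> x s)))) \<le> ennreal (M * (b - a))"
proof (rule esum_le_finite_sums)
  fix X :: "'x set" assume X: "finite X"
  define I where "I x = integral {a..b} (\<lambda>s. \<gamma>' s * \<psi> x s)" for x
  have I: "((\<lambda>s. \<gamma>' s * \<psi> x s) has_integral I x) {a..b}" for x
    unfolding I_def
    by (rule integrable_integral) (rule integrable_derivative_times[OF bounded_bilinear_mult vd le \<psi>])
  define \<theta> where "\<theta> x = cnj (sgn (I x))" for x
  have \<theta>: "\<theta> x * I x = of_real (cmod (I x))" "cmod (\<theta> x) \<le> 1" for x
  proof -
    have "I x * cnj (I x) = of_real (cmod (I x)) * of_real (cmod (I x))"
      by (simp add: complex_norm_square[symmetric] power2_eq_square)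
    then show "\<theta> x * I x = of_real (cmod (I x))"
      by (cases "I x = 0") (simp_all add: \<theta>_def sgn_eq field_simps)
    show "cmod (\<theta> x) \<le> 1" by (simp add: \<theta>_def norm_sgn)
  qed
  have "((\<lambda>s. \<Sum>x\<in>X. \<theta> x * (\<gamma>' s * \<psi> x s)) has_integral (\<Sum>x\<in>X. \<theta> x * I x)) (cbox a b)"
    by (auto intro!: has_integral_sum X has_integral_mult_right I)
  moreover have "cmod (\<Sum>x\<in>X. \<theta> x * (\<gamma>' s * \<psi> x s)) \<le> M" if "s \<in> cbox a b" for s
  proof -
    have s: "s \<in> {a..b}" using that by simp
    have "cmod (\<Sum>x\<in>X. \<theta> x * (\<gamma>' s * \<psi> x s)) \<le> (\<Sum>x\<in>X. cmod (\<psi> x s))"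
    proof (rule order_trans[OF norm_sum], rule sum_mono)
      fix x
      have "cmod (\<theta> x) * (cmod (\<gamma>' s) * cmod (\<psi> x s)) \<le> 1 * (1 * cmod (\<psi> x s))"
        by (intro mult_mono \<theta> le s) auto
      then show "cmod (\<theta> x * (\<gamma>' s * \<psi> x s)) \<le> cmod (\<psi> x s)" by (simp add: norm_mult)
    qed
    also have "\<dots> \<le> M" by (rule finite_sum_le_esum[OF M(1)[OF s] M(2) _ X]) simp
    finally show ?thesis .
  qed
  ultimately have "cmod (\<Sum>x\<in>X. \<theta> x * I x) \<le> M * measure lborel (cbox a b)"
    by (rule has_integral_bound[OF M(2)])
  also have "measure lborel (cbox a b) = b - a" using ab by simp
  finally have "cmod (of_real (\<Sum>x\<in>X. cmod (I x))) \<le> M * (b - a)" by (simp add: \<theta>)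
  then show "(\<Sum>x\<in>X. cmod (integral {a..b} (\<lambda>s. \<gamma>' s * \<psi> x s))) \<le> M * (b - a)"
    unfolding norm_of_real by (simp add: I_def sum_nonneg)
qed simp

subsection \<open>Uniform bounds for the resolvents\<close>

lemma inverse_difference:
  assumes "is_op_inverse (cmul z - A) R" "is_op_inverse (cmul w - A) R'" "clinear_op R"
  shows "R' - R = R o\<^sub>L cmul (z - w) o\<^sub>L R'"
proof (rule blinfun_eqI)
  fix x
  have 1: "R (cscale z y - A y) = y" "cscale w (R' y) - A (R' y) = y" for y
    using assms(1,2) unfolding is_op_inverse_def
    by (metis blinfun_apply_blinfun_compose blinfun_apply_id_blinfun id_apply blinfun.diff_left blinfun_apply_cmul)+
  have "cscale (z - w) (R' x) = (cscale z (R' x) - A (R' x)) - x"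
  proof (rule ell2_eqI)
    fix i
    have "ell2_nth x i = ell2_nth (cscale w (R' x) - A (R' x)) i" by (simp only: 1(2))
    then show "ell2_nth (cscale (z - w) (R' x)) i = ell2_nth (cscale z (R' x) - A (R' x) - x) i"
      by (simp add: ell2_nth_diff ell2_nth_add ell2_nth_cscale algebra_simps)
  qed
  then have "R (cscale (z - w) (R' x)) = R' x - R x"
    using 1(1)[of "R' x"] by (simp add: blinfun.diff_right)
  then show "(R' - R) x = (R o\<^sub>L cmul (z - w) o\<^sub>L R') x" by (simp add: blinfun.diff_left)
qed

lemma resolvent_continuous:
  assumes "\<And>z. z \<in> Z \<Longrightarrow> is_op_inverse (cmul z - A) (R z)" "\<And>z. z \<in> Z \<Longrightarrow> clinear_op (R z)"
  shows "continuous_on Z R"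
  unfolding continuous_on_iff
proof (intro ballI allI impI)
  fix z e assume z: "z \<in> Z" and e: "0 < (e::real)"
  define r where "r = norm (R z) + 1"
  have r: "0 < r" "norm (R z) \<le> r" by (auto simp: r_def add_nonneg_pos)
  \<comment> \<open>The first term keeps \<open>norm (R w)\<close> below \<open>2 * r\<close> by
    absorption, the second makes the difference smaller than \<open>e\<close>.\<close>
  define d where "d = min (1 / (2 * r)) (e / (4 * r\<^sup>2))"
  have d: "0 < d" using r e by (auto simp: d_def)
  have "dist (R w) (R z) < e" if w: "w \<in> Z" "dist w z < d" for w
  proof -
    have D: "norm (R w - R z) \<le> r * (cmod (z - w) * norm (R w))"
    proof -
      have "norm (cmul (z - w) o\<^sub>L R w) \<le> cmod (z - w) * norm (R w)"
      proof (rule norm_blinfun_bound)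
        fix x
        have "cmod (z - w) * norm (R w x) \<le> cmod (z - w) * (norm (R w) * norm x)"
          by (intro mult_left_mono norm_blinfun) auto
        then show "norm ((cmul (z - w) o\<^sub>L R w) x) \<le> cmod (z - w) * norm (R w) * norm x"
          by (simp add: norm_cscale mult.assoc)
      qed simp
      with r have "norm (R z) * norm (cmul (z - w) o\<^sub>L R w) \<le> r * (cmod (z - w) * norm (R w))"
        by (intro mult_mono) auto
      then have "norm (R z o\<^sub>L (cmul (z - w) o\<^sub>L R w)) \<le> r * (cmod (z - w) * norm (R w))"
        by (rule order_trans[OF norm_blinfun_compose])
      moreover have "R w - R z = R z o\<^sub>L (cmul (z - w) o\<^sub>L R w)"
        unfolding inverse_difference[OF assms(1)[OF z] assms(1)[OF w(1)] assms(2)[OF z]]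
        by (rule blinfun_eqI) simp
      ultimately show ?thesis by simp
    qed
    have zw: "cmod (z - w) \<le> 1 / (2 * r)" "cmod (z - w) < e / (4 * r\<^sup>2)"
      using w(2) by (auto simp: d_def dist_norm norm_minus_commute)
    have "r * (cmod (z - w) * norm (R w)) \<le> r * (1 / (2 * r) * norm (R w))"
      using r zw by (intro mult_left_mono mult_right_mono) auto
    then have "norm (R w) - norm (R z) \<le> norm (R w) / 2"
      using D norm_triangle_ineq2[of "R w" "R z"] r by simp
    then have "norm (R w) \<le> 2 * r" using r by simp
    then have "norm (R w - R z) \<le> r * (cmod (z - w) * (2 * r))"
      using r by (intro order_trans[OF D] mult_left_mono) auto
    also have "\<dots> < r * (e / (4 * r\<^sup>2) * (2 * r))"
      using r zw by (intro mult_strict_left_mono mult_strict_right_mono) auto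
    also have "\<dots> \<le> e" using r e by (simp add: field_simps power2_eq_square)
    finally show ?thesis by (simp add: dist_norm)
  qed
  with d show "\<exists>d>0. \<forall>x'\<in>Z. dist x' z < d \<longrightarrow> dist (R x') (R z) < e" by blast
qed

lemma wnorm_shifted:
  assumes "weight v"
  shows "wnorm v (shifted z a) \<le> ennreal (cmod z * v 0) + wnorm v a"
proof -
  have "wnorm v (\<lambda>k. z * cunit k) = esum (\<lambda>k :: int. ennreal (cmod z * v 0) * indicator {0} k)"
    unfolding wnorm_def by (rule esum_cong) (auto simp: cunit_def indicator_def mult.commute)
  also have "\<dots> = ennreal (cmod z * v 0)"
    unfolding esum_cmult by (simp add: esum_card)
  finally show ?thesis
    using wnorm_diff[of v "\<lambda>k. z * cunit k" a] weight_ge0[OF assms]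
    by (simp add: shifted_def[abs_def])
qed

text \<open>The local bounds hold on balls around each point. Since \<open>vt\<close> increases with
  its parameter, the smallest parameter of a finite subcover serves all of \<open>Z\<close>.\<close>

lemma uniform_inverse:
  assumes Z: "compact Z" and v: "weight v" and a: "wnorm v a < top"
    and c: "\<And>z. z \<in> Z \<Longrightarrow> c z \<in> wiener" "\<And>z. z \<in> Z \<Longrightarrow> conv (c z) (shifted z a) = cunit"
    and vt: "\<And>t. 0 < t \<Longrightarrow> t \<le> 1 \<Longrightarrow> weight (vt t)"
      "\<And>t k. 0 < t \<Longrightarrow> t \<le> 1 \<Longrightarrow> vt t k \<le> (1 - t) + t * v k"
      "\<And>s t k. 0 < s \<Longrightarrow> s \<le> t \<Longrightarrow> t \<le> 1 \<Longrightarrow> vt s k \<le> vt t k"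
  shows "\<exists>t C. 0 < t \<and> t \<le> 1 \<and> 0 \<le> C \<and> (\<forall>z\<in>Z. wnorm (vt t) (c z) \<le> ennreal C)"
proof -
  have aw: "a \<in> wiener" using wnorm1_le[OF v, of a] a by (simp add: wiener_iff order_le_less_trans)
  have sa: "wnorm v (shifted z a) < top" for z
    by (rule order_le_less_trans[OF wnorm_shifted[OF v]]) (use a in simp)
  have "\<forall>z\<in>Z. \<exists>t C. 0 < t \<and> t \<le> 1 \<and> 0 \<le> C \<and> wnorm (vt t) (c z) \<le> ennreal C"
  proof
    fix z assume z: "z \<in> Z"
    obtain t where "0 < t" "t \<le> 1" "wnorm (vt t) (c z) < top"
      using weighted_inverse[OF v sa c(1)[OF z] c(2)[OF z] vt(1,2)] by blast
    then show "\<exists>t C. 0 < t \<and> t \<le> 1 \<and> 0 \<le> C \<and> wnorm (vt t) (c z) \<le> ennreal C"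
      by (intro exI[of _ t] exI[of _ "enn2real (wnorm (vt t) (c z))"]) simp
  qed
  then obtain t C where tC: "\<And>z. z \<in> Z \<Longrightarrow> 0 < t z" "\<And>z. z \<in> Z \<Longrightarrow> t z \<le> 1" "\<And>z. z \<in> Z \<Longrightarrow> 0 \<le> C z"
    "\<And>z. z \<in> Z \<Longrightarrow> wnorm (vt (t z)) (c z) \<le> ennreal (C z)" by metis
  \<comment> \<open>The radius yields the condition \<open>cmod (z - w) * C z \<le> 1 / 2\<close> of
    \<open>resolvent_locally_bounded\<close>.\<close>
  define B where "B z = ball z (1 / (2 * (C z + 1)))" for z
  have "Z \<subseteq> (\<Union>z\<in>Z. B z)" using tC(3) by (fastforce simp: B_def)
  then obtain T where T: "T \<subseteq> Z" "finite T" "Z \<subseteq> (\<Union>z\<in>T. B z)"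
    by (rule compactE_image[OF Z, rotated]) (auto simp: B_def)
  define t' where "t' = Min (insert 1 (t ` T))"
  define C' where "C' = Max (insert 0 ((\<lambda>z. 2 * C z) ` T))"
  have t': "0 < t'" "t' \<le> 1" "\<And>z. z \<in> T \<Longrightarrow> t' \<le> t z"
    using T tC by (auto simp: t'_def)
  have C': "0 \<le> C'" "\<And>z. z \<in> T \<Longrightarrow> 2 * C z \<le> C'"
    using T by (auto simp: C'_def intro: Max_ge)
  have "wnorm (vt t') (c w) \<le> ennreal C'" if w: "w \<in> Z" for w
  proof -
    obtain z where z: "z \<in> T" "w \<in> B z" using T w by blast
    then have zZ: "z \<in> Z" using T by blast
    have "cmod (z - w) \<le> 1 / (2 * (C z + 1))" using z by (simp add: B_def dist_norm)
    then have "cmod (z - w) * C z \<le> 1 / (2 * (C z + 1)) * C z" using tC(3)[OF zZ] by (rule mult_right_mono)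
    also have "\<dots> \<le> 1 / 2" using tC(3)[OF zZ] by (simp add: field_simps)
    finally have near: "cmod (z - w) * C z \<le> 1 / 2" .
    have "wnorm (vt t') (c w) \<le> wnorm (vt (t z)) (c w)"
      by (rule wnorm_mono) (intro vt(3) t' z tC zZ)
    also have "\<dots> \<le> ennreal (2 * C z)"
      by (rule resolvent_locally_bounded[OF vt(1)[OF tC(1)[OF zZ] tC(2)[OF zZ]] aw c(1)[OF zZ] c(2)[OF zZ] c(1)[OF w] c(2)[OF w] tC(4)[OF zZ] tC(3)[OF zZ] near])
    also have "\<dots> \<le> ennreal C'" by (intro ennreal_leI C' z)
    finally show ?thesis .
  qed
  then show ?thesis using t' C' by blast
qed

text \<open>Recasts the derivative condition as a submultiplicative weight; reindexing absorbs the
  shift by one in \<open>laurent_deriv\<close>.\<close>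

lemma wiener1_iff: "a \<in> wiener1 \<longleftrightarrow> wnorm (\<lambda>k. 1 + \<bar>real_of_int k\<bar>) a < top"
proof -
  have "wnorm1 (laurent_deriv a) = esum (\<lambda>k. ennreal (\<bar>real_of_int k\<bar> * cmod (a k)))"
    using esum_shift[of "\<lambda>k. ennreal (\<bar>real_of_int k\<bar> * cmod (a k))" 1]
    by (simp add: wnorm_def laurent_deriv_def norm_mult flip: of_int_add)
  moreover have "wnorm (\<lambda>k. 1 + \<bar>real_of_int k\<bar>) a = wnorm1 a + esum (\<lambda>k. ennreal (\<bar>real_of_int k\<bar> * cmod (a k)))"
    unfolding wnorm_def by (simp add: distrib_right esum_add)
  ultimately show ?thesis by (simp add: wiener1_def wiener_iff)
qed

subsection \<open>Analytic symbols\<close>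

text \<open>The annulus contains \<open>q\<close> and \<open>1 / q\<close> for some
  \<open>q > 1\<close>. Summability at these two points is absolute, and together they dominate
  \<open>exp (ln q * |k|)\<close> for \<open>k\<close> of either sign.\<close>

lemma annulus_symbols_exp_weight:
  assumes "a \<in> annulus_symbols"
  shows "\<exists>s>0. wnorm (\<lambda>k. exp (s * \<bar>real_of_int k\<bar>)) a < top"
proof -
  obtain r R where r: "0 \<le> r" "r < 1" "1 < R"
    and sm: "\<And>z. r < cmod z \<Longrightarrow> cmod z < R \<Longrightarrow> (\<lambda>i. a i * z powi i) summable_on UNIV"
    using assms by (auto simp: annulus_symbols_def)
  \<comment> \<open>The first bound gives \<open>q < R\<close>, the second
    \<open>1 / q \<ge> (1 + r) / 2 > r\<close>.\<close>
  define q where "q = min ((1 + R) / 2) (2 / (1 + r))"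
  have q: "1 < q" "q < R" "q \<le> 2 / (1 + r)"
  proof -
    have "1 < (1 + R) / 2" "(1 + R) / 2 < R" "1 < 2 / (1 + r)" using r by (simp_all add: field_simps)
    then show "1 < q" "q < R" "q \<le> 2 / (1 + r)" by (auto simp: q_def min_less_iff_disj)
  qed
  have "r < 1 / q"
  proof -
    have "r < (1 + r) / 2" using r by simp
    also have "\<dots> \<le> 1 / q" using q r by (simp add: field_simps)
    finally show ?thesis .
  qed
  moreover have "1 / q < R" using q r by (simp add: field_simps) (smt (verit) mult_less_cancel_left2)
  ultimately have 1: "(\<lambda>i. a i * (complex_of_real (1 / q)) powi i) summable_on UNIV"
    using q by (intro sm) (auto simp: norm_divide)
  have 2: "(\<lambda>i. a i * (complex_of_real q) powi i) summable_on UNIV"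
    using q r by (intro sm) auto
  have "(\<lambda>i. cmod (a i * (complex_of_real (1 / q)) powi i) + cmod (a i * (complex_of_real q) powi i)) summable_on UNIV"
    using 1 2 by (intro summable_on_add) (simp_all add: summable_on_iff_abs_summable_on_complex)
  then have "(\<lambda>i. exp (ln q * \<bar>real_of_int i\<bar>) * cmod (a i)) summable_on UNIV"
  proof (rule summable_on_comparison_test)
    fix i :: int
    have "cmod (complex_of_real x powi i) = exp (ln x * real_of_int i)" if "0 < x" for x
      using that by (simp add: norm_power_int powr_real_of_int'[symmetric] powr_def mult.commute)
    from this[of q] this[of "1 / q"] q
    have "exp (ln q * \<bar>real_of_int i\<bar>) \<le> cmod (complex_of_real (1 / q) powi i) + cmod (complex_of_real q powi i)"
      by (cases "0 \<le> i") (auto simp: ln_div)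
    from mult_right_mono[OF this norm_ge_zero[of "a i"]]
    show "exp (ln q * \<bar>real_of_int i\<bar>) * cmod (a i)
        \<le> cmod (a i * (complex_of_real (1 / q)) powi i) + cmod (a i * (complex_of_real q) powi i)"
      by (simp add: norm_mult algebra_simps)
  qed auto
  then have "wnorm (\<lambda>k. exp (ln q * \<bar>real_of_int k\<bar>)) a < top"
    using esum_finite_iff[of "\<lambda>i. exp (ln q * \<bar>real_of_int i\<bar>) * cmod (a i)"]
    by (simp add: wnorm_def abs_mult)
  moreover have "0 < ln q" using q by simp
  ultimately show ?thesis by blast
qed

text \<open>For \<open>exp (- s) < cmod z < exp s\<close> the weight dominates the powers of
  \<open>z\<close>, so the series is a locally uniform limit of holomorphic sums.\<close>

lemma exp_weight_annulus_symbols: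
  assumes s: "0 < s" and a: "wnorm (\<lambda>k. exp (s * \<bar>real_of_int k\<bar>)) a < top"
  shows "a \<in> annulus_symbols"
proof -
  let ?M = "\<lambda>k. exp (s * \<bar>real_of_int k\<bar>) * cmod (a k)"
  define D where "D = {z. exp (- s) < cmod z \<and> cmod z < exp s}"
  have M: "?M summable_on UNIV"
    using a esum_finite_iff[of ?M] by (simp add: wnorm_def abs_mult)
  have le: "cmod (a k * z powi k) \<le> ?M k" if z: "z \<in> D" for z k
  proof -
    have z0: "0 < cmod z" using z by (auto simp: D_def intro: less_trans[OF exp_gt_zero])
    have "exp (- s) < exp (ln (cmod z))" "exp (ln (cmod z)) < exp s" using z z0 by (simp_all add: D_def)
    then have l: "\<bar>ln (cmod z)\<bar> \<le> s" by simp
    have "cmod (z powi k) = exp (ln (cmod z) * real_of_int k)"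
      using z0 by (simp add: norm_power_int powr_real_of_int'[symmetric] powr_def mult.commute)
    also have "\<dots> \<le> exp (s * \<bar>real_of_int k\<bar>)"
    proof -
      have "ln (cmod z) * real_of_int k \<le> \<bar>ln (cmod z)\<bar> * \<bar>real_of_int k\<bar>"
        by (metis abs_ge_self abs_mult)
      also have "\<dots> \<le> s * \<bar>real_of_int k\<bar>" by (intro mult_right_mono l) auto
      finally show ?thesis by simp
    qed
    finally show ?thesis by (simp add: norm_mult mult.commute mult_left_mono)
  qed
  have sm: "(\<lambda>k. a k * z powi k) summable_on UNIV" if "z \<in> D" for z
    by (rule abs_summable_summable) (rule summable_on_comparison_test[OF M], use le that in auto)
  have oD: "open D"
    unfolding D_def by (intro open_Collect_conj open_Collect_less continuous_intros)
  have "laurent a analytic_on D"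
    unfolding analytic_on_def
  proof
    fix z0 assume "z0 \<in> D"
    then obtain e where e: "e > 0" "cball z0 e \<subseteq> D" using oD open_contains_cball by blast
    have nz: "z \<noteq> 0" if "z \<in> D" for z using that by (auto simp: D_def)
    have ul: "uniform_limit (cball z0 e) (\<lambda>X z. \<Sum>k\<in>X. a k * z powi k) (\<lambda>z. \<Sum>\<^sub>\<infinity>k. a k * z powi k) (finite_subsets_at_top UNIV)"
      by (rule Weierstrass_m_test_general[OF _ M]) (use le e in auto)
    have hol: "(\<lambda>z. \<Sum>k\<in>X. a k * z powi k) holomorphic_on cball z0 e" for X
      using e nz by (intro holomorphic_intros) auto
    have "(\<lambda>z. \<Sum>\<^sub>\<infinity>k. a k * z powi k) holomorphic_on ball z0 e"
      by (rule holomorphic_uniform_limit[OF _ ul])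
        (auto intro!: always_eventually holomorphic_on_imp_continuous_on[OF hol] holomorphic_on_subset[OF hol])
    then have "laurent a holomorphic_on ball z0 e" by (simp add: laurent_def[abs_def])
    then show "\<exists>e>0. laurent a holomorphic_on ball z0 e" using e by blast
  qed
  then show ?thesis
    unfolding annulus_symbols_def
    by (intro CollectI exI[of _ "exp (- s)"] exI[of _ "exp s"]) (use s sm in \<open>auto simp: D_def\<close>)
qed

text \<open>Each symbol coefficient occurs infinitely often, so it cannot be absorbed into a summable matrix.\<close>

lemma toeplitz_unique:
  assumes E: "E \<in> fmatrices" "E' \<in> fmatrices"
    and eq: "(\<lambda>i j. toeplitz a i j + E i j) = (\<lambda>i j. toeplitz a' i j + E' i j)"
  shows "a = a'"
proof
  fix d :: int
  have "fnorm (\<lambda>i j. E' i j - E i j) \<le> fnorm E' + fnorm E"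
    using fnorm_add[of E' "\<lambda>i j. - E i j"] by simp
  also have "\<dots> < top" using E by (simp add: fmatrices_iff)
  finally have fin: "fnorm (\<lambda>i j. E' i j - E i j) < top" .
  have diff: "a (int j - int i) - a' (int j - int i) = E' i j - E i j" for i j
    using fun_cong[OF fun_cong[OF eq, of i], of j] by (simp add: toeplitz_def algebra_simps)
  \<comment> \<open>These positions run along diagonal \<open>d\<close> for either sign of
    \<open>d\<close>, as one of the two offsets is 0.\<close>
  have diag: "E' (n + nat (- d)) (n + nat d) - E (n + nat (- d)) (n + nat d) = a d - a' d" for n
    by (cases "0 \<le> d") (simp_all flip: diff)
  have "inj (\<lambda>n::nat. (n + nat (- d), n + nat d))" by (auto simp: inj_on_def)
  from esum_inj_le[OF this, of "\<lambda>(i, j). ennreal (cmod (E' i j - E i j))"]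
  have "esum (\<lambda>n::nat. ennreal (cmod (a d - a' d))) \<le> fnorm (\<lambda>i j. E' i j - E i j)"
    unfolding esum_pair fnorm_def by (simp add: diag)
  also note fin
  finally show "a d = a' d"
    by (simp add: esum_def ennreal_mult_less_top ennreal_mult_eq_top_iff less_top[symmetric])
qed

theorem theorem4p2:
  fixes a :: "int \<Rightarrow> complex" and E A :: inf_matrix
    and f :: "complex \<Rightarrow> complex" and \<Omega> :: "complex set"
    and \<gamma> :: "real \<Rightarrow> complex" and s0 s1 :: real
  assumes "a \<in> wiener1" and "E \<in> fmatrices"
    and "A = (\<lambda>i j. toeplitz a i j + E i j)"
    and "compact_domain \<Omega>"
    and "f analytic_on \<Omega>"
    and "spectrum (matrix_op A) \<subseteq> interior \<Omega>"
    and "laurent a ` sphere 0 1 \<subseteq> \<Omega>"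
    and "boundary_param \<Omega> \<gamma> s0 s1"
  shows "cauchy_integrand f \<gamma> s0 s1 (matrix_op A) integrable_on {s0..s1} \<and>
    (\<exists>B\<in>CQT. fun_of_op f \<gamma> s0 s1 (matrix_op A) = matrix_op B) \<and>
    (A \<in> AQT \<longrightarrow> (\<exists>B\<in>AQT. fun_of_op f \<gamma> s0 s1 (matrix_op A) = matrix_op B))"
proof -
  let ?Z = "frontier \<Omega>"
  let ?lin = "\<lambda>k. 1 + \<bar>real_of_int k\<bar>"
  have lin: "weight ?lin" using weight_linear[of 1] by simp
  have a1: "wnorm ?lin a < top" using assms(1) by (simp add: wiener1_iff)
  have aw: "a \<in> wiener" using linear_weight_wiener[OF a1] .
  have E': "(\<lambda>i j. - E i j) \<in> fmatrices" using assms(2) by (simp add: fmatrices_iff)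
  have clin: "clinear_op (matrix_op A)"
    using schur_bound_cqt_exists[OF aw assms(2)] clinear_matrix_op unfolding assms(3) by metis
  have Z: "compact ?Z" "?Z \<subseteq> \<Omega>"
    using assms(4) by (auto simp: compact_domain_def compact_frontier frontier_subset_compact)

  \<comment> \<open>Resolvents on the boundary\<close>
  define R where "R z = op_inverse (cmul z - matrix_op A)" for z
  have R: "is_op_inverse (cmul z - matrix_op A) (R z)" if "z \<in> ?Z" for z
  proof -
    have "z \<notin> spectrum (matrix_op A)" using that assms(6) by (auto simp: frontier_def)
    then obtain R' where "is_op_inverse (cmul z - matrix_op A) R'" by (auto simp: spectrum_def)
    with op_inverse_eq[OF this] show ?thesis by (simp add: R_def)
  qed
  have linR: "clinear_op (R z)" if "z \<in> ?Z" for z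
    by (rule clinear_inverse[OF _ R[OF that]]) (intro clinear_diff clinear_cmul clin)
  have R': "is_op_inverse (matrix_op (\<lambda>i j. toeplitz (shifted z a) i j + - E i j)) (R z)" if "z \<in> ?Z" for z
    using R[OF that] cmul_minus_matrix_op[OF aw assms(2)] by (simp add: assms(3))
  have contR: "continuous_on ?Z R" by (rule resolvent_continuous[OF R linR])
  obtain \<rho> where \<rho>: "\<And>z. z \<in> ?Z \<Longrightarrow> norm (R z) \<le> \<rho>"
    using compact_imp_bounded[OF compact_continuous_image[OF contR Z(1)]] by (auto simp: bounded_iff)
  obtain \<zeta> where \<zeta>: "0 \<le> \<zeta>" "\<And>z. z \<in> ?Z \<Longrightarrow> cmod z \<le> \<zeta>"
    using compact_imp_bounded[OF Z(1)] by (metis bounded_pos less_imp_le)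

  \<comment> \<open>Inverse symbols with uniform weighted bounds\<close>
  define \<alpha> where "\<alpha> = enn2real (wnorm ?lin a)"
  have \<alpha>: "wnorm ?lin a = ennreal \<alpha>" "0 \<le> \<alpha>" using a1 by (auto simp: \<alpha>_def)
  define \<epsilon> where "\<epsilon> = enn2real (fnorm E)"
  have \<epsilon>: "fnorm E = ennreal \<epsilon>" "0 \<le> \<epsilon>" using assms(2) by (auto simp: \<epsilon>_def fmatrices_iff)
  have sh: "wnorm ?lin (shifted z a) \<le> ennreal (\<zeta> + \<alpha>)" if "z \<in> ?Z" for z
  proof -
    have "wnorm ?lin (shifted z a) \<le> ennreal (cmod z) + ennreal \<alpha>"
      using wnorm_shifted[OF lin, of z a] by (simp add: \<alpha>)
    also have "\<dots> = ennreal (cmod z + \<alpha>)" using \<alpha> by simp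
    also have "\<dots> \<le> ennreal (\<zeta> + \<alpha>)" by (rule ennreal_leI) (use \<zeta>(2)[OF that] in simp)
    finally show ?thesis .
  qed
  have "\<forall>z\<in>?Z. \<exists>c. c \<in> wiener \<and> conv c (shifted z a) = cunit"
  proof
    fix z assume z: "z \<in> ?Z"
    have s: "wnorm ?lin (shifted z a) < top" by (rule order_le_less_trans[OF sh[OF z]]) simp
    show "\<exists>c. c \<in> wiener \<and> conv c (shifted z a) = cunit"
      using wiener_inverse[OF s laurent_nonzero[OF s E' R'[OF z]]] by blast
  qed
  then obtain c where c: "\<And>z. z \<in> ?Z \<Longrightarrow> c z \<in> wiener" "\<And>z. z \<in> ?Z \<Longrightarrow> conv (c z) (shifted z a) = cunit"
    by metis
  have "\<exists>t C. 0 < t \<and> t \<le> 1 \<and> 0 \<le> C \<and> (\<forall>z\<in>?Z. wnorm (\<lambda>k. 1 + t * \<bar>real_of_int k\<bar>) (c z) \<le> ennreal C)"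
  proof (rule uniform_inverse[OF Z(1) lin a1 c])
    show "weight (\<lambda>k. 1 + t * \<bar>real_of_int k\<bar>)" if "0 < t" for t
      using weight_linear[of t] that by simp
    show "1 + t * \<bar>real_of_int k\<bar> \<le> 1 - t + t * ?lin k" if "0 < t" for t k
      by (simp add: algebra_simps)
    show "1 + t * \<bar>real_of_int k\<bar> \<le> 1 + t' * \<bar>real_of_int k\<bar>" if "t \<le> t'" for t t' k
      using that by (simp add: mult_right_mono)
  qed
  then obtain \<tau> K where \<tau>: "0 < \<tau>" "\<tau> \<le> 1" and K: "0 \<le> K"
    "\<And>z. z \<in> ?Z \<Longrightarrow> wnorm (\<lambda>k. 1 + \<tau> * \<bar>real_of_int k\<bar>) (c z) \<le> ennreal K" by blast
  have K1: "wnorm1 (c z) \<le> ennreal K" if "z \<in> ?Z" for z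
    using \<tau> by (intro order_trans[OF wnorm_mono K(2)[OF that]]) auto
  \<comment> \<open>Linear weights of different slopes are equivalent: \<open>\<tau> \<le> 1\<close>
    gives \<open>1 + |k| \<le> (1 + \<tau> * |k|) / \<tau>\<close>.\<close>
  have K2: "wnorm ?lin (c z) \<le> ennreal (K / \<tau>)" if "z \<in> ?Z" for z
  proof -
    have "wnorm ?lin (c z) \<le> wnorm (\<lambda>k. 1 / \<tau> * (1 + \<tau> * \<bar>real_of_int k\<bar>)) (c z)"
      using \<tau> by (intro wnorm_mono) (simp add: field_simps)
    also have "\<dots> = ennreal (1 / \<tau>) * wnorm (\<lambda>k. 1 + \<tau> * \<bar>real_of_int k\<bar>) (c z)"
      using \<tau> unfolding wnorm_def
      by (subst esum_cmult[symmetric]) (simp only: mult.assoc ennreal_mult' zero_le_divide_1_iff less_imp_le)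
    also have "\<dots> \<le> ennreal (1 / \<tau>) * ennreal K" by (intro mult_left_mono K that) auto
    also have "\<dots> = ennreal (K / \<tau>)" using \<tau> K by (simp flip: ennreal_mult')
    finally show ?thesis .
  qed

  \<comment> \<open>Summable corrections of the resolvents\<close>
  define G where "G z i j = entry (R z) i j - toeplitz (c z) i j" for z i j
  define K3 where "K3 = K * (\<zeta> + \<alpha> + \<epsilon>) * (K + \<rho> * (K * (\<zeta> + \<alpha> + \<epsilon>)))"
  have fG: "fnorm (G z) \<le> ennreal K3" if z: "z \<in> ?Z" for z
    unfolding K3_def G_def[abs_def]
    by (rule inverse_correction[OF sh[OF z] _ R'[OF z] \<rho>[OF z] K1[OF z] c(2)[OF z]])
      (use \<epsilon> \<zeta> \<alpha> K in auto)

  \<comment> \<open>Regularity of the curve and continuity along it\<close>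
  have bp: "s0 < s1" "\<gamma> ` {s0..s1} = ?Z" "arc_length_param \<gamma> s0 s1"
    and df: "\<And>s. s \<in> {s0..s1} \<Longrightarrow> \<gamma> differentiable (at s within {s0..s1})"
    using assms(8) by (auto simp: boundary_param_def)
  define \<gamma>' where "\<gamma>' s = vector_derivative \<gamma> (at s within {s0..s1})" for s
  have vd: "(\<gamma> has_vector_derivative \<gamma>' s) (at s within {s0..s1})" if "s \<in> {s0..s1}" for s
    using df[OF that] unfolding \<gamma>'_def by (rule vector_derivative_works[THEN iffD1])
  have le1: "norm (\<gamma>' s) \<le> 1" if "s \<in> {s0..s1}" for s
    by (rule norm_derivative_le_one[OF vd[OF that] that bp(1) arc_length_param_lipschitz[OF bp(3)]])
  have cont\<gamma>: "continuous_on {s0..s1} \<gamma>"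
    by (rule continuous_on_vector_derivative[OF vd])
  have \<gamma>Z: "\<gamma> s \<in> ?Z" if "s \<in> {s0..s1}" for s using that bp(2) by blast
  have contZ: "continuous_on {s0..s1} (\<lambda>s. h (\<gamma> s))" if "continuous_on ?Z h" for h :: "complex \<Rightarrow> 'b::topological_space"
    by (rule continuous_on_compose2[OF that cont\<gamma>]) (use \<gamma>Z in auto)
  have contf: "continuous_on ?Z f"
    using analytic_imp_holomorphic[OF assms(5)] holomorphic_on_imp_continuous_on Z(2) continuous_on_subset by blast
  obtain \<phi> where \<phi>: "0 \<le> \<phi>" "\<And>z. z \<in> ?Z \<Longrightarrow> cmod (f z) \<le> \<phi>"
    using compact_imp_bounded[OF compact_continuous_image[OF contf Z(1)]]
    unfolding bounded_pos by (metis image_eqI less_imp_le)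
  \<comment> \<open>The inverses \<open>c z\<close> were chosen pointwise; the resolvent identity
    makes each coefficient Lipschitz in \<open>z\<close>.\<close>
  have contc: "continuous_on ?Z (\<lambda>z. c z k)" for k
  proof (rule lipschitz_on_continuous_on[of "K * K"], rule lipschitz_onI)
    fix z w assume z: "z \<in> ?Z" and w: "w \<in> ?Z"
    have "ennreal (cmod (conv (c z) (c w) k)) \<le> wnorm1 (conv (c z) (c w))" by (rule cmod_le_wnorm1)
    also have "\<dots> \<le> wnorm1 (c z) * wnorm1 (c w)" by (rule wnorm_conv_weight) simp
    also have "\<dots> \<le> ennreal K * ennreal K" by (intro mult_mono K1 z w) auto
    also have "\<dots> = ennreal (K * K)" using K(1) by (intro ennreal_mult[symmetric])
    finally have le: "cmod (conv (c z) (c w) k) \<le> K * K" using K(1) by (subst (asm) ennreal_le_iff) auto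
    have "c w k - c z k = (z - w) * conv (c z) (c w) k"
      using fun_cong[OF resolvent_identity[OF aw c[OF z] c[OF w]], of k] by simp
    then have "cmod (c w k - c z k) = cmod (z - w) * cmod (conv (c z) (c w) k)"
      by (simp add: norm_mult)
    also have "\<dots> \<le> cmod (z - w) * (K * K)" by (intro mult_left_mono le) auto
    finally show "dist (c z k) (c w k) \<le> K * K * dist z w"
      by (simp add: dist_norm norm_minus_commute[of "c z k"] mult.commute)
  qed (use K in auto)
  have contG: "continuous_on ?Z (\<lambda>z. G z i j)" for i j
    unfolding G_def toeplitz_def
    by (intro continuous_on_diff contc bounded_linear.continuous_on[OF bounded_linear_entry contR])

  \<comment> \<open>Scalar contour integrals of the coefficients\<close>
  define I where "I h = 1 / (2 * of_real pi * \<i>) * integral {s0..s1} (\<lambda>s. \<gamma>' s * (f (\<gamma> s) * h (\<gamma> s)))"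
    for h :: "complex \<Rightarrow> complex"
  have esumI: "esum (\<lambda>x. ennreal (cmod (I (h x)))) < top"
    if h: "\<And>x. continuous_on ?Z (h x)" and L: "\<And>z. z \<in> ?Z \<Longrightarrow> esum (\<lambda>x. ennreal (cmod (h x z))) \<le> ennreal L" "0 \<le> L"
    for h :: "'x \<Rightarrow> complex \<Rightarrow> complex" and L
  proof -
    have "esum (\<lambda>x. ennreal (cmod (integral {s0..s1} (\<lambda>s. \<gamma>' s * (f (\<gamma> s) * h x (\<gamma> s))))))
        \<le> ennreal (\<phi> * L * (s1 - s0))"
    proof (rule esum_integral_le[OF vd le1])
      show "continuous_on {s0..s1} (\<lambda>s. f (\<gamma> s) * h x (\<gamma> s))" for x
        by (intro continuous_on_mult contZ contf h)
      fix s assume s: "s \<in> {s0..s1}"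
      have "esum (\<lambda>x. ennreal (cmod (f (\<gamma> s) * h x (\<gamma> s)))) = ennreal (cmod (f (\<gamma> s))) * esum (\<lambda>x. ennreal (cmod (h x (\<gamma> s))))"
        by (simp add: norm_mult ennreal_mult esum_cmult)
      also have "\<dots> \<le> ennreal \<phi> * ennreal L"
        by (intro mult_mono ennreal_leI \<phi> L \<gamma>Z s) auto
      finally show "esum (\<lambda>x. ennreal (cmod (f (\<gamma> s) * h x (\<gamma> s)))) \<le> ennreal (\<phi> * L)"
        using \<phi> L by (simp add: ennreal_mult)
    qed (use bp \<phi> L in auto)
    then have "esum (\<lambda>x. ennreal (cmod (integral {s0..s1} (\<lambda>s. \<gamma>' s * (f (\<gamma> s) * h x (\<gamma> s)))))) < top"
      by (rule order_le_less_trans) simp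
    moreover have "esum (\<lambda>x. ennreal (cmod (I (h x)))) = ennreal (cmod (1 / (2 * of_real pi * \<i>))) *
        esum (\<lambda>x. ennreal (cmod (integral {s0..s1} (\<lambda>s. \<gamma>' s * (f (\<gamma> s) * h x (\<gamma> s))))))"
      unfolding I_def norm_mult by (simp add: ennreal_mult'' esum_cmult)
    ultimately show ?thesis by (simp add: ennreal_mult_less_top)
  qed
  define cb where "cb k = I (\<lambda>z. c z k)" for k
  define Gb where "Gb i j = I (\<lambda>z. G z i j)" for i j
  have wcb: "wnorm v cb < top" if v: "\<And>k. 0 \<le> v k" and L: "\<And>z. z \<in> ?Z \<Longrightarrow> wnorm v (c z) \<le> ennreal L" "0 \<le> L" for v L
  proof -
    \<comment> \<open>The weight is moved under the integral, which reduces the weighted norm to a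
      plain sum.\<close>
    have "esum (\<lambda>k. ennreal (cmod (I (\<lambda>z. of_real (v k) * c z k)))) < top"
      by (rule esumI[OF _ _ L(2)]) (use L(1) v in \<open>auto intro!: continuous_intros contc simp: wnorm_def norm_mult\<close>)
    moreover have "I (\<lambda>z. of_real (v k) * c z k) = of_real (v k) * cb k" for k
      by (simp add: I_def cb_def mult.left_commute[of _ "of_real (v k)"])
    ultimately show ?thesis using v by (simp add: wnorm_def norm_mult)
  qed
  have cb1: "cb \<in> wiener1"
    unfolding wiener1_iff by (rule wcb[OF _ K2]) (use K \<tau> in auto)
  then have cbw: "cb \<in> wiener" by (simp add: wiener1_def)
  have Gbf: "Gb \<in> fmatrices"
  proof -
    have "esum (\<lambda>p. ennreal (cmod (I (case p of (i, j) \<Rightarrow> (\<lambda>z. G z i j))))) < top"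
    proof (rule esumI)
      show "continuous_on ?Z (case p of (i, j) \<Rightarrow> (\<lambda>z. G z i j))" for p
        by (cases p) (simp add: contG)
      \<comment> \<open>\<open>\<rho>\<close> was obtained without a sign, so \<open>max\<close>
        supplies the nonnegative bound that \<open>esumI\<close> asks for.\<close>
      show "esum (\<lambda>p. ennreal (cmod ((case p of (i, j) \<Rightarrow> (\<lambda>z. G z i j)) z))) \<le> ennreal (max 0 K3)" if "z \<in> ?Z" for z
      proof -
        have "esum (\<lambda>p. ennreal (cmod ((case p of (i, j) \<Rightarrow> (\<lambda>z. G z i j)) z))) = esum (\<lambda>(i, j). ennreal (cmod (G z i j)))"
          by (rule esum_cong) auto
        also have "\<dots> \<le> ennreal (max 0 K3)"
          unfolding esum_pair fnorm_def[symmetric]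
          by (rule order_trans[OF fG[OF that] ennreal_leI]) simp
        finally show ?thesis .
      qed
    qed simp
    moreover have "esum (\<lambda>p. ennreal (cmod (I (case p of (i, j) \<Rightarrow> (\<lambda>z. G z i j))))) = esum (\<lambda>(i, j). ennreal (cmod (Gb i j)))"
      by (rule esum_cong) (auto simp: Gb_def)
    ultimately show ?thesis by (simp add: fmatrices_iff fnorm_def esum_pair)
  qed

  \<comment> \<open>The operator-valued integral and its entries\<close>
  let ?F = "cauchy_integrand f \<gamma> s0 s1 (matrix_op A)"
  have F: "?F = (\<lambda>s. cmul (\<gamma>' s) o\<^sub>L (cmul (f (\<gamma> s)) o\<^sub>L R (\<gamma> s)))"
    unfolding cauchy_integrand_def \<gamma>'_def R_def cmul_mult_compose ..
  have int: "?F integrable_on {s0..s1}"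
    unfolding F
  proof (rule integrable_derivative_times[OF bounded_bilinear_cmul vd le1])
    show "continuous_on {s0..s1} (\<lambda>s. cmul (f (\<gamma> s)) o\<^sub>L R (\<gamma> s))"
      by (rule bounded_bilinear.continuous_on[OF bounded_bilinear_cmul]) (intro contZ contf contR)+
  qed
  define J where "J = integral {s0..s1} ?F"
  have J: "(?F has_integral J) {s0..s1}" unfolding J_def by (rule integrable_integral[OF int])
  have linJ: "clinear_op J"
  proof -
    \<comment> \<open>Complex linearity as commutation with \<open>cmul d\<close>, which passes
      under the integral since composition on either side is bounded and linear.\<close>
    have "J o\<^sub>L cmul d = cmul d o\<^sub>L J" for d
    proof (rule has_integral_unique)
      show "((\<lambda>s. ?F s o\<^sub>L cmul d) has_integral (J o\<^sub>L cmul d)) {s0..s1}"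
        using has_integral_linear[OF J bounded_bilinear.bounded_linear_left[OF bounded_bilinear_blinfun_compose, of "cmul d"]]
        by (simp add: o_def)
      have "((\<lambda>s. cmul d o\<^sub>L ?F s) has_integral (cmul d o\<^sub>L J)) {s0..s1}"
        using has_integral_linear[OF J bounded_bilinear.bounded_linear_right[OF bounded_bilinear_blinfun_compose, of "cmul d"]]
        by (simp add: o_def)
      moreover have "cmul d o\<^sub>L ?F s = ?F s o\<^sub>L cmul d" if "s \<in> {s0..s1}" for s
      proof (rule blinfun_eqI)
        fix x
        have "clinear_op (?F s)" unfolding F by (intro clinear_compose clinear_cmul linR \<gamma>Z that)
        then show "(cmul d o\<^sub>L ?F s) x = (?F s o\<^sub>L cmul d) x" by (simp add: clinear_op_def)
      qed
      ultimately show "((\<lambda>s. ?F s o\<^sub>L cmul d) has_integral (cmul d o\<^sub>L J)) {s0..s1}"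
        by (rule has_integral_eq[rotated])
    qed
    then show ?thesis
      unfolding clinear_op_def by (metis blinfun_apply_blinfun_compose blinfun_apply_cmul)
  qed
  let ?B = "\<lambda>i j. toeplitz cb i j + Gb i j"
  have eq: "fun_of_op f \<gamma> s0 s1 (matrix_op A) = matrix_op ?B"
  proof -
    obtain C where C: "schur_bound C ?B" using schur_bound_cqt_exists[OF cbw Gbf] .
    show ?thesis
    proof (rule clinear_op_eqI)
      show "clinear_op (fun_of_op f \<gamma> s0 s1 (matrix_op A))"
        unfolding fun_of_op_def J_def[symmetric] by (intro clinear_compose clinear_cmul linJ)
      show "clinear_op (matrix_op ?B)" by (rule clinear_matrix_op[OF C])
      fix i j
      have "((\<lambda>s. entry (?F s) i j) has_integral entry J i j) {s0..s1}"
        using has_integral_linear[OF J bounded_linear_entry] by (simp add: o_def)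
      moreover have "entry (?F s) i j = \<gamma>' s * (f (\<gamma> s) * c (\<gamma> s) (int j - int i)) + \<gamma>' s * (f (\<gamma> s) * G (\<gamma> s) i j)" for s
        by (simp add: F entry_cmul_compose G_def toeplitz_def algebra_simps)
      moreover have "((\<lambda>s. \<gamma>' s * (f (\<gamma> s) * h (\<gamma> s))) has_integral (2 * of_real pi * \<i> * I h)) {s0..s1}"
        if "continuous_on ?Z h" for h
      proof -
        have "(\<lambda>s. \<gamma>' s * (f (\<gamma> s) * h (\<gamma> s))) integrable_on {s0..s1}"
          by (rule integrable_derivative_times[OF bounded_bilinear_mult vd le1])
            (assumption | intro continuous_on_mult contZ contf that)+
        from integrable_integral[OF this] show ?thesis by (simp add: I_def)
      qed
      note this[OF contc[of "int j - int i"]] this[OF contG[of i j]]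
      ultimately have "entry J i j = 2 * of_real pi * \<i> * cb (int j - int i) + 2 * of_real pi * \<i> * Gb i j"
        unfolding cb_def Gb_def by (auto intro: has_integral_unique has_integral_add)
      then show "entry (fun_of_op f \<gamma> s0 s1 (matrix_op A)) i j = entry (matrix_op ?B) i j"
        unfolding fun_of_op_def J_def[symmetric] entry_cmul_compose entry_matrix_op[OF C]
        by (simp add: toeplitz_def field_simps)
    qed
  qed

  \<comment> \<open>Membership in the two matrix classes\<close>
  have "?B \<in> CQT" unfolding CQT_def using cb1 Gbf by blast
  moreover have "?B \<in> AQT" if "A \<in> AQT"
  proof -
    obtain a' E'' where A: "A = (\<lambda>i j. toeplitz a' i j + E'' i j)" "a' \<in> annulus_symbols" "E'' \<in> fmatrices"
      using \<open>A \<in> AQT\<close> by (auto simp: AQT_def)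
    \<comment> \<open>A priori the analytic symbol belongs to another decomposition of
      \<open>A\<close> than the given one.\<close>
    have "a = a'" using toeplitz_unique[OF assms(2) A(3)] A(1) assms(3) by simp
    then obtain s where s: "0 < s" "wnorm (\<lambda>k. exp (s * \<bar>real_of_int k\<bar>)) a < top"
      using annulus_symbols_exp_weight A(2) by blast
    \<comment> \<open>Here \<open>t\<close> narrows the annulus of \<open>a\<close> to one that
      serves all boundary points at once.\<close>
    have "\<exists>t C. 0 < t \<and> t \<le> 1 \<and> 0 \<le> C \<and> (\<forall>z\<in>?Z. wnorm (\<lambda>k. exp (t * (s * \<bar>real_of_int k\<bar>))) (c z) \<le> ennreal C)"
    proof (rule uniform_inverse[OF Z(1) weight_exp[OF less_imp_le[OF s(1)], unfolded of_int_abs] s(2) c])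
      show "weight (\<lambda>k. exp (t * (s * \<bar>real_of_int k\<bar>)))" if "0 < t" for t
        using weight_exp[of "t * s"] that s by (simp add: mult.assoc)
      show "exp (t * (s * \<bar>real_of_int k\<bar>)) \<le> 1 - t + t * exp (s * \<bar>real_of_int k\<bar>)" if "0 < t" "t \<le> 1" for t k
        by (rule exp_convex_weight[OF that])
      show "exp (t * (s * \<bar>real_of_int k\<bar>)) \<le> exp (t' * (s * \<bar>real_of_int k\<bar>))" if "t \<le> t'" for t t' k
        using that s by (simp add: mult_right_mono)
    qed
    then obtain t C where t: "0 < t" "0 \<le> C"
      "\<And>z. z \<in> ?Z \<Longrightarrow> wnorm (\<lambda>k. exp (t * (s * \<bar>real_of_int k\<bar>))) (c z) \<le> ennreal C" by blast
    have "wnorm (\<lambda>k. exp (t * (s * \<bar>real_of_int k\<bar>))) cb < top"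
      by (rule wcb[OF _ t(3,2)]) auto
    then have "cb \<in> annulus_symbols"
      using s t by (intro exp_weight_annulus_symbols[of "t * s"]) (auto simp: mult.assoc)
    then show ?thesis unfolding AQT_def using Gbf by blast
  qed
  ultimately show ?thesis using int eq by blast
qed

end
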